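(* For every $\varepsilon>0$ and integers $1\le d\le k-1$ there exists $n_0\in\mathbb{N}$ such that the following holds for all $n>n_0$ with $k\mid n$. Every $n$-vertex $k$-graph system $\mathbf{H}=\{H_1,\ldots,H_{n/k}\}$ with $\delta_d(H_i)\ge(\max\{c_{k,d},\frac12\}+\varepsilon)\binom{n-d}{k-d}$ for each $i$ admits a rainbow perfect matching.
   Context: A $k$-graph system $\mathbf{H}=\{H_1,\ldots,H_m\}$ is a collection of not necessarily distinct $k$-uniform hypergraphs on the same vertex set. For a $k$-graph $H$ and a $d$-set $S$, $d_H(S)$ is the number of edges containing $S$, and $\delta_d(H)$ is the minimum of $d_H(S)$ over all $d$-subsets $S$ of $V(H)$. A fractional matching of $H$ is a function $f:E(H)\to[0,1]$ with $\sum_{e\ni v}f(e)\le 1$ for all $v$; it is perfect if equality holds for every $v$. $c_{k,d}$ denotes the minimum $d$-degree threshold for perfect fractional matchings: the infimum of $c$ such that for every $\varepsilon>0$ and all sufficiently large $n$, every $n$-vertex $k$-graph $H$ with $\delta_d(H)\ge(c+\varepsilon)\binom{n-d}{k-d}$ has a perfect fractional matching. A rainbow perfect matching of $\mathbf{H}=\{H_1,\ldots,H_{n/k}\}$ is a perfect matching $\{e_1,\ldots,e_{n/k}\}$ of the common vertex set with $e_i\in E(H_i)$ for each $i$. *)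

theory Defs
  imports Complex_Main "HOL-Library.Disjoint_Sets"
begin

text \<open>A hypergraph is given by its vertex set \<open>V\<close> and its edge set \<open>E\<close>.\<close>

definition k_graph :: "nat \<Rightarrow> 'a set \<Rightarrow> 'a set set \<Rightarrow> bool" where
  "k_graph k V E \<longleftrightarrow> finite V \<and> (\<forall>e\<in>E. e \<subseteq> V \<and> card e = k)"

definition set_degree :: "'a set set \<Rightarrow> 'a set \<Rightarrow> nat" where
  "set_degree E S = card {e \<in> E. S \<subseteq> e}"

text \<open>The minimum is over a nonempty finite set as soon as \<open>d \<le> card V\<close>; for smaller
  \<open>V\<close> the value is unspecified.\<close>

definition min_degree :: "nat \<Rightarrow> 'a set \<Rightarrow> 'a set set \<Rightarrow> nat" where
  "min_degree d V E = Min (set_degree E ` {S. S \<subseteq> V \<and> card S = d})"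

definition fractional_matching :: "'a set \<Rightarrow> 'a set set \<Rightarrow> ('a set \<Rightarrow> real) \<Rightarrow> bool" where
  "fractional_matching V E f \<longleftrightarrow>
     (\<forall>e\<in>E. 0 \<le> f e \<and> f e \<le> 1) \<and> (\<forall>v\<in>V. (\<Sum>e\<in>{e \<in> E. v \<in> e}. f e) \<le> 1)"

definition perfect_fractional_matching ::
    "'a set \<Rightarrow> 'a set set \<Rightarrow> ('a set \<Rightarrow> real) \<Rightarrow> bool" where
  "perfect_fractional_matching V E f \<longleftrightarrow>
     fractional_matching V E f \<and> (\<forall>v\<in>V. (\<Sum>e\<in>{e \<in> E. v \<in> e}. f e) = 1)"

text \<open>The threshold \<open>c\<^sub>k\<^sub>,\<^sub>d\<close>. Vertices are natural numbers because a constant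
  cannot quantify over vertex types; up to isomorphism this covers every finite hypergraph.
  For \<open>1 \<le> d < k\<close> the infimum is over a nonempty set that is bounded below: it contains
  \<open>1\<close> (for large \<open>n\<close> no \<open>H\<close> satisfies the degree condition) and no negative number
  (edgeless hypergraphs with vertices have no perfect fractional matching).\<close>

definition pfm_threshold :: "nat \<Rightarrow> nat \<Rightarrow> real" where
  "pfm_threshold k d = Inf {c :: real. \<forall>\<epsilon>>0. \<exists>n0. \<forall>n\<ge>n0. \<forall>(V :: nat set) E.
     k_graph k V E \<and> card V = n \<and>
     real (min_degree d V E) \<ge> (c + \<epsilon>) * real ((n - d) choose (k - d)) \<longrightarrow>
     (\<exists>f. perfect_fractional_matching V E f)}"

definition k_graph_system :: "nat \<Rightarrow> 'a set \<Rightarrow> nat \<Rightarrow> (nat \<Rightarrow> 'a set set) \<Rightarrow> bool" where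
  "k_graph_system k V m H \<longleftrightarrow> (\<forall>i\<in>{1..m}. k_graph k V (H i))"

definition perfect_matching :: "'a set \<Rightarrow> 'a set set \<Rightarrow> bool" where
  "perfect_matching V M \<longleftrightarrow> disjoint M \<and> \<Union>M = V"

definition rainbow_perfect_matching ::
    "'a set \<Rightarrow> nat \<Rightarrow> (nat \<Rightarrow> 'a set set) \<Rightarrow> (nat \<Rightarrow> 'a set) \<Rightarrow> bool" where
  "rainbow_perfect_matching V m H e \<longleftrightarrow>
     (\<forall>i\<in>{1..m}. e i \<in> H i) \<and> inj_on e {1..m} \<and> perfect_matching V (e ` {1..m})"

end

theory Submission
  imports Defs "HOL-Library.FuncSet"
begin

text \<open>
  The perfect matching consists of an absorbing family, chosen first, and a near-perfect rainbow
  matching of the remaining colours and vertices, whose leftover the family absorbs.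

  \<^emph>\<open>Near-perfect matching.\<close> View an edge \<open>e\<close> of colour \<open>c\<close> as a tuple \<open>(c, v\<^sub>1, \<dots>, v\<^sub>k)\<close> over the
  disjoint union of colours and vertices. By linear programming duality and the definition of the
  threshold, a weighting whose total is too small for a fractional cover leaves not just one edge but
  a positive proportion of all tuples uncovered. Hence, given the current vertex loads, there is
  always a large box of tuples with small total load in which every large subbox contains an edge.
  Adding boxes repeatedly keeps the loads balanced, because the sum of the squared loads is
  controlled. When the average load reaches a fixed large constant, almost every load is near that
  constant; sharing the vertices out among the bounded number of boxes and matching greedily inside
  each box covers almost everything.

  \<^emph>\<open>Absorption.\<close> A relative minimum \<open>d\<close>-degree above \<open>1/2\<close> gives relative vertex degrees above \<open>1/2\<close>, so
  any two vertices have many common links in every colour. To absorb a \<open>k\<close>-set \<open>{v\<^sub>1, \<dots>, v\<^sub>k}\<close> and a colour \<open>c\<close>, take an edge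
  \<open>{x\<^sub>1, \<dots>, x\<^sub>k}\<close> of colour \<open>c\<close> and common links \<open>S\<^sub>i\<close> of \<open>x\<^sub>i\<close> and \<open>v\<^sub>i\<close> in colours \<open>c\<^sub>i\<close>: the edges
  \<open>S\<^sub>i + x\<^sub>i\<close> can be replaced by the edges \<open>S\<^sub>i + v\<^sub>i\<close> and \<open>{x\<^sub>1, \<dots>, x\<^sub>k}\<close>.
\<close>

section \<open>Lower regular boxes\<close>

text \<open>The delicate point is the passage from one uncovered edge to a positive proportion of
  them. Deleting the few light edges of a hypergraph may ruin the degree of the
  \<open>d\<close>-sets on which they concentrate, so the threshold cannot be applied to what
  remains. It is applied to the hypergraph of all \<open>k\<close>-sets that are heavy for a
  slightly raised weighting, edges or not: its degrees are bounded below by those of a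
  \<open>d\<close>-set of light vertices that lies in few light edges, and its perfect fractional
  matching then contradicts the small total weight by weak duality.

  The order of the constants decides the form of the statements. Absorption yields the leftover
  proportion \<open>\<sigma>\<close>, which is the error allowed in the near-perfect matching; this
  error fixes the slack \<open>\<gamma>\<close> of the fractional covers, and only then comes the
  proportion \<open>\<delta>\<close> of uncovered tuples, which may be arbitrarily small.

  The number of boxes has to be bounded independently of \<open>n\<close>, since the rounding error
  grows exponentially with it; hence each box takes a fixed proportion of all points.\<close>

definition lower_regular :: "nat \<Rightarrow> nat \<Rightarrow> (nat \<Rightarrow> 'x) set \<Rightarrow> (nat \<Rightarrow> 'x set) \<Rightarrow> bool" where
  "lower_regular q r F A \<longleftrightarrow>
     (\<forall>B. (\<forall>i<r. B i \<subseteq> A i \<and> card (A i) \<le> q * card (B i)) \<longrightarrow> F \<inter> PiE {..<r} B \<noteq> {})"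

text \<open>The partition is given by a colouring \<open>f\<close>, so that choosing one block in
  every coordinate becomes a tuple of numbers below \<open>q\<close>. Class 0 is prescribed: the
  density increment below puts the edgeless subbox there.\<close>

lemma obtain_blocks:
  assumes "finite A" "card A = q * b" "B \<subseteq> A" "card B = b" "q > 0"
  obtains f :: "'x \<Rightarrow> nat" where "\<And>j. j < q \<Longrightarrow> card {x \<in> A. f x = j} = b" "f ` A \<subseteq> {..<q}"
    "{x \<in> A. f x = 0} = B"
proof (cases "b = 0")
  case True
  then show ?thesis using assms that[of "\<lambda>_. 0"] by (auto simp: finite_subset)
next
  case False
  have fB: "finite B" using assms finite_subset by blast
  obtain g where g: "bij_betw g B {0..<b}" using ex_bij_betw_finite_nat[OF fB] assms by auto
  have "card (A - B) = (q - 1) * b" using assms fB by (simp add: card_Diff_subset diff_mult_distrib)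
  then obtain h where h: "bij_betw h (A - B) {0..<(q-1)*b}"
    using ex_bij_betw_finite_nat[of "A - B"] assms by auto
  \<comment> \<open>Outside \<open>B\<close> an enumeration \<open>h\<close> is cut into consecutive
    runs of length \<open>b\<close>; the shift by \<open>Suc\<close> leaves the number 0 to
    \<open>B\<close>.\<close>
  define f where "f x = (if x \<in> B then 0 else Suc (h x div b))" for x
  have f0: "{x \<in> A. f x = 0} = B" using assms by (auto simp: f_def)
  have c: "card {x \<in> A. f x = j} = b" if "j < q" for j
  proof (cases j)
    case 0 then show ?thesis using f0 assms by simp
  next
    case (Suc i)
    have inj: "inj_on h (A - B)" using h by (simp add: bij_betw_def)
    have e: "{x \<in> A. f x = j} = {x \<in> A - B. h x div b = i}" using Suc by (auto simp: f_def)
    have "h ` {x \<in> A - B. h x div b = i} = {y \<in> {0..<(q-1)*b}. y div b = i}"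
      using bij_betw_imp_surj_on[OF h] by (auto simp del: atLeastLessThan_iff)
    also have "\<dots> = {i*b..<(i+1)*b}"
    proof -
      have le: "(i+1)*b \<le> (q-1)*b" using Suc that by (intro mult_right_mono) auto
      have "y div b = i \<longleftrightarrow> i*b \<le> y \<and> y < (i+1)*b" for y
      proof
        assume "y div b = i"
        then show "i*b \<le> y \<and> y < (i+1)*b" using False dividend_less_div_times[of b y] by auto
      next
        assume "i*b \<le> y \<and> y < (i+1)*b"
        then show "y div b = i" by (intro div_nat_eqI) (auto simp: algebra_simps)
      qed
      then have "y \<in> {y \<in> {0..<(q-1)*b}. y div b = i} \<longleftrightarrow> y \<in> {i*b..<(i+1)*b}" for y
        using less_le_trans[OF _ le, of y] by (simp only: mem_Collect_eq atLeastLessThan_iff) blast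
      then show ?thesis by blast
    qed
    finally have "card (h ` {x \<in> A - B. h x div b = i}) = b" by simp
    moreover have "card (h ` {x \<in> A - B. h x div b = i}) = card {x \<in> A - B. h x div b = i}"
      by (rule card_image, rule inj_on_subset[OF inj]) auto
    ultimately show ?thesis using e by simp
  qed
  have im: "f ` A \<subseteq> {..<q}"
  proof
    fix y assume "y \<in> f ` A"
    then obtain x where x: "x \<in> A" "y = f x" by auto
    show "y \<in> {..<q}"
    proof (cases "x \<in> B")
      case True then show ?thesis using x assms by (simp add: f_def)
    next
      case False
      then have "h x < (q-1)*b" using h x by (auto simp: bij_betw_def)
      then have "h x div b < q - 1" by (simp add: less_mult_imp_div_less)
      then show ?thesis using x False by (simp add: f_def)
    qed
  qed
  show ?thesis using that[of f] c f0 im by blast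
qed

text \<open>Density increment. If the box is not lower regular, an edgeless subbox can be trimmed to
  exactly one \<open>q\<close>-th of every side. Cutting each side into \<open>q\<close> equal
  blocks gives \<open>q ^ r\<close> subboxes, one of them edgeless, so some other one has density at
  least \<open>\<theta>\<close> times the old bound. Sides of the form \<open>b * q ^ j\<close> keep
  every cut exact, and since no density exceeds 1, a lower regular box appears before the cuts run
  out.\<close>

lemma lower_regular_subbox:
  fixes \<rho> \<theta> :: real and F :: "(nat \<Rightarrow> 'x) set"
  assumes "q \<ge> 2" "r \<ge> 1" "b > 0" and \<theta>: "\<theta> = real (q ^ r) / real (q ^ r - 1)"
    and "\<And>i. i < r \<Longrightarrow> finite (A i) \<and> card (A i) = b * q ^ j"
    and "real (card (F \<inter> PiE {..<r} A)) \<ge> \<rho> * real ((b * q ^ j) ^ r)" "\<rho> * \<theta> ^ j > 1"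
  shows "\<exists>B j'. (\<forall>i<r. B i \<subseteq> A i \<and> card (B i) = b * q ^ j') \<and> lower_regular q r F B"
  using assms(5-)
proof (induction j arbitrary: A \<rho>)
  case 0
  have "card (F \<inter> PiE {..<r} A) \<le> card (PiE {..<r} A)"
    by (intro card_mono finite_PiE) (use 0 in auto)
  also have "\<dots> = b ^ r" using 0 by (simp add: card_PiE)
  finally have "real (card (F \<inter> PiE {..<r} A)) \<le> real (b ^ r)" by (simp only: of_nat_le_iff)
  then have "\<rho> * real (b ^ r) \<le> 1 * real (b ^ r)" using 0(2) by (simp only: power_0 mult_1_right)
  then have "\<rho> \<le> 1" using \<open>b > 0\<close> by (simp only: mult_le_cancel_right) auto
  then show ?case using 0 by simp
next
  case (Suc j)
  show ?case
  proof (cases "lower_regular q r F A")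
    case True then show ?thesis using Suc.prems by blast
  next
    case False
    then obtain B where B: "\<And>i. i < r \<Longrightarrow> B i \<subseteq> A i" "\<And>i. i < r \<Longrightarrow> card (A i) \<le> q * card (B i)"
      and FB: "F \<inter> PiE {..<r} B = {}" unfolding lower_regular_def by auto
    define s where "s = b * q ^ j"
    have cA: "finite (A i)" "card (A i) = q * s" if "i < r" for i
      using Suc.prems(1)[OF that] by (auto simp: s_def)
    have sB: "s \<le> card (B i)" if "i < r" for i
      using B(2)[OF that] cA(2)[OF that] \<open>q \<ge> 2\<close> by simp
    have "\<exists>C. C \<subseteq> B i \<and> card C = s" if "i < r" for i
      using obtain_subset_with_card_n[OF sB[OF that]] by metis
    then obtain C where C: "\<And>i. i < r \<Longrightarrow> C i \<subseteq> B i" "\<And>i. i < r \<Longrightarrow> card (C i) = s" by metis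
    define Q where "Q i f \<longleftrightarrow> (\<forall>l<q. card {x \<in> A i. f x = l} = s) \<and> f ` A i \<subseteq> {..<q} \<and> {x \<in> A i. f x = 0} = C i"
      for i and f :: "'x \<Rightarrow> nat"
    have "\<exists>f. Q i f"
      if "i < r" for i
    proof -
      have 1: "C i \<subseteq> A i" using B(1)[OF that] C(1)[OF that] by auto
      have 2: "q > 0" using \<open>q \<ge> 2\<close> by simp
      obtain f :: "'x \<Rightarrow> nat" where "\<And>l. l < q \<Longrightarrow> card {x \<in> A i. f x = l} = s"
        "f ` A i \<subseteq> {..<q}" "{x \<in> A i. f x = 0} = C i"
        by (rule obtain_blocks[OF cA(1)[OF \<open>i < r\<close>] cA(2)[OF \<open>i < r\<close>] 1 C(2)[OF \<open>i < r\<close>] 2]) blast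
      then show ?thesis unfolding Q_def by blast
    qed
    then obtain f where "\<And>i. i < r \<Longrightarrow> Q i (f i)" by metis
    then have f: "\<And>i l. i < r \<Longrightarrow> l < q \<Longrightarrow> card {x \<in> A i. f i x = l} = s"
      "\<And>i. i < r \<Longrightarrow> f i ` A i \<subseteq> {..<q}" "\<And>i. i < r \<Longrightarrow> {x \<in> A i. f i x = 0} = C i"
      unfolding Q_def by blast+
    \<comment> \<open>\<open>g\<close> selects a block in each coordinate and \<open>P g\<close> is
      the resulting subbox; the zero selection \<open>z\<close> gives the edgeless one.\<close>
    define P where "P g i = {x \<in> A i. f i x = g i}" for g :: "nat \<Rightarrow> nat" and i
    define G where "G = PiE {..<r} (\<lambda>_. {..<q})"
    define z where "z = (\<lambda>i\<in>{..<r}. 0 :: nat)"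
    have zG: "z \<in> G" using \<open>q \<ge> 2\<close> by (auto simp: G_def z_def)
    have fG: "finite G" by (auto simp: G_def intro: finite_PiE)
    have cG: "card G = q ^ r" by (simp add: G_def card_PiE)
    have fA: "finite (PiE {..<r} A)" by (rule finite_PiE) (use cA in auto)
    have empty: "F \<inter> PiE {..<r} (P z) = {}"
    proof -
      have "P z i \<subseteq> B i" if "i < r" for i
        using f(3)[OF that] C(1)[OF that] that by (simp add: P_def z_def)
      then have "PiE {..<r} (P z) \<subseteq> PiE {..<r} B" by (intro PiE_mono) auto
      then have "F \<inter> PiE {..<r} (P z) \<subseteq> F \<inter> PiE {..<r} B" by (rule Int_mono[OF subset_refl])
      then show ?thesis using FB by (simp only: subset_empty)
    qed
    have sub: "F \<inter> PiE {..<r} A \<subseteq> (\<Union>g\<in>G - {z}. F \<inter> PiE {..<r} (P g))"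
    proof
      fix x assume x: "x \<in> F \<inter> PiE {..<r} A"
      define g where "g = (\<lambda>i\<in>{..<r}. f i (x i))"
      have "f i (x i) < q" if "i < r" for i
        using x f(2)[OF that] that by (auto simp: PiE_iff)
      then have "g \<in> G" by (simp add: G_def g_def)
      moreover have xP: "x \<in> PiE {..<r} (P g)"
        using x by (auto simp: P_def g_def PiE_iff)
      moreover have "g \<noteq> z"
      proof
        assume "g = z"
        then have "x \<in> F \<inter> PiE {..<r} (P z)" using xP x by simp
        then show False using empty by simp
      qed
      ultimately show "x \<in> (\<Union>g\<in>G - {z}. F \<inter> PiE {..<r} (P g))"
        using x by (intro UN_I[of g]) simp_all
    qed
    \<comment> \<open>Averaging over the other \<open>q ^ r - 1\<close> subboxes: the fullest of
      them carries the induction.\<close>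
    define m where "m = Max ((\<lambda>g. card (F \<inter> PiE {..<r} (P g))) ` (G - {z}))"
    have qr: "q ^ r \<ge> 2" using \<open>q \<ge> 2\<close> \<open>r \<ge> 1\<close>
      using self_le_power[of q r] by linarith
    have ne: "G - {z} \<noteq> {}" 
    proof
      assume "G - {z} = {}" then have "G = {z}" using zG by auto
      then have "card G = 1" by simp
      then show False using cG qr by linarith
    qed
    have "card (F \<inter> PiE {..<r} A) \<le> card (\<Union>g\<in>G - {z}. F \<inter> PiE {..<r} (P g))"
    proof (rule card_mono[OF _ sub], rule finite_UN_I)
      show "finite (G - {z})" using fG by simp
      show "finite (F \<inter> PiE {..<r} (P g))" for g
        by (rule finite_Int, rule disjI2, rule finite_PiE) (auto simp: P_def cA)
    qed
    also have "\<dots> \<le> (\<Sum>g\<in>G - {z}. card (F \<inter> PiE {..<r} (P g)))" by (rule card_UN_le) (use fG in simp)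
    also have "\<dots> \<le> (\<Sum>g\<in>G - {z}. m)" unfolding m_def
      by (rule sum_mono, rule Max_ge) (use fG in auto)
    also have "\<dots> = (q ^ r - 1) * m" using zG fG cG by (simp add: card_Diff_singleton)
    finally have le: "card (F \<inter> PiE {..<r} A) \<le> (q ^ r - 1) * m" .
    have "m \<in> (\<lambda>g. card (F \<inter> PiE {..<r} (P g))) ` (G - {z})"
      unfolding m_def by (rule Max_in) (use fG ne in auto)
    then obtain g where g: "g \<in> G" "m = card (F \<inter> PiE {..<r} (P g))" by auto
    have cP: "finite (P g i) \<and> card (P g i) = b * q ^ j" if "i < r" for i
    proof -
      have "g i < q" using g that by (auto simp: G_def)
      then show ?thesis using f(1)[OF that] cA[OF that] by (simp add: P_def s_def)
    qed
    have "\<rho> * real ((b * q ^ Suc j) ^ r) = (\<rho> * \<theta> * real (s ^ r)) * real (q ^ r - 1)"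
    proof -
      have "real (q ^ r - 1) \<noteq> 0" using qr by (simp only: of_nat_eq_0_iff)
      then have "\<theta> * real (q ^ r - 1) = real (q ^ r)" unfolding \<theta> by (simp only: times_divide_eq_left nonzero_mult_div_cancel_right if_False not_False_eq_True)
      moreover have "b * q ^ Suc j = q * s" by (simp add: s_def)
      ultimately have "\<rho> * real ((b * q ^ Suc j) ^ r) = \<rho> * real (s ^ r) * (\<theta> * real (q ^ r - 1))"
        by (simp only: power_mult_distrib of_nat_mult mult_ac)
      then show ?thesis by (simp only: mult_ac)
    qed
    moreover have "real (card (F \<inter> PiE {..<r} A)) \<le> real m * real (q ^ r - 1)"
      using le by (simp flip: of_nat_mult add: mult.commute)
    ultimately have "(\<rho> * \<theta> * real (s ^ r)) * real (q ^ r - 1) \<le> real m * real (q ^ r - 1)"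
      using Suc.prems(2) by linarith
    then have "\<rho> * \<theta> * real (s ^ r) \<le> real m" 
    proof (rule mult_right_le_imp_le)
      show "real (q ^ r - 1) > 0" using qr by (simp only: of_nat_0_less_iff)
    qed
    then have "\<exists>B j'. (\<forall>i<r. B i \<subseteq> P g i \<and> card (B i) = b * q ^ j') \<and> lower_regular q r F B"
      using Suc.IH[of "P g" "\<rho> * \<theta>"] cP g(2) Suc.prems(3) by (simp add: s_def mult.assoc)
    then show ?thesis unfolding P_def by blast
  qed
qed

lemma card_PiE_hitting_le:
  assumes "finite X" "Y \<subseteq> X" "r \<ge> 1"
  shows "card {x \<in> {..<r} \<rightarrow>\<^sub>E X. \<exists>i<r. x i \<in> Y} \<le> r * card Y * card X ^ (r - 1)"
proof -
  have "{x \<in> {..<r} \<rightarrow>\<^sub>E X. \<exists>i<r. x i \<in> Y} \<subseteq> (\<Union>i\<in>{..<r}. PiE {..<r} (\<lambda>j. if j = i then Y else X))"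
    by (auto simp: PiE_iff)
  then have "card {x \<in> {..<r} \<rightarrow>\<^sub>E X. \<exists>i<r. x i \<in> Y} \<le> card (\<Union>i\<in>{..<r}. PiE {..<r} (\<lambda>j. if j = i then Y else X))"
    by (intro card_mono finite_UN_I finite_PiE) (use assms finite_subset in auto)
  also have "\<dots> \<le> (\<Sum>i<r. card (PiE {..<r} (\<lambda>j. if j = i then Y else X)))" by (rule card_UN_le) simp
  also have "\<dots> = (\<Sum>i<r. card Y * card X ^ (r - 1))"
  proof (rule sum.cong)
    fix i assume i: "i \<in> {..<r}"
    have "(\<Prod>j<r. card (if j = i then Y else X)) = card Y * (\<Prod>j\<in>{..<r}-{i}. card (if j = i then Y else X))"
      by (subst prod.remove[OF _ i]) auto
    also have "(\<Prod>j\<in>{..<r}-{i}. card (if j = i then Y else X)) = (\<Prod>j\<in>{..<r}-{i}. card X)"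
      by (rule prod.cong) auto
    finally show "card (PiE {..<r} (\<lambda>j. if j = i then Y else X)) = card Y * card X ^ (r - 1)"
      using i by (simp add: card_PiE card_Diff_singleton)
  qed simp
  finally show ?thesis by (simp add: mult.assoc)
qed

lemma dense_lower_regular_box:
  fixes \<delta> :: real
  assumes "\<delta> > 0" "q \<ge> 2" "r \<ge> 1"
  obtains \<alpha> N0 where "\<alpha> > 0"
    "\<And>(X :: 'x set) F. \<lbrakk>finite X; card X \<ge> N0; F \<subseteq> {..<r} \<rightarrow>\<^sub>E X; real (card F) \<ge> \<delta> * real (card X) ^ r\<rbrakk>
      \<Longrightarrow> \<exists>A a. (\<forall>i<r. A i \<subseteq> X \<and> card (A i) = a) \<and> real a \<ge> \<alpha> * real (card X) \<and> lower_regular q r F A"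
proof -
  define \<theta> where "\<theta> = real (q ^ r) / real (q ^ r - 1)"
  have qr: "q ^ r \<ge> 2" using \<open>q \<ge> 2\<close> \<open>r \<ge> 1\<close>
    using self_le_power[of q r] by linarith
  then have "real (q ^ r - 1) < real (q ^ r)" "real (q ^ r - 1) > 0" by (auto simp only: of_nat_less_iff of_nat_0_less_iff)
  then have "\<theta> > 1" unfolding \<theta>_def by (simp only: less_divide_eq_1_pos)
  \<comment> \<open>Half of the density is reserved for trimming \<open>X\<close> to a multiple of
    \<open>q ^ J\<close>; the other half, multiplied by \<open>\<theta> ^ J\<close>, exceeds 1, as
    the density increment requires.\<close>
  then obtain J where J: "2 / \<delta> < \<theta> ^ J" using real_arch_pow by blast
  \<comment> \<open>The first summand bounds by \<open>\<delta> / 2\<close> the density of the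
    tuples that meet the at most \<open>q ^ J\<close> discarded points; the second makes
    \<open>b\<close> at least 2.\<close>
  define N0 :: nat where "N0 = nat \<lceil>2 * real (r * q ^ J) / \<delta>\<rceil> + 2 * q ^ J"
  \<comment> \<open>The box found has sides of size at least \<open>b\<close>, and
    \<open>b * q ^ J\<close> is at least half of \<open>card X\<close>.\<close>
  define \<alpha> where "\<alpha> = 1 / real (2 * q ^ J)"
  have main: "\<exists>A a. (\<forall>i<r. A i \<subseteq> X \<and> card (A i) = a) \<and> real a \<ge> \<alpha> * real (card X) \<and> lower_regular q r F A"
    if X: "finite X" "card X \<ge> N0" and F: "F \<subseteq> {..<r} \<rightarrow>\<^sub>E X" "real (card F) \<ge> \<delta> * real (card X) ^ r"
    for X :: "'x set" and F
  proof -
    define N where "N = card X"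
    define b where "b = N div q ^ J"
    have qJ: "q ^ J > 0" using \<open>q \<ge> 2\<close> by simp
    have N1: "N \<ge> 2 * q ^ J" using X by (simp add: N_def N0_def)
    then have "b \<ge> 2" unfolding b_def using div_le_mono[OF N1, of "q ^ J"] qJ by (simp split: if_splits)
    have mod: "N = b * q ^ J + N mod q ^ J" unfolding b_def by (rule div_mult_mod_eq[symmetric])
    have mod2: "N mod q ^ J < q ^ J" using qJ by simp
    have "b * q ^ J \<le> card X" using mod N_def by linarith
    then obtain X0 where X0: "X0 \<subseteq> X" "card X0 = b * q ^ J" using obtain_subset_with_card_n by metis
    have fX0: "finite X0" using X0 X finite_subset by blast
    have c0: "card (X - X0) \<le> q ^ J" using X0 X mod mod2 by (simp add: card_Diff_subset fX0 N_def[symmetric])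
    have fF: "finite F" using F X by (meson finite_PiE finite_lessThan finite_subset)
    have fP: "finite ({..<r} \<rightarrow>\<^sub>E X)" using X by (auto intro: finite_PiE)
    have "F \<subseteq> (F \<inter> PiE {..<r} (\<lambda>_. X0)) \<union> {x \<in> {..<r} \<rightarrow>\<^sub>E X. \<exists>i<r. x i \<in> X - X0}"
      using F by (auto simp: PiE_iff)
    then have "card F \<le> card ((F \<inter> PiE {..<r} (\<lambda>_. X0)) \<union> {x \<in> {..<r} \<rightarrow>\<^sub>E X. \<exists>i<r. x i \<in> X - X0})"
      by (intro card_mono) (use fF fP in auto)
    also have "\<dots> \<le> card (F \<inter> PiE {..<r} (\<lambda>_. X0)) + card {x \<in> {..<r} \<rightarrow>\<^sub>E X. \<exists>i<r. x i \<in> X - X0}"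
      by (rule card_Un_le)
    also have "card {x \<in> {..<r} \<rightarrow>\<^sub>E X. \<exists>i<r. x i \<in> X - X0} \<le> r * card (X - X0) * N ^ (r - 1)"
      unfolding N_def by (rule card_PiE_hitting_le) (use X \<open>r \<ge> 1\<close> in auto)
    also have "\<dots> \<le> r * q ^ J * N ^ (r - 1)" using c0 by (intro mult_right_mono mult_left_mono) auto
    finally have "real (card F) \<le> real (card (F \<inter> PiE {..<r} (\<lambda>_. X0))) + real (r * q ^ J) * real N ^ (r - 1)"
      by (simp flip: of_nat_mult of_nat_power of_nat_add)
    moreover have "real (r * q ^ J) * real N ^ (r - 1) \<le> (\<delta> / 2 * real N) * real N ^ (r - 1)"
    proof (rule mult_right_mono)
      have "2 * real (r * q ^ J) / \<delta> \<le> real N0" unfolding N0_def by linarith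
      also have "\<dots> \<le> real N" using X by (simp add: N_def)
      finally show "real (r * q ^ J) \<le> \<delta> / 2 * real N" using \<open>\<delta> > 0\<close> by (simp add: field_simps)
    qed simp
    moreover have "(\<delta> / 2 * real N) * real N ^ (r - 1) = \<delta> / 2 * real N ^ r"
      using \<open>r \<ge> 1\<close> by (simp add: power_eq_if)
    ultimately have "real (card (F \<inter> PiE {..<r} (\<lambda>_. X0))) \<ge> \<delta> / 2 * real N ^ r"
      using F(2) unfolding N_def by linarith
    moreover have "\<delta> / 2 * real N ^ r \<ge> \<delta> / 2 * real ((b * q ^ J) ^ r)"
    proof -
      have "(b * q ^ J) ^ r \<le> N ^ r" using mod by (intro power_mono) auto
      then have "real ((b * q ^ J) ^ r) \<le> real N ^ r" by (metis of_nat_le_iff of_nat_power)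
      then show ?thesis using \<open>\<delta> > 0\<close> by simp
    qed
    ultimately have "\<delta> / 2 * real ((b * q ^ J) ^ r) \<le> real (card (F \<inter> PiE {..<r} (\<lambda>_. X0)))"
      by linarith
    then have "\<exists>B j'. (\<forall>i<r. B i \<subseteq> X0 \<and> card (B i) = b * q ^ j') \<and> lower_regular q r F B"
      using \<open>b \<ge> 2\<close> fX0 X0 J \<open>\<delta> > 0\<close> assms
      by (intro lower_regular_subbox[OF \<open>q \<ge> 2\<close> \<open>r \<ge> 1\<close> _ \<theta>_def, where A = "\<lambda>_. X0" and \<rho> = "\<delta>/2" and j = J])
        (auto simp: field_simps)
    then obtain B j' where B: "\<forall>i<r. B i \<subseteq> X0 \<and> card (B i) = b * q ^ j'" "lower_regular q r F B" by blast
    have "1 * q ^ J \<le> b * q ^ J" using \<open>b \<ge> 2\<close> by (intro mult_right_mono) auto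
    then have "N \<le> 2 * b * q ^ J" using mod mod2 by linarith
    then have "real N \<le> real (2 * b * q ^ J)" by (simp only: of_nat_le_iff)
    then have "\<alpha> * real N \<le> real b" using qJ by (simp add: \<alpha>_def field_simps)
    also have "real b \<le> real (b * q ^ j')" using \<open>q \<ge> 2\<close> by (subst of_nat_le_iff) simp
    finally show ?thesis using B X0 by (intro exI[of _ B] exI[of _ "b * q ^ j'"]) (auto simp: N_def)
  qed
  show ?thesis 
  proof (rule that[of \<alpha> N0])
    show "\<alpha> > 0" using \<open>q \<ge> 2\<close> by (simp add: \<alpha>_def)
  qed (fact main)
qed

lemma ex_top_subset:
  fixes y :: "'x \<Rightarrow> real"
  assumes "finite A" "m \<le> card A"
  shows "\<exists>B\<subseteq>A. card B = m \<and> (\<forall>u\<in>A - B. \<forall>b\<in>B. y u \<le> y b)"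
  using assms(2)
proof (induction m)
    case 0 then show ?case by (intro exI[of _ "{}"]) auto
  next
    case (Suc m)
    then obtain B where B: "B \<subseteq> A" "card B = m" "\<forall>u\<in>A - B. \<forall>b\<in>B. y u \<le> y b" by auto
    have fB: "finite B" using B assms finite_subset by blast
    have "A - B \<noteq> {}" using B Suc.prems
      using card_mono[OF fB, of A] by auto
    then obtain w where w: "w \<in> A - B" "y w = Max (y ` (A - B))"
      using Max_in[of "y ` (A - B)"] assms by fastforce
    have "y u \<le> y w" if "u \<in> A - B" for u using w that assms by simp
    then show ?case using B w fB by (intro exI[of _ "insert w B"]) auto
qed


text \<open>Lightness passes from the edges to all tuples of a box. Reserve the heaviest vertices in
  each side of a lower regular box; regularity finds an edge \<open>x\<close> inside the reserved
  part, and every remaining vertex of side \<open>i\<close> weighs at most \<open>y (x i)\<close>.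
  So each tuple of the remaining box, edge or not, weighs at most as much as
  \<open>x\<close>.\<close>

lemma light_lower_regular_box:
  fixes \<delta> :: real
  assumes "\<delta> > 0" "q \<ge> 1" "r \<ge> 1"
  obtains \<alpha> N0 where "\<alpha> > 0"
    "\<And>(X :: 'x set) F y \<mu>. \<lbrakk>finite X; card X \<ge> N0; F \<subseteq> {..<r} \<rightarrow>\<^sub>E X; real (card F) \<ge> \<delta> * real (card X) ^ r;
        \<And>x. x \<in> F \<Longrightarrow> (\<Sum>i<r. y (x i) :: real) \<le> \<mu>\<rbrakk>
      \<Longrightarrow> \<exists>A a. (\<forall>i<r. A i \<subseteq> X \<and> card (A i) = a) \<and> real a \<ge> \<alpha> * real (card X) \<and> lower_regular q r F A
            \<and> (\<forall>u\<in>PiE {..<r} A. (\<Sum>i<r. y (u i)) \<le> \<mu>)"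
proof -
  \<comment> \<open>One factor 2 pays for passing to a box with at least half of each side; the
    other keeps the reserved part, of size just above \<open>a / q'\<close>, at most half of the
    side once \<open>a \<ge> 4\<close>.\<close>
  define q' where "q' = 4 * q"
  have "q' \<ge> 2" using assms by (simp add: q'_def)
  obtain \<alpha> N0 where \<alpha>: "\<alpha> > 0" and box: "\<And>(X :: 'x set) F. \<lbrakk>finite X; card X \<ge> N0; F \<subseteq> {..<r} \<rightarrow>\<^sub>E X;
      real (card F) \<ge> \<delta> * real (card X) ^ r\<rbrakk>
      \<Longrightarrow> \<exists>A a. (\<forall>i<r. A i \<subseteq> X \<and> card (A i) = a) \<and> real a \<ge> \<alpha> * real (card X) \<and> lower_regular q' r F A"
    by (rule dense_lower_regular_box[OF \<open>\<delta> > 0\<close> \<open>q' \<ge> 2\<close> \<open>r \<ge> 1\<close>]) blast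
  define N1 where "N1 = N0 + nat \<lceil>4 / \<alpha>\<rceil>"
  show ?thesis
  proof (rule that[of "\<alpha> / 2" N1])
    show "\<alpha> / 2 > 0" using \<alpha> by simp
    fix X :: "'x set" and F y \<mu>
    assume X: "finite X" "card X \<ge> N1" and F: "F \<subseteq> {..<r} \<rightarrow>\<^sub>E X" "real (card F) \<ge> \<delta> * real (card X) ^ r"
      and y: "\<And>x. x \<in> F \<Longrightarrow> (\<Sum>i<r. y (x i) :: real) \<le> \<mu>"
    have "card X \<ge> N0" using X by (simp add: N1_def)
    from box[OF X(1) this F] obtain A a where A: "\<And>i. i < r \<Longrightarrow> A i \<subseteq> X" "\<And>i. i < r \<Longrightarrow> card (A i) = a"
      and a: "real a \<ge> \<alpha> * real (card X)" and reg: "lower_regular q' r F A" by blast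
    have "real (card X) \<ge> 4 / \<alpha>" using X(2) unfolding N1_def by linarith
    then have "\<alpha> * real (card X) \<ge> 4" using \<alpha> by (simp add: field_simps)
    then have a4: "a \<ge> 4" using a by linarith
    have fA: "finite (A i)" if "i < r" for i using A(1)[OF that] X finite_subset by blast
    define t where "t = a div q' + 1"
    have "4 * (a div q') \<le> q' * (a div q')" using assms by (intro mult_right_mono) (auto simp: q'_def)
    also have "\<dots> \<le> a" by simp
    finally have t2: "2 * t \<le> a" using a4 by (simp add: t_def)
    have t3: "a \<le> q' * t" using dividend_less_div_times[of q' a] \<open>q' \<ge> 2\<close> by (simp add: t_def algebra_simps)
    have "\<exists>B. B \<subseteq> A i \<and> card B = t \<and> (\<forall>u\<in>A i - B. \<forall>b\<in>B. y u \<le> y b)" if i: "i < r" for i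
    proof -
      have "t \<le> card (A i)" using t2 A(2)[OF i] by simp
      from ex_top_subset[OF fA[OF i] this, of y] show ?thesis by blast
    qed
    then obtain B where B: "\<And>i. i < r \<Longrightarrow> B i \<subseteq> A i" "\<And>i. i < r \<Longrightarrow> card (B i) = t"
      "\<And>i u b. i < r \<Longrightarrow> u \<in> A i - B i \<Longrightarrow> b \<in> B i \<Longrightarrow> y u \<le> y b" by metis
    have "F \<inter> PiE {..<r} B \<noteq> {}" using reg A(2) B t3 unfolding lower_regular_def by metis
    then obtain x where x: "x \<in> F" "x \<in> PiE {..<r} B" by blast
    define C where "C i = A i - B i" for i
    have cC: "card (C i) = a - t" if "i < r" for i
      using A(2)[OF that] B(1,2)[OF that] fA[OF that] by (simp add: C_def card_Diff_subset finite_subset)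
    have reg': "lower_regular q r F C"
      unfolding lower_regular_def
    proof (intro allI impI)
      fix D assume D: "\<forall>i<r. D i \<subseteq> C i \<and> card (C i) \<le> q * card (D i)"
      have "D i \<subseteq> A i \<and> card (A i) \<le> q' * card (D i)" if i: "i < r" for i
      proof -
        have "a - t \<le> q * card (D i)" using D i cC by auto
        moreover have "a \<le> 2 * (a - t)" using t2 by linarith
        ultimately have "a \<le> 2 * (q * card (D i))" by linarith
        then show ?thesis using D i A(2) by (auto simp: C_def q'_def)
      qed
      then show "F \<inter> PiE {..<r} D \<noteq> {}" using reg unfolding lower_regular_def by blast
    qed
    have "(\<Sum>i<r. y (u i)) \<le> \<mu>" if u: "u \<in> PiE {..<r} C" for u
    proof -
      have "(\<Sum>i<r. y (u i)) \<le> (\<Sum>i<r. y (x i))"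
        by (rule sum_mono, rule B(3)) (use u x(2) in \<open>auto simp: PiE_iff C_def\<close>)
      then show ?thesis using y[OF x(1)] by linarith
    qed
    moreover have "real (a - t) \<ge> \<alpha> / 2 * real (card X)"
    proof -
      have "real a \<le> 2 * real (a - t)" using t2 by linarith
      then show ?thesis using a by linarith
    qed
    moreover have "\<forall>i<r. C i \<subseteq> X \<and> card (C i) = a - t" using A(1) cC by (auto simp: C_def)
    ultimately show "\<exists>A a. (\<forall>i<r. A i \<subseteq> X \<and> card (A i) = a) \<and> real a \<ge> \<alpha> / 2 * real (card X)
        \<and> lower_regular q r F A \<and> (\<forall>u\<in>PiE {..<r} A. (\<Sum>i<r. y (u i)) \<le> \<mu>)"
      using reg' by blast
  qed
qed

section \<open>Boxes with balanced loads\<close>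

definition box_load :: "nat \<Rightarrow> nat \<Rightarrow> (nat \<Rightarrow> nat \<Rightarrow> 'x set) \<Rightarrow> 'x \<Rightarrow> real" where
  "box_load r T A v = (\<Sum>t<T. \<Sum>i<r. of_bool (v \<in> A t i))"

text \<open>By linear programming duality, a robust form of having a perfect fractional matching; it is
  all that the near-perfect matching argument uses.\<close>

definition robust_cover :: "real \<Rightarrow> real \<Rightarrow> nat \<Rightarrow> 'x set \<Rightarrow> (nat \<Rightarrow> 'x) set \<Rightarrow> bool" where
  "robust_cover \<gamma> \<delta> r X F \<longleftrightarrow> (\<forall>L \<mu>. (\<forall>v\<in>X. 0 \<le> L v) \<and> \<mu> > 0 \<and>
      sum L X \<le> (1 - \<gamma>) * \<mu> * real (card X) / real r \<longrightarrow>
      \<delta> * real (card X) ^ r \<le> real (card {x\<in>F. (\<Sum>i<r. L (x i)) < \<mu>}))"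

text \<open>Write S for the total load and N for \<open>card X\<close>. Constant loads would have
  sum of squares exactly S^2 / N; the last condition allows the relative error coming from
  \<open>1 - \<gamma>\<close> and a term linear in S, which is negligible once the average load
  \<open>K\<close> is large.\<close>

abbreviation near_uniform :: "real \<Rightarrow> nat \<Rightarrow> nat \<Rightarrow> nat \<Rightarrow> nat \<Rightarrow> 'x set \<Rightarrow> (nat \<Rightarrow> 'x) set \<Rightarrow> bool" where
  "near_uniform \<gamma> q K r T0 X F \<equiv> \<exists>T A a. T \<le> T0 \<and>
     (\<forall>t<T. (\<forall>i<r. A t i \<subseteq> X \<and> card (A t i) = a t) \<and> lower_regular q r F (A t)) \<and>
     real K * real (card X) \<le> (\<Sum>v\<in>X. box_load r T A v) \<and>
     (\<Sum>v\<in>X. box_load r T A v) \<le> (real K + real r) * real (card X) \<and>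
     (\<Sum>v\<in>X. box_load r T A v) = real r * (\<Sum>t<T. real (a t)) \<and>
     (\<Sum>v\<in>X. (box_load r T A v)\<^sup>2) \<le> (\<Sum>v\<in>X. box_load r T A v)\<^sup>2 / (real (card X) * (1 - \<gamma>))
       + (2 / real r + real r) * (\<Sum>v\<in>X. box_load r T A v)"

lemma sum_of_bool_mem:
  assumes "finite X" "A \<subseteq> X"
  shows "(\<Sum>v\<in>X. of_bool (v \<in> A) * f v :: real) = sum f A"
proof -
  have "(\<Sum>v\<in>X. of_bool (v \<in> A) * f v) = (\<Sum>v\<in>X. if v \<in> A then f v else 0)"
    by (rule sum.cong) auto
  also have "\<dots> = sum f (X \<inter> A)" using assms by (simp add: sum.inter_restrict)
  also have "X \<inter> A = A" using assms by auto
  finally show ?thesis .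
qed

text \<open>The heaviest vertices of the sides together form one tuple of the box, and its weight
  bounds the average over all of them.\<close>

lemma sum_box_le:
  fixes y :: "'x \<Rightarrow> real"
  assumes "\<And>i. i < r \<Longrightarrow> finite (A i) \<and> card (A i) = a" "a > 0"
    "\<forall>u\<in>PiE {..<r} A. (\<Sum>i<r. y (u i)) \<le> \<mu>"
  shows "(\<Sum>i<r. \<Sum>v\<in>A i. y v) \<le> real a * \<mu>"
proof -
  have "\<exists>u\<in>A i. \<forall>v\<in>A i. y v \<le> y u" if i: "i < r" for i
  proof -
    have "finite (y ` A i)" "y ` A i \<noteq> {}" using assms(1)[OF i] assms(2) by auto
    from Max_in[OF this] obtain u where u: "u \<in> A i" "Max (y ` A i) = y u" by blast
    have "y v \<le> y u" if "v \<in> A i" for v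
      using Max_ge[OF \<open>finite (y ` A i)\<close>, of "y v"] that u(2) by simp
    then show ?thesis using u(1) by blast
  qed
  then obtain w where w: "\<And>i. i < r \<Longrightarrow> w i \<in> A i" "\<And>i v. i < r \<Longrightarrow> v \<in> A i \<Longrightarrow> y v \<le> y (w i)" by metis
  have "(\<Sum>i<r. \<Sum>v\<in>A i. y v) \<le> (\<Sum>i<r. real a * y (w i))"
  proof (rule sum_mono)
    fix i assume i: "i \<in> {..<r}"
    have "(\<Sum>v\<in>A i. y v) \<le> of_nat (card (A i)) * y (w i)" by (rule sum_bounded_above) (use w i in auto)
    then show "(\<Sum>v\<in>A i. y v) \<le> real a * y (w i)" using assms(1)[of i] i by simp
  qed
  also have "\<dots> = real a * (\<Sum>i<r. y (restrict w {..<r} i))" by (simp add: sum_distrib_left)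
  also have "\<dots> \<le> real a * \<mu>"
    by (rule mult_left_mono, rule assms(3)[rule_format]) (use w in \<open>auto simp: PiE_iff extensional_def\<close>)
  finally show ?thesis .
qed

text \<open>Boxes that are light for the current loads are added until the average load reaches
  \<open>K\<close>. If a box with sides of size \<open>b\<close> is added at total load S, the main
  part of the growth of the sum of squares is at most \<open>2 * b * \<mu>\<close>. With
  \<open>\<mu>\<close> about \<open>S * r / (N * (1 - \<gamma>))\<close> this is no more than the
  growth of \<open>S^2 / (N * (1 - \<gamma>))\<close> when S increases by \<open>r * b\<close>, so
  the bound on the squares is preserved.\<close>

lemma near_uniform_boxes:
  fixes \<gamma> \<delta> :: real
  assumes "r \<ge> 1" "0 < \<gamma>" "\<gamma> < 1" "\<delta> > 0" "q \<ge> 1" "K \<ge> 1"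
  shows "\<exists>T0 N0 :: nat. \<forall>(X :: 'x set) F.
      finite X \<and> card X \<ge> N0 \<and> F \<subseteq> {..<r} \<rightarrow>\<^sub>E X \<and> robust_cover \<gamma> \<delta> r X F \<longrightarrow>
      near_uniform \<gamma> q K r T0 X F"
proof -
  obtain \<alpha> N0 where \<alpha>: "\<alpha> > 0" and box:
    "\<And>(X :: 'x set) F y \<mu>. \<lbrakk>finite X; card X \<ge> N0; F \<subseteq> {..<r} \<rightarrow>\<^sub>E X; real (card F) \<ge> \<delta> * real (card X) ^ r;
        \<And>x. x \<in> F \<Longrightarrow> (\<Sum>i<r. y (x i) :: real) \<le> \<mu>\<rbrakk>
      \<Longrightarrow> \<exists>A a. (\<forall>i<r. A i \<subseteq> X \<and> card (A i) = a) \<and> real a \<ge> \<alpha> * real (card X) \<and> lower_regular q r F A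
            \<and> (\<forall>u\<in>PiE {..<r} A. (\<Sum>i<r. y (u i)) \<le> \<mu>)"
    using light_lower_regular_box[OF \<open>\<delta> > 0\<close> \<open>q \<ge> 1\<close> \<open>r \<ge> 1\<close>, where 'x = 'x] by metis
  \<comment> \<open>Each box adds at least \<open>r * \<alpha> * N\<close> to the total load, so
    this many boxes bring it to \<open>K * N\<close>.\<close>
  define T0 where "T0 = nat \<lceil>real K / (real r * \<alpha>)\<rceil> + 1"
  show ?thesis
  proof (rule exI[of _ T0], rule exI[of _ "N0 + 1"], intro allI impI, elim conjE)
    fix X :: "'x set" and F
    assume X: "finite X" "N0 + 1 \<le> card X" and F: "F \<subseteq> {..<r} \<rightarrow>\<^sub>E X" and rob: "robust_cover \<gamma> \<delta> r X F"
    define N where "N = real (card X)"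
    have N0: "N > 0" using X by (simp add: N_def)
    define valid where "valid T A a \<longleftrightarrow>
      (\<forall>t<T. (\<forall>i<r. A t i \<subseteq> X \<and> card (A t i) = a t) \<and> lower_regular q r F (A t))" for T :: nat and A and a :: "nat \<Rightarrow> nat"
    define S where "S T A = (\<Sum>v\<in>X. box_load r T A v)" for T A
    define good where "good T A a \<longleftrightarrow> valid T A a \<and> S T A \<le> (real K + real r) * N \<and>
        S T A = real r * (\<Sum>t<T. real (a t)) \<and>
        (\<Sum>v\<in>X. (box_load r T A v)\<^sup>2) \<le> (S T A)\<^sup>2 / (N * (1 - \<gamma>)) + (2 / real r + real r) * S T A" for T A a
    \<comment> \<open>Either the target load has been reached and the process has stopped, or all
      \<open>T\<close> boxes are present and of linear size. The upper bound on \<open>S\<close> in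
      \<open>good\<close> persists because a box is added only while \<open>S\<close> is below
      \<open>K * N\<close>, and it adds at most \<open>r * N\<close>.\<close>
    have step: "\<exists>T' A a. T' \<le> T \<and> good T' A a \<and> (real K * N \<le> S T' A \<or> (T' = T \<and> real r * real T * \<alpha> * N \<le> S T' A))" for T
    proof (induction T)
      case 0
      have "good 0 (\<lambda>_ _. {}) (\<lambda>_. 0)" using N0 by (simp add: good_def valid_def S_def box_load_def)
      then show ?case by (intro exI[of _ 0]) (auto simp: S_def box_load_def)
    next
      case (Suc T)
      then obtain T' A a where IH: "T' \<le> T" "good T' A a"
        "real K * N \<le> S T' A \<or> (T' = T \<and> real r * real T * \<alpha> * N \<le> S T' A)" by blast
      show ?case
      proof (cases "real K * N \<le> S T' A")
        case True then show ?thesis using IH by (metis le_SucI)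
      next
        case False
        then have T': "T' = T" and big: "real r * real T * \<alpha> * N \<le> S T A" and small: "S T A < real K * N"
          using IH by auto
        have g: "good T A a" using IH T' by simp
        define c where "c v = box_load r T A v" for v
        have c0: "c v \<ge> 0" for v by (auto simp: c_def box_load_def intro!: sum_nonneg)
        have S0: "S T A \<ge> 0" unfolding S_def using c0 by (auto simp: c_def intro!: sum_nonneg)
        \<comment> \<open>The least value for which the load \<open>c\<close> meets the hypothesis
          of \<open>robust_cover\<close>, raised by 1 so as to be positive even before the first
          box.\<close>
        define \<mu> where "\<mu> = S T A * real r / (N * (1 - \<gamma>)) + 1"
        have mu0: "\<mu> > 0" using S0 N0 assms by (auto simp: \<mu>_def intro!: add_nonneg_pos divide_nonneg_pos)
        have "sum c X \<le> (1 - \<gamma>) * \<mu> * N / real r"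
        proof -
          have "(1 - \<gamma>) * \<mu> * N / real r = S T A + (1 - \<gamma>) * N / real r"
            using N0 assms by (simp add: \<mu>_def field_simps)
          moreover have "(1 - \<gamma>) * N / real r \<ge> 0" using N0 assms by simp
          moreover have "sum c X = S T A" by (simp add: S_def c_def)
          ultimately show ?thesis by linarith
        qed
        then have dense: "\<delta> * real (card X) ^ r \<le> real (card {x\<in>F. (\<Sum>i<r. c (x i)) < \<mu>})"
          using rob mu0 c0 unfolding robust_cover_def N_def by blast
        have "\<exists>B b. (\<forall>i<r. B i \<subseteq> X \<and> card (B i) = b) \<and> real b \<ge> \<alpha> * real (card X)
            \<and> lower_regular q r {x\<in>F. (\<Sum>i<r. c (x i)) < \<mu>} B \<and> (\<forall>u\<in>PiE {..<r} B. (\<Sum>i<r. c (u i)) \<le> \<mu>)"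
          by (rule box[OF X(1) _ _ dense]) (use X(2) F in auto)
        then obtain B b where B: "\<And>i. i < r \<Longrightarrow> B i \<subseteq> X" "\<And>i. i < r \<Longrightarrow> card (B i) = b"
          and b: "real b \<ge> \<alpha> * N" and reg: "lower_regular q r {x\<in>F. (\<Sum>i<r. c (x i)) < \<mu>} B"
          and light: "\<forall>u\<in>PiE {..<r} B. (\<Sum>i<r. c (u i)) \<le> \<mu>" unfolding N_def by blast
        have reg': "lower_regular q r F B" using reg unfolding lower_regular_def by blast
        have b0: "b > 0"
        proof -
          have "\<alpha> * N > 0" using \<alpha> N0 by simp
          then have "real b > 0" using b by linarith
          then show ?thesis by simp
        qed
        define A' where "A' = A(T := B)"
        define a' where "a' = a(T := b)"
        define \<Delta> where "\<Delta> v = (\<Sum>i<r. of_bool (v \<in> B i) :: real)" for v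
        have load: "box_load r (Suc T) A' v = c v + \<Delta> v" for v
          by (simp add: box_load_def c_def \<Delta>_def A'_def)
        have \<Delta>0: "\<Delta> v \<ge> 0" "\<Delta> v \<le> real r" for v
          using sum_bounded_above[of "{..<r}" "\<lambda>i. of_bool (v \<in> B i) :: real" 1]
          by (auto simp: \<Delta>_def intro!: sum_nonneg)
        have \<Delta>sum: "(\<Sum>v\<in>X. \<Delta> v * f v) = (\<Sum>i<r. \<Sum>v\<in>B i. f v)" for f :: "'x \<Rightarrow> real"
        proof -
          have "(\<Sum>v\<in>X. \<Delta> v * f v) = (\<Sum>i<r. \<Sum>v\<in>X. of_bool (v \<in> B i) * f v)"
            unfolding \<Delta>_def by (simp only: sum_distrib_right sum.swap[of _ X])
          also have "\<dots> = (\<Sum>i<r. \<Sum>v\<in>B i. f v)"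
            by (rule sum.cong) (auto intro!: sum_of_bool_mem X B)
          finally show ?thesis .
        qed
        have d1: "(\<Sum>v\<in>X. \<Delta> v) = real r * real b" using \<Delta>sum[of "\<lambda>_. 1"] B(2) by simp
        have S': "S (Suc T) A' = S T A + real r * real b"
          by (simp add: S_def load sum.distrib d1 c_def)
        have dc: "(\<Sum>v\<in>X. \<Delta> v * c v) \<le> real b * \<mu>"
          unfolding \<Delta>sum by (rule sum_box_le[OF _ b0 light]) (use B X finite_subset[OF B(1) X(1)] in auto)
        have dd: "(\<Sum>v\<in>X. (\<Delta> v)\<^sup>2) \<le> real r * (real r * real b)"
        proof -
          have "(\<Sum>v\<in>X. (\<Delta> v)\<^sup>2) \<le> (\<Sum>v\<in>X. real r * \<Delta> v)"
            unfolding power2_eq_square by (intro sum_mono mult_right_mono \<Delta>0)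
          then show ?thesis using d1 by (simp add: sum_distrib_left[symmetric])
        qed
        have sq: "(\<Sum>v\<in>X. (box_load r (Suc T) A' v)\<^sup>2) = (\<Sum>v\<in>X. (c v)\<^sup>2) + 2 * (\<Sum>v\<in>X. \<Delta> v * c v) + (\<Sum>v\<in>X. (\<Delta> v)\<^sup>2)"
          unfolding load by (simp add: power2_sum sum.distrib sum_distrib_left algebra_simps)
        have "(\<Sum>v\<in>X. (box_load r (Suc T) A' v)\<^sup>2) \<le> (S T A)\<^sup>2 / (N * (1 - \<gamma>)) + (2 / real r + real r) * S T A
            + 2 * (real b * \<mu>) + real r * (real r * real b)"
          using sq dc dd g unfolding good_def c_def[symmetric] by linarith
        \<comment> \<open>The linear term grows by \<open>(2 / r + r) * (r * b)\<close>, that is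
          \<open>2 * b + r^2 * b\<close>. This pays for the summand 1 in \<open>\<mu>\<close> and
          for the squares of the increments.\<close>
        also have "\<dots> \<le> (S (Suc T) A')\<^sup>2 / (N * (1 - \<gamma>)) + (2 / real r + real r) * S (Suc T) A'"
        proof -
          have "(S (Suc T) A')\<^sup>2 / (N * (1 - \<gamma>)) = (S T A)\<^sup>2 / (N * (1 - \<gamma>)) + 2 * (real b * (S T A * real r / (N * (1 - \<gamma>))))
             + (real r * real b)\<^sup>2 / (N * (1 - \<gamma>))"
            unfolding S' by (simp add: power2_sum add_divide_distrib algebra_simps)
          moreover have "(real r * real b)\<^sup>2 / (N * (1 - \<gamma>)) \<ge> 0" using N0 assms by simp
          moreover have "(2 / real r + real r) * S (Suc T) A' = (2 / real r + real r) * S T A + 2 * real b + real r * (real r * real b)"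
            unfolding S' using assms by (simp add: field_simps)
          moreover have "2 * (real b * \<mu>) = 2 * (real b * (S T A * real r / (N * (1 - \<gamma>)))) + 2 * real b"
            by (simp add: \<mu>_def algebra_simps)
          ultimately show ?thesis by linarith
        qed
        finally have pot: "(\<Sum>v\<in>X. (box_load r (Suc T) A' v)\<^sup>2) \<le> (S (Suc T) A')\<^sup>2 / (N * (1 - \<gamma>)) + (2 / real r + real r) * S (Suc T) A'" .
        have "valid (Suc T) A' a'"
          using g B reg' unfolding good_def valid_def by (auto simp: A'_def a'_def less_Suc_eq)
        moreover have "S (Suc T) A' \<le> (real K + real r) * N"
        proof -
          have "card (B 0) \<le> card X" using B(1)[of 0] X assms by (intro card_mono) auto
          then have "real b \<le> N" using B(2)[of 0] assms by (simp add: N_def)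
          then have "real r * real b \<le> real r * N" by (rule mult_left_mono) simp
          then show ?thesis using S' small by (simp add: algebra_simps)
        qed
        moreover have "S (Suc T) A' = real r * (\<Sum>t<Suc T. real (a' t))"
          using S' g unfolding good_def by (simp add: a'_def algebra_simps)
        ultimately have "good (Suc T) A' a'" using pot unfolding good_def by blast
        moreover have "real r * real (Suc T) * \<alpha> * N \<le> S (Suc T) A'"
        proof -
          have "real r * (\<alpha> * N) \<le> real r * real b" using b by (rule mult_left_mono) simp
          then show ?thesis using S' big by (simp add: algebra_simps)
        qed
        ultimately show ?thesis by blast
      qed
    qed
    from step[of T0] obtain T A a where TA: "T \<le> T0" "good T A a"
      "real K * N \<le> S T A \<or> (T = T0 \<and> real r * real T0 * \<alpha> * N \<le> S T A)" by blast
    have "real K * N \<le> real r * real T0 * \<alpha> * N"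
    proof -
      have "real K / (real r * \<alpha>) \<le> real T0" unfolding T0_def by linarith
      then have "real K \<le> real r * real T0 * \<alpha>" using \<alpha> assms by (simp add: field_simps)
      then show ?thesis using N0 by (intro mult_right_mono) auto
    qed
    then have "real K * N \<le> S T A" using TA(3) by linarith
    then show "near_uniform \<gamma> q K r T0 X F"
      using TA(1,2) unfolding good_def valid_def S_def N_def by blast
  qed
qed

section \<open>Near-perfect matchings of tuples\<close>

abbreviation disjoint_tuples :: "nat \<Rightarrow> (nat \<Rightarrow> 'x) set \<Rightarrow> bool" where
  "disjoint_tuples r M \<equiv> \<forall>x\<in>M. \<forall>y\<in>M. x \<noteq> y \<longrightarrow> x ` {..<r} \<inter> y ` {..<r} = {}"

text \<open>As long as more than \<open>a div q\<close> points of each side are left, they span a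
  subbox large enough for lower regularity to supply another edge. Disjointness of the sides
  \<open>D i\<close> reduces disjointness of tuples to comparing equal coordinates.\<close>

lemma greedy_matching_in_box:
  assumes "lower_regular q r F A" "\<And>i. i < r \<Longrightarrow> card (A i) = a" "\<And>i. i < r \<Longrightarrow> D i \<subseteq> A i"
    "\<And>i. i < r \<Longrightarrow> finite (D i)" "disjoint_family_on D {..<r}"
    "\<And>i. i < r \<Longrightarrow> b \<le> card (D i)" "r \<ge> 1" "q \<ge> 1"
  shows "\<exists>M. M \<subseteq> F \<inter> PiE {..<r} D \<and> finite M \<and> card M = b - a div q \<and>
     disjoint_tuples r M"
proof -
  have "p \<le> b - a div q \<Longrightarrow> \<exists>M. M \<subseteq> F \<inter> PiE {..<r} D \<and> finite M \<and> card M = p \<and>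
     disjoint_tuples r M" for p
  proof (induction p)
    case 0 then show ?case by (intro exI[of _ "{}"]) auto
  next
    case (Suc p)
    then obtain M where M: "M \<subseteq> F \<inter> PiE {..<r} D" "finite M" "card M = p"
      "\<forall>x\<in>M. \<forall>y\<in>M. x \<noteq> y \<longrightarrow> x ` {..<r} \<inter> y ` {..<r} = {}" by auto
    define B where "B i = D i - (\<lambda>x. x i) ` M" for i
    have "B i \<subseteq> A i \<and> card (A i) \<le> q * card (B i)" if i: "i < r" for i
    proof -
      have "card (B i) \<ge> card (D i) - card ((\<lambda>x. x i) ` M)"
        unfolding B_def by (rule diff_card_le_card_Diff) (use M in auto)
      moreover have "card ((\<lambda>x. x i) ` M) \<le> p" using M card_image_le by metis
      ultimately have "card (B i) \<ge> b - p" using assms(6)[OF i] by linarith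
      moreover have "b - p \<ge> a div q + 1" using Suc.prems by linarith
      ultimately have "q * card (B i) \<ge> q * (a div q + 1)" by (intro mult_left_mono) auto
      moreover have "q * (a div q + 1) \<ge> a"
        using dividend_less_div_times[of q a] assms(8) by (simp add: algebra_simps)
      ultimately show ?thesis using assms(2,3)[OF i] by (auto simp: B_def)
    qed
    then have "F \<inter> PiE {..<r} B \<noteq> {}" using assms(1) unfolding lower_regular_def by metis
    then obtain x where x: "x \<in> F" "x \<in> PiE {..<r} B" by blast
    have xi: "x i \<in> D i" "\<And>y. y \<in> M \<Longrightarrow> x i \<noteq> y i" if "i < r" for i
      using x(2) that by (auto simp: PiE_iff B_def)
    have xD: "x \<in> PiE {..<r} D" using x(2) xi by (auto simp: PiE_iff)
    have dis: "x ` {..<r} \<inter> y ` {..<r} = {}" if y: "y \<in> M" for y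
    proof (rule equals0I)
      fix v assume "v \<in> x ` {..<r} \<inter> y ` {..<r}"
      then obtain i j where ij: "i < r" "j < r" "v = x i" "v = y j" by auto
      have "y \<in> PiE {..<r} D" using y M(1) by blast
      then have "y j \<in> D j" using ij(2) by (simp add: PiE_iff)
      then have "i = j" using assms(5) xi(1)[OF ij(1)] ij unfolding disjoint_family_on_def by auto
      then show False using xi(2)[OF ij(1) y] ij by auto
    qed
    have "x \<notin> M" using xi(2)[of 0 x] assms(7) by auto
    then show ?case using M x(1) xD dis
      by (intro exI[of _ "insert x M"]) (auto simp: Int_commute)
  qed
  from this[OF order_refl] show ?thesis .
qed

lemma obtain_disjoint_subsets:
  assumes "finite I" "finite Y" "card I * b \<le> card Y"
  obtains E where "\<And>p. p \<in> I \<Longrightarrow> E p \<subseteq> Y \<and> card (E p) = b" "disjoint_family_on E I"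
proof -
  have "\<exists>E. (\<forall>p\<in>I. E p \<subseteq> Y \<and> card (E p) = b) \<and> disjoint_family_on E I"
    using assms(1,3)
  proof (induction I)
    case empty then show ?case by (auto simp: disjoint_family_on_def)
  next
    case (insert p I)
    then obtain E where E: "\<forall>p\<in>I. E p \<subseteq> Y \<and> card (E p) = b" "disjoint_family_on E I" by auto
    have "card (\<Union>(E ` I)) \<le> (\<Sum>p\<in>I. card (E p))" by (rule card_UN_le) (use insert in auto)
    then have "card (\<Union>(E ` I)) \<le> card I * b" using E by simp
    moreover have "card (Y - \<Union>(E ` I)) = card Y - card (\<Union>(E ` I))"
      by (rule card_Diff_subset) (use E assms(2) insert in \<open>auto intro!: finite_UN_I intro: finite_subset\<close>)
    ultimately have "b \<le> card (Y - \<Union>(E ` I))" using insert by simp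
    then obtain Z where Z: "Z \<subseteq> Y - \<Union>(E ` I)" "card Z = b" using obtain_subset_with_card_n by metis
    have "disjoint_family_on (E(p := Z)) (insert p I)"
      using E(2) Z(1) insert.hyps(2) unfolding disjoint_family_on_def by auto
    moreover have "\<forall>p'\<in>insert p I. (E(p := Z)) p' \<subseteq> Y \<and> card ((E(p := Z)) p') = b"
      using E(1) Z insert.hyps(2) by auto
    ultimately show ?case by blast
  qed
  then show ?thesis using that by blast
qed

text \<open>The vertices lying in exactly the same sets \<open>A p\<close> are shared out evenly; the error is one
  vertex for each of the at most \<open>2 ^ card I\<close> classes.\<close>

lemma split_evenly:
  fixes A :: "'p \<Rightarrow> 'x set"
  assumes "finite I" "finite X" "\<And>p. p \<in> I \<Longrightarrow> A p \<subseteq> X" "K \<ge> 1"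
  obtains D where "\<And>p. p \<in> I \<Longrightarrow> D p \<subseteq> A p" "disjoint_family_on D I"
    "\<And>p. p \<in> I \<Longrightarrow> real (card (D p)) \<ge> (\<Sum>v\<in>A p. 1 / real (max K (card {p\<in>I. v \<in> A p}))) - 2 ^ card I"
proof -
  define \<sigma> where "\<sigma> v = {p\<in>I. v \<in> A p}" for v
  define Y where "Y \<tau> = {v\<in>X. \<sigma> v = \<tau>}" for \<tau>
  \<comment> \<open>A point lying in fewer than \<open>K\<close> of the sets still gives only
    \<open>1 / K\<close> to each: even shares are what matters, since a box can use no more than its
    smallest side.\<close>
  define m where "m \<tau> = max K (card \<tau>)" for \<tau> :: "'p set"
  have "\<exists>E. (\<forall>p\<in>\<tau>. E p \<subseteq> Y \<tau> \<and> card (E p) = card (Y \<tau>) div m \<tau>) \<and> disjoint_family_on E \<tau>"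
    if "\<tau> \<subseteq> I" for \<tau>
  proof -
    have "card \<tau> * (card (Y \<tau>) div m \<tau>) \<le> m \<tau> * (card (Y \<tau>) div m \<tau>)"
      by (rule mult_right_mono) (auto simp: m_def)
    also have "\<dots> \<le> card (Y \<tau>)" by simp
    finally have *: "card \<tau> * (card (Y \<tau>) div m \<tau>) \<le> card (Y \<tau>)" .
    have "finite \<tau>" "finite (Y \<tau>)" using that assms finite_subset by (auto simp: Y_def)
    from obtain_disjoint_subsets[OF this *] show ?thesis by metis
  qed
  then obtain E where E: "\<And>\<tau> p. \<tau> \<subseteq> I \<Longrightarrow> p \<in> \<tau> \<Longrightarrow> E \<tau> p \<subseteq> Y \<tau>"
    "\<And>\<tau> p. \<tau> \<subseteq> I \<Longrightarrow> p \<in> \<tau> \<Longrightarrow> card (E \<tau> p) = card (Y \<tau>) div m \<tau>"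
    "\<And>\<tau>. \<tau> \<subseteq> I \<Longrightarrow> disjoint_family_on (E \<tau>) \<tau>" by metis
  define T where "T p = {\<tau>. \<tau> \<subseteq> I \<and> p \<in> \<tau>}" for p
  have fT: "finite (T p)" for p using assms(1) by (auto simp: T_def)
  define D where "D p = (\<Union>\<tau>\<in>T p. E \<tau> p)" for p
  have fY: "finite (Y \<tau>)" for \<tau> using assms by (simp add: Y_def)
  have DA: "D p \<subseteq> A p" if "p \<in> I" for p
  proof
    fix v assume "v \<in> D p"
    then obtain \<tau> where t: "\<tau> \<subseteq> I" "p \<in> \<tau>" "v \<in> E \<tau> p" by (auto simp: D_def T_def)
    then have "\<sigma> v = \<tau>" using E(1) by (auto simp: Y_def)
    then show "v \<in> A p" using t by (auto simp: \<sigma>_def)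
  qed
  have dis: "disjoint_family_on D I"
    unfolding disjoint_family_on_def
  proof (intro ballI impI equals0I)
    fix p p' v assume pp: "p \<in> I" "p' \<in> I" "p \<noteq> p'" and v: "v \<in> D p \<inter> D p'"
    then obtain \<tau> \<tau>' where t: "\<tau> \<subseteq> I" "p \<in> \<tau>" "v \<in> E \<tau> p" "\<tau>' \<subseteq> I" "p' \<in> \<tau>'" "v \<in> E \<tau>' p'"
      by (auto simp: D_def T_def)
    have "v \<in> Y \<tau>" using E(1) t by blast
    moreover have "v \<in> Y \<tau>'" using E(1) t by blast
    ultimately have "\<tau> = \<tau>'" by (auto simp: Y_def)
    then have "p' \<in> \<tau>" "v \<in> E \<tau> p'" using t by simp_all
    moreover have "E \<tau> p \<inter> E \<tau> p' = {}"
      using E(3)[OF t(1)] t(2) calculation(1) pp(3) by (simp add: disjoint_family_on_def)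
    ultimately have "v \<in> {}" using t(3) by (metis IntI)
    then show False by simp
  qed
  have card: "real (card (D p)) \<ge> (\<Sum>v\<in>A p. 1 / real (max K (card {p\<in>I. v \<in> A p}))) - 2 ^ card I"
    if p: "p \<in> I" for p
  proof -
    have fE: "finite (E \<tau> p)" if "\<tau> \<in> T p" for \<tau>
      by (rule finite_subset[OF E(1) fY]) (use that in \<open>simp_all add: T_def\<close>)
    have disE: "E \<tau> p \<inter> E \<tau>' p = {}" if "\<tau> \<in> T p" "\<tau>' \<in> T p" "\<tau> \<noteq> \<tau>'" for \<tau> \<tau>'
    proof -
      have "E \<tau> p \<subseteq> Y \<tau>" "E \<tau>' p \<subseteq> Y \<tau>'" using E(1) that by (auto simp: T_def)
      moreover have "Y \<tau> \<inter> Y \<tau>' = {}" using that by (auto simp: Y_def)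
      ultimately show ?thesis by blast
    qed
    have "card (D p) = (\<Sum>\<tau>\<in>T p. card (E \<tau> p))"
      unfolding D_def by (rule card_UN_disjoint) (use fT fE disE in auto)
    also have "\<dots> = (\<Sum>\<tau>\<in>T p. card (Y \<tau>) div m \<tau>)"
      by (rule sum.cong) (use E(2) in \<open>auto simp: T_def\<close>)
    finally have "real (card (D p)) = (\<Sum>\<tau>\<in>T p. real (card (Y \<tau>) div m \<tau>))" by simp
    also have "\<dots> \<ge> (\<Sum>\<tau>\<in>T p. real (card (Y \<tau>)) / real (m \<tau>) - 1)"
    proof (rule sum_mono)
      fix \<tau>
      have m0: "m \<tau> > 0" using assms(4) by (simp add: m_def)
      have "card (Y \<tau>) < (card (Y \<tau>) div m \<tau> + 1) * m \<tau>"
        using dividend_less_div_times[of "m \<tau>" "card (Y \<tau>)"] m0 by (simp add: algebra_simps)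
      then have "real (card (Y \<tau>)) < real ((card (Y \<tau>) div m \<tau> + 1) * m \<tau>)" by (simp only: of_nat_less_iff)
      then have "real (card (Y \<tau>)) < (real (card (Y \<tau>) div m \<tau>) + 1) * real (m \<tau>)" by (simp only: of_nat_mult of_nat_add of_nat_1)
      then have "real (card (Y \<tau>)) / real (m \<tau>) < real (card (Y \<tau>) div m \<tau>) + 1"
        using m0 by (simp only: pos_divide_less_eq of_nat_0_less_iff)
      then show "real (card (Y \<tau>)) / real (m \<tau>) - 1 \<le> real (card (Y \<tau>) div m \<tau>)" by simp
    qed
    also have "(\<Sum>\<tau>\<in>T p. real (card (Y \<tau>)) / real (m \<tau>) - 1) = (\<Sum>\<tau>\<in>T p. real (card (Y \<tau>)) / real (m \<tau>)) - real (card (T p))"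
      by (simp add: sum_subtractf)
    also have "(\<Sum>\<tau>\<in>T p. real (card (Y \<tau>)) / real (m \<tau>)) = (\<Sum>\<tau>\<in>T p. \<Sum>v\<in>{v\<in>A p. \<sigma> v = \<tau>}. 1 / real (m (\<sigma> v)))"
    proof (rule sum.cong)
      fix \<tau> assume "\<tau> \<in> T p"
      then have "{v\<in>A p. \<sigma> v = \<tau>} = Y \<tau>" using assms(3)[OF p] by (auto simp: T_def Y_def \<sigma>_def)
      then show "real (card (Y \<tau>)) / real (m \<tau>) = (\<Sum>v\<in>{v\<in>A p. \<sigma> v = \<tau>}. 1 / real (m (\<sigma> v)))"
        by (simp add: Y_def)
    qed simp
    also have "\<dots> = (\<Sum>v\<in>A p. 1 / real (m (\<sigma> v)))"
      by (rule sum.group) (use fT finite_subset[OF assms(3)[OF p] assms(2)] p in \<open>auto simp: T_def \<sigma>_def\<close>)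
    finally have "real (card (D p)) \<ge> (\<Sum>v\<in>A p. 1 / real (m (\<sigma> v))) - real (card (T p))" .
    moreover have "card (T p) \<le> card (Pow I)" by (rule card_mono) (use assms in \<open>auto simp: T_def\<close>)
    then have "card (T p) \<le> 2 ^ card I" using assms(1) by (simp add: card_Pow)
    then have "real (card (T p)) \<le> real (2 ^ card I)" by (simp only: of_nat_le_iff)
    then have "real (card (T p)) \<le> 2 ^ card I" by simp
    ultimately show ?thesis unfolding m_def \<sigma>_def by linarith
  qed
  show ?thesis using that[of D] DA dis card by blast
qed

text \<open>Stands in for Cauchy-Schwarz when passing from a variance to a mean absolute deviation;
  the scale \<open>s\<close> will be \<open>\<eta> * k\<close>.\<close>

lemma abs_le_scaled_square:
  fixes u s :: real
  assumes "s > 0"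
  shows "\<bar>u\<bar> \<le> u\<^sup>2 / (2 * s) + s / 2"
proof -
  have "0 \<le> (\<bar>u\<bar> - s)\<^sup>2" by simp
  also have "\<dots> = u\<^sup>2 + s\<^sup>2 - 2 * s * \<bar>u\<bar>" by (simp add: power2_diff mult_ac)
  finally have "2 * s * \<bar>u\<bar> \<le> u\<^sup>2 + s\<^sup>2" by simp
  then show ?thesis using assms by (simp add: field_simps power2_eq_square)
qed

text \<open>The bound on the squares is a variance bound around the mean load \<open>l\<close>. As
  \<open>k \<le> l \<le> k + r\<close>, the excess over \<open>k\<close> is at most the deviation
  from \<open>l\<close> plus \<open>r\<close>. On the deviation scale \<open>\<eta> * k\<close>, the
  hypothesis on \<open>\<gamma>\<close> makes the quadratic part of the variance contribute at most
  \<open>\<eta> * k * N / 2\<close>, the scale itself contributes another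
  \<open>\<eta> * k * N / 2\<close>, and \<open>\<eta> * k \<ge> r + (2 + r) / \<eta>\<close>
  absorbs the rest.\<close>

lemma sum_excess_le:
  fixes c :: "'x \<Rightarrow> real" and X and \<eta> \<gamma> k N r :: real
  defines "S \<equiv> sum c X"
  assumes "finite X" "N = real (card X)" "N > 0" "0 < \<gamma>" "\<gamma> \<le> 1/2" "0 < \<eta>" "\<gamma> \<le> \<eta>\<^sup>2 / 8"
    and "r \<ge> 1" "k \<ge> r" "\<eta> * k \<ge> r + (2 + r) / \<eta>"
    and S: "k * N \<le> S" "S \<le> (k + r) * N"
    and sq: "(\<Sum>v\<in>X. (c v)\<^sup>2) \<le> S\<^sup>2 / (N * (1 - \<gamma>)) + (2 / r + r) * S"
  shows "(\<Sum>v\<in>X. max 0 (c v - k)) \<le> 2 * \<eta> * k * N"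
proof -
  define l where "l = S / N"
  have l: "S = l * N" using assms by (simp add: l_def)
  have k0: "k > 0" using assms by linarith
  have lk: "k \<le> l" "l \<le> k + r" using S \<open>N > 0\<close> unfolding l by simp_all
  have l2: "l \<le> 2 * k" using lk assms by linarith
  have "(\<Sum>v\<in>X. 2 * c v * l) = 2 * l * S" unfolding S_def sum_distrib_left by (rule sum.cong) auto
  then have "(\<Sum>v\<in>X. (c v - l)\<^sup>2) = (\<Sum>v\<in>X. (c v)\<^sup>2) - 2 * l * S + N * l\<^sup>2"
    using assms(3) by (simp add: power2_diff sum.distrib sum_subtractf)
  then have "(\<Sum>v\<in>X. (c v - l)\<^sup>2) = (\<Sum>v\<in>X. (c v)\<^sup>2) - N * l\<^sup>2"
    unfolding l by (simp add: power2_eq_square algebra_simps)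
  also have "\<dots> \<le> 2 * \<gamma> * (N * l\<^sup>2) + (2 + r) * (N * l)"
  proof -
    have "S\<^sup>2 / (N * (1 - \<gamma>)) = (N * l\<^sup>2) * (1 / (1 - \<gamma>))"
      using \<open>N > 0\<close> unfolding l by (simp add: power2_eq_square)
    also have "\<dots> \<le> (N * l\<^sup>2) * (1 + 2 * \<gamma>)"
    proof (rule mult_left_mono)
      have "\<gamma> * (2 * \<gamma>) \<le> \<gamma> * 1" using assms by (intro mult_left_mono) auto
      then have "1 \<le> (1 + 2 * \<gamma>) * (1 - \<gamma>)" by (simp add: algebra_simps)
      then show "1 / (1 - \<gamma>) \<le> 1 + 2 * \<gamma>" using assms by (simp add: divide_le_eq)
    qed (use \<open>N > 0\<close> in simp)
    finally have 1: "S\<^sup>2 / (N * (1 - \<gamma>)) \<le> (N * l\<^sup>2) * (1 + 2 * \<gamma>)" .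
    have "2 / r \<le> 2" using assms by (simp add: divide_le_eq)
    then have "(2 / r + r) * (N * l) \<le> (2 + r) * (N * l)"
      using \<open>N > 0\<close> lk k0 by (intro mult_right_mono) auto
    then have "(2 / r + r) * S \<le> (2 + r) * (N * l)" unfolding l by (simp only: mult.commute[of N])
    then show ?thesis using 1 sq by (simp add: algebra_simps)
  qed
  also have "\<dots> \<le> 2 * \<gamma> * (N * (2 * k)\<^sup>2) + (2 + r) * (N * (2 * k))"
    using assms l2 lk k0 by (intro add_mono mult_left_mono power_mono) auto
  finally have var: "(\<Sum>v\<in>X. (c v - l)\<^sup>2) \<le> 8 * \<gamma> * N * k\<^sup>2 + 2 * (2 + r) * N * k"
    by (simp add: power2_eq_square algebra_simps)
  have ek: "\<eta> * k > 0" using assms k0 by simp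
  have "(\<Sum>v\<in>X. max 0 (c v - k)) \<le> (\<Sum>v\<in>X. (c v - l)\<^sup>2 / (2 * (\<eta> * k)) + (\<eta> * k / 2 + r))"
  proof (rule sum_mono)
    fix v
    have "max 0 (c v - k) \<le> \<bar>c v - l\<bar> + r" using lk assms by auto
    then show "max 0 (c v - k) \<le> (c v - l)\<^sup>2 / (2 * (\<eta> * k)) + (\<eta> * k / 2 + r)"
      using abs_le_scaled_square[OF ek, of "c v - l"] by linarith
  qed
  also have "\<dots> = (\<Sum>v\<in>X. (c v - l)\<^sup>2) / (2 * (\<eta> * k)) + N * (\<eta> * k / 2 + r)"
    using assms(3) by (simp add: sum.distrib sum_divide_distrib algebra_simps)
  also have "\<dots> \<le> (8 * \<gamma> * N * k\<^sup>2 + 2 * (2 + r) * N * k) / (2 * (\<eta> * k)) + N * (\<eta> * k / 2 + r)"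
    using var ek by (intro add_right_mono divide_right_mono) auto
  also have "(8 * \<gamma> * N * k\<^sup>2 + 2 * (2 + r) * N * k) / (2 * (\<eta> * k)) = 4 * N * k * (\<gamma> / \<eta>) + N * ((2 + r) / \<eta>)"
    using assms k0 by (simp add: field_simps power2_eq_square)
  also have "4 * N * k * (\<gamma> / \<eta>) \<le> 4 * N * k * (\<eta> / 8)"
    using assms k0 by (intro mult_left_mono) (auto simp: field_simps power2_eq_square)
  also have "4 * N * k * (\<eta> / 8) + N * ((2 + r) / \<eta>) + N * (\<eta> * k / 2 + r) = N * (\<eta> * k + (r + (2 + r) / \<eta>))"
    by (simp add: algebra_simps)
  also have "\<dots> \<le> N * (\<eta> * k + \<eta> * k)" using assms by (intro mult_left_mono) auto
  finally show ?thesis by (simp add: algebra_simps)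
qed

lemma box_load_eq_card:
  "box_load r T A v = real (card {p \<in> {..<T} \<times> {..<r}. v \<in> A (fst p) (snd p)})"
proof -
  have "box_load r T A v = (\<Sum>p\<in>{..<T} \<times> {..<r}. of_bool (v \<in> A (fst p) (snd p)))"
    unfolding box_load_def by (simp only: sum.cartesian_product case_prod_unfold)
  also have "\<dots> = (\<Sum>p\<in>{p \<in> {..<T} \<times> {..<r}. v \<in> A (fst p) (snd p)}. 1)"
    by (rule sum.mono_neutral_cong_right) auto
  also have "\<dots> = real (card {p \<in> {..<T} \<times> {..<r}. v \<in> A (fst p) (snd p)})" by simp
  finally show ?thesis .
qed

text \<open>Up to rounding, the shares reach the target \<open>a t / K\<close> on each side except
  for a loss caused by vertices of load above \<open>K\<close>. Summed over all boxes and sides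
  these losses are at most \<open>\<xi> / K\<close>, so they need no control box by box. The other
  two errors are the rounding of the shares and the part \<open>a t / q\<close> of each box at which
  greedy matching stops.\<close>

lemma matching_in_boxes:
  fixes X :: "'x set" and T r :: nat and \<xi> :: real and A :: "nat \<Rightarrow> nat \<Rightarrow> 'x set"
  defines "c \<equiv> box_load r T A"
  assumes "finite X" "r \<ge> 1" "K \<ge> 1" "q \<ge> 1"
    and A: "\<And>t i. t < T \<Longrightarrow> i < r \<Longrightarrow> A t i \<subseteq> X" "\<And>t i. t < T \<Longrightarrow> i < r \<Longrightarrow> card (A t i) = a t"
    and reg: "\<And>t. t < T \<Longrightarrow> lower_regular q r F (A t)"
    and exc: "(\<Sum>v\<in>X. max 0 (c v - real K)) \<le> \<xi>"
    and S: "(\<Sum>v\<in>X. c v) = real r * (\<Sum>t<T. real (a t))"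
  shows "\<exists>M. M \<subseteq> F \<and> finite M \<and> disjoint_tuples r M \<and>
    (\<Sum>t<T. real (a t)) / real K - \<xi> / real K - real T * 2 ^ (T * r) - (\<Sum>t<T. real (a t)) / real q \<le> real (card M)"
proof -
  define I where "I = {..<T} \<times> {..<r}"
  define R :: real where "R = 2 ^ (T * r)"
  have cI: "card I = T * r" "finite I" by (simp_all add: I_def)
  have cc: "c v = real (card {p\<in>I. v \<in> A (fst p) (snd p)})" for v
    unfolding c_def I_def by (rule box_load_eq_card)
  \<comment> \<open>The share that a vertex gives, before rounding, to each box side containing
    it.\<close>
  define h where "h v = 1 / max (real K) (c v)" for v
  have h_eq: "1 / real (max K (card {p\<in>I. v \<in> A (fst p) (snd p)})) = h v" for v
    by (simp add: h_def cc of_nat_max)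
  obtain D where D: "\<And>p. p \<in> I \<Longrightarrow> D p \<subseteq> A (fst p) (snd p)" "disjoint_family_on D I"
    "\<And>p. p \<in> I \<Longrightarrow> real (card (D p)) \<ge> (\<Sum>v\<in>A (fst p) (snd p). h v) - R"
  proof (rule split_evenly[OF cI(2) \<open>finite X\<close> _ \<open>K \<ge> 1\<close>, of "\<lambda>p. A (fst p) (snd p)"])
    show "A (fst p) (snd p) \<subseteq> X" if "p \<in> I" for p
      using A(1)[of "fst p" "snd p"] that by (auto simp: I_def)
  qed (unfold h_eq cI R_def, blast)
  have K0: "real K > 0" using \<open>K \<ge> 1\<close> by simp
  define loss where "loss t i = real (a t) / real K - (\<Sum>v\<in>A t i. h v)" for t i
  have fA: "finite (A t i)" if "t < T" "i < r" for t i using A(1)[OF that] \<open>finite X\<close> finite_subset by blast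
  have loss0: "loss t i \<ge> 0" if "t < T" "i < r" for t i
  proof -
    have "h v \<le> 1 / real K" for v using K0 by (simp add: h_def frac_le)
    then have "(\<Sum>v\<in>A t i. h v) \<le> of_nat (card (A t i)) * (1 / real K)" by (intro sum_bounded_above) auto
    then show ?thesis using A(2)[OF that] by (simp add: loss_def)
  qed
  \<comment> \<open>A box is limited by its smallest side. Subtracting the losses of all its sides
    bounds each of them from below at once, and only the total of the losses is going to
    matter.\<close>
  define \<beta> where "\<beta> t = real (a t) / real K - (\<Sum>i<r. loss t i) - R" for t
  define b where "b t = nat \<lceil>\<beta> t\<rceil>" for t
  have bD: "b t \<le> card (D (t, i))" if "t < T" "i < r" for t i
  proof -
    have "loss t i \<le> (\<Sum>i<r. loss t i)" by (rule member_le_sum) (use that loss0 in auto)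
    then have "\<beta> t \<le> (\<Sum>v\<in>A t i. h v) - R" by (simp add: \<beta>_def loss_def)
    also have "\<dots> \<le> real (card (D (t, i)))" using D(3)[of "(t, i)"] that by (simp add: I_def)
    finally show ?thesis unfolding b_def by (simp add: ceiling_le_iff)
  qed
  define Q where "Q t M \<longleftrightarrow> M \<subseteq> F \<inter> PiE {..<r} (\<lambda>i. D (t, i)) \<and> finite M \<and> card M = b t - a t div q \<and>
     disjoint_tuples r M" for t M
  have "\<exists>M. Q t M" if t: "t < T" for t
  proof -
    have DA: "D (t, i) \<subseteq> A t i" if "i < r" for i using D(1)[of "(t, i)"] t that by (simp add: I_def)
    have dis: "disjoint_family_on (\<lambda>i. D (t, i)) {..<r}"
      using D(2) t unfolding disjoint_family_on_def I_def by auto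
    show ?thesis unfolding Q_def
      by (rule greedy_matching_in_box[OF reg[OF t] A(2)[OF t] DA finite_subset[OF DA fA[OF t]] dis bD[OF t] \<open>r \<ge> 1\<close> \<open>q \<ge> 1\<close>])
  qed
  then obtain M where "\<And>t. t < T \<Longrightarrow> Q t (M t)" by metis
  then have M: "\<And>t. t < T \<Longrightarrow> M t \<subseteq> F \<inter> PiE {..<r} (\<lambda>i. D (t, i))" "\<And>t. t < T \<Longrightarrow> finite (M t)"
    "\<And>t. t < T \<Longrightarrow> card (M t) = b t - a t div q"
    "\<And>t x y. t < T \<Longrightarrow> x \<in> M t \<Longrightarrow> y \<in> M t \<Longrightarrow> x \<noteq> y \<Longrightarrow> x ` {..<r} \<inter> y ` {..<r} = {}"
    unfolding Q_def by simp_all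
  have MD: "x i \<in> D (t, i)" if "t < T" "x \<in> M t" "i < r" for t x i
    using subsetD[OF M(1)[OF that(1)] that(2)] that(3) by (simp add: PiE_iff)
  have dis: "x ` {..<r} \<inter> y ` {..<r} = {}" if "t < T" "t' < T" "t \<noteq> t'" "x \<in> M t" "y \<in> M t'" for t t' x y
  proof (rule equals0I)
    fix v assume "v \<in> x ` {..<r} \<inter> y ` {..<r}"
    then obtain i j where ij: "i < r" "j < r" "v = x i" "v = y j" by auto
    have "v \<in> D (t, i)" "v \<in> D (t', j)" 
      using MD[OF that(1,4) ij(1)] MD[OF that(2,5) ij(2)] ij(3,4) by simp_all
    moreover have "D (t, i) \<inter> D (t', j) = {}"
      using D(2) that ij unfolding disjoint_family_on_def I_def by auto
    ultimately show False by blast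
  qed
  have disM: "M t \<inter> M t' = {}" if "t < T" "t' < T" "t \<noteq> t'" for t t'
  proof (rule equals0I)
    fix x assume "x \<in> M t \<inter> M t'"
    then have "x ` {..<r} \<inter> x ` {..<r} = {}" using dis that by blast
    then show False using \<open>r \<ge> 1\<close> by (auto simp: lessThan_empty_iff)
  qed
  define U where "U = (\<Union>t<T. M t)"
  have "card U = (\<Sum>t<T. card (M t))"
    unfolding U_def by (rule card_UN_disjoint) (use M(2) disM in auto)
  then have "real (card U) = (\<Sum>t<T. real (b t - a t div q))" using M(3) by simp
  also have "\<dots> \<ge> (\<Sum>t<T. \<beta> t - real (a t) / real q)"
  proof (rule sum_mono)
    fix t
    have "\<beta> t \<le> real (b t)" unfolding b_def by linarith
    moreover have "real (a t div q) \<le> real (a t) / real q" by (rule of_nat_div_le_of_nat)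
    ultimately show "\<beta> t - real (a t) / real q \<le> real (b t - a t div q)" by linarith
  qed
  also have "(\<Sum>t<T. \<beta> t - real (a t) / real q) = (\<Sum>t<T. real (a t)) / real K - (\<Sum>t<T. \<Sum>i<r. loss t i) - real T * R - (\<Sum>t<T. real (a t)) / real q"
    by (simp add: \<beta>_def sum_subtractf sum_divide_distrib)
  finally have cU: "(\<Sum>t<T. real (a t)) / real K - (\<Sum>t<T. \<Sum>i<r. loss t i) - real T * R - (\<Sum>t<T. real (a t)) / real q \<le> real (card U)" .
  have "(\<Sum>t<T. \<Sum>i<r. \<Sum>v\<in>A t i. h v) = (\<Sum>t<T. \<Sum>i<r. \<Sum>v\<in>X. of_bool (v \<in> A t i) * h v)"
    by (intro sum.cong refl sum_of_bool_mem[symmetric]) (use A \<open>finite X\<close> in auto)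
  also have "\<dots> = (\<Sum>t<T. \<Sum>v\<in>X. \<Sum>i<r. of_bool (v \<in> A t i) * h v)"
    by (intro sum.cong refl sum.swap)
  also have "\<dots> = (\<Sum>v\<in>X. \<Sum>t<T. \<Sum>i<r. of_bool (v \<in> A t i) * h v)" by (rule sum.swap)
  also have "\<dots> = (\<Sum>v\<in>X. c v * h v)" by (simp add: c_def box_load_def sum_distrib_right)
  finally have hs: "(\<Sum>t<T. \<Sum>i<r. \<Sum>v\<in>A t i. h v) = (\<Sum>v\<in>X. c v * h v)" .
  \<comment> \<open>A vertex of load at most \<open>K\<close> distributes \<open>c v / K\<close> in
    all, an overloaded one distributes exactly 1.\<close>
  have "(\<Sum>v\<in>X. c v * h v) \<ge> (\<Sum>v\<in>X. (c v - max 0 (c v - real K)) / real K)"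
  proof (rule sum_mono)
    fix v
    show "(c v - max 0 (c v - real K)) / real K \<le> c v * h v"
      using K0 by (cases "c v \<le> real K") (auto simp: h_def max_def)
  qed
  moreover have "(\<Sum>v\<in>X. (c v - max 0 (c v - real K)) / real K) = (sum c X - (\<Sum>v\<in>X. max 0 (c v - real K))) / real K"
    by (simp add: sum_divide_distrib[symmetric] sum_subtractf)
  moreover have "(sum c X - \<xi>) / real K \<le> (sum c X - (\<Sum>v\<in>X. max 0 (c v - real K))) / real K"
    using exc K0 by (intro divide_right_mono) auto
  ultimately have hs2: "(sum c X - \<xi>) / real K \<le> (\<Sum>v\<in>X. c v * h v)" by linarith
  have "(\<Sum>t<T. \<Sum>i<r. loss t i) = real r * (\<Sum>t<T. real (a t)) / real K - (\<Sum>v\<in>X. c v * h v)"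
    unfolding hs[symmetric] loss_def by (simp add: sum_subtractf sum_divide_distrib sum_distrib_left)
  also have "\<dots> \<le> \<xi> / real K" using hs2 S by (simp add: diff_divide_distrib)
  finally have "(\<Sum>t<T. \<Sum>i<r. loss t i) \<le> \<xi> / real K" .
  then have "real (card U) \<ge> (\<Sum>t<T. real (a t)) / real K - \<xi> / real K - real T * 2 ^ (T * r) - (\<Sum>t<T. real (a t)) / real q"
    using cU unfolding R_def by linarith
  moreover have "U \<subseteq> F" "finite U" using M(1,2) by (auto simp: U_def)
  moreover have "x ` {..<r} \<inter> y ` {..<r} = {}" if xy: "x \<in> U" "y \<in> U" "x \<noteq> y" for x y
  proof -
    obtain t t' where t: "t < T" "x \<in> M t" "t' < T" "y \<in> M t'" using xy by (auto simp: U_def)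
    show ?thesis
    proof (cases "t = t'")
      case True
      then show ?thesis using M(4)[OF t(1,2) _ xy(3)] t(4) by simp
    next
      case False
      show ?thesis by (rule dis[OF t(1,3) False t(2,4)])
    qed
  qed
  ultimately show ?thesis by (intro exI[of _ U] conjI ballI impI) simp_all
qed

text \<open>The slack \<open>\<gamma>\<close> is produced before \<open>\<delta>\<close> is given,
  because in the application \<open>\<delta>\<close> depends on \<open>\<gamma>\<close>. Only the
  lower bound on \<open>card X\<close> depends on \<open>\<delta>\<close>.\<close>

lemma near_perfect_tuple_matching:
  fixes \<kappa> :: real
  assumes "r \<ge> 1" "\<kappa> > 0"
  obtains \<gamma> where "0 < \<gamma>" "\<gamma> < 1"
    "\<And>\<delta>. \<delta> > 0 \<Longrightarrow> \<exists>N0. \<forall>(X :: 'x set) F. finite X \<and> card X \<ge> N0 \<and> F \<subseteq> {..<r} \<rightarrow>\<^sub>E X \<and> robust_cover \<gamma> \<delta> r X F \<longrightarrow>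
      (\<exists>M. M \<subseteq> F \<and> finite M \<and> disjoint_tuples r M \<and>
        (1 - \<kappa>) * real (card X) / real r \<le> real (card M))"
proof -
  \<comment> \<open>Four errors of size \<open>\<eta> * N\<close> will arise: two from overloaded
    vertices, one from rounding, one from the unfinished parts of the boxes.\<close>
  define \<eta> where "\<eta> = \<kappa> / (4 * real r)"
  have \<eta>: "\<eta> > 0" using assms by (simp add: \<eta>_def)
  define \<gamma> where "\<gamma> = min (1/2) (\<eta>\<^sup>2 / 8)"
  have \<gamma>: "0 < \<gamma>" "\<gamma> \<le> 1/2" "\<gamma> \<le> \<eta>\<^sup>2 / 8" using \<eta> by (auto simp: \<gamma>_def)
  \<comment> \<open>Chosen for the condition \<open>\<eta> * k \<ge> r + (2 + r) / \<eta>\<close> of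
    \<open>sum_excess_le\<close>; the summand \<open>r\<close> gives
    \<open>K \<ge> r\<close>.\<close>
  define K where "K = nat \<lceil>(real r + (2 + real r) / \<eta>) / \<eta>\<rceil> + r"
  have "real K \<ge> (real r + (2 + real r) / \<eta>) / \<eta>" unfolding K_def by linarith
  then have K: "\<eta> * real K \<ge> real r + (2 + real r) / \<eta>" using \<eta> by (simp add: field_simps)
  have K1: "K \<ge> 1" "real K \<ge> real r" using assms by (auto simp: K_def)
  \<comment> \<open>The box sizes \<open>a t\<close> add up to at most \<open>2 * K * N\<close>, and
    greedy matching leaves a proportion \<open>1 / q\<close> of this.\<close>
  define q where "q = nat \<lceil>2 * real K / \<eta>\<rceil> + 1"
  have "real q \<ge> 2 * real K / \<eta>" unfolding q_def by linarith
  then have q: "2 * real K \<le> \<eta> * real q" using \<eta> by (simp add: field_simps)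
  have q1: "q \<ge> 1" by (simp add: q_def)
  have main: "\<exists>N0. \<forall>(X :: 'x set) F. finite X \<and> card X \<ge> N0 \<and> F \<subseteq> {..<r} \<rightarrow>\<^sub>E X \<and> robust_cover \<gamma> \<delta> r X F \<longrightarrow>
      (\<exists>M. M \<subseteq> F \<and> finite M \<and> disjoint_tuples r M \<and>
        (1 - \<kappa>) * real (card X) / real r \<le> real (card M))" if \<delta>: "\<delta> > 0" for \<delta>
  proof -
    have \<gamma>1: "\<gamma> < 1" using \<gamma> by linarith
    obtain T0 N0 where boxes: "\<forall>(X :: 'x set) F.
      finite X \<and> card X \<ge> N0 \<and> F \<subseteq> {..<r} \<rightarrow>\<^sub>E X \<and> robust_cover \<gamma> \<delta> r X F \<longrightarrow>
      near_uniform \<gamma> q K r T0 X F"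
      using near_uniform_boxes[OF \<open>r \<ge> 1\<close> \<gamma>(1) \<gamma>1 \<delta> q1 K1(1), where 'x = 'x] by (elim exE) (rule that)
    \<comment> \<open>The rounding error depends on \<open>T0\<close> and \<open>r\<close> only, so
      it drops below \<open>\<eta> * N\<close> for large \<open>X\<close>.\<close>
    define N1 where "N1 = N0 + nat \<lceil>real T0 * 2 ^ (T0 * r) / \<eta>\<rceil> + 1"
    show ?thesis
    proof (intro exI[of _ N1] allI impI, elim conjE)
      fix X :: "'x set" and F assume X: "finite X" "N1 \<le> card X" and F: "F \<subseteq> {..<r} \<rightarrow>\<^sub>E X" "robust_cover \<gamma> \<delta> r X F"
      define N where "N = real (card X)"
      have "card X \<ge> N0" using X by (simp add: N1_def)
      have N0: "N > 0" using X by (simp add: N_def N1_def)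
      have "real T0 * 2 ^ (T0 * r) / \<eta> \<le> N" using X(2) unfolding N1_def N_def by linarith
      then have NT: "real T0 * 2 ^ (T0 * r) \<le> \<eta> * N" using \<eta> by (simp add: field_simps)
      from boxes[rule_format, OF conjI[OF X(1) conjI[OF \<open>card X \<ge> N0\<close> conjI[OF F]]]] obtain T A a where T: "T \<le> T0"
        and A: "\<And>t i. t < T \<Longrightarrow> i < r \<Longrightarrow> A t i \<subseteq> X" "\<And>t i. t < T \<Longrightarrow> i < r \<Longrightarrow> card (A t i) = a t"
        and reg: "\<And>t. t < T \<Longrightarrow> lower_regular q r F (A t)"
        and S1: "real K * N \<le> (\<Sum>v\<in>X. box_load r T A v)"
        and S2: "(\<Sum>v\<in>X. box_load r T A v) \<le> (real K + real r) * N"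
        and S3: "(\<Sum>v\<in>X. box_load r T A v) = real r * (\<Sum>t<T. real (a t))"
        and S4: "(\<Sum>v\<in>X. (box_load r T A v)\<^sup>2) \<le> (\<Sum>v\<in>X. box_load r T A v)\<^sup>2 / (N * (1 - \<gamma>))
          + (2 / real r + real r) * (\<Sum>v\<in>X. box_load r T A v)" unfolding N_def by blast
      have exc: "(\<Sum>v\<in>X. max 0 (box_load r T A v - real K)) \<le> 2 * \<eta> * real K * N"
        by (rule sum_excess_le[OF X(1) _ N0 \<gamma>(1,2) \<eta> \<gamma>(3) _ K1(2) K S1 S2 S4]) (use assms in \<open>auto simp: N_def\<close>)
      obtain M where M: "M \<subseteq> F" "finite M" "\<forall>x\<in>M. \<forall>y\<in>M. x \<noteq> y \<longrightarrow> x ` {..<r} \<inter> y ` {..<r} = {}"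
        and cM: "(\<Sum>t<T. real (a t)) / real K - 2 * \<eta> * real K * N / real K - real T * 2 ^ (T * r) - (\<Sum>t<T. real (a t)) / real q \<le> real (card M)"
        using matching_in_boxes[OF X(1) \<open>r \<ge> 1\<close> K1(1) q1 A reg exc S3] by blast
      define s where "s = (\<Sum>t<T. real (a t))"
      have r0: "real r \<ge> 1" using assms by simp
      have s1: "N / real r \<le> s / real K" using S1 S3 K1 r0 unfolding s_def[symmetric] by (simp add: field_simps)
      have s2: "s / real q \<le> \<eta> * N"
      proof -
        have "real r * s \<le> (2 * real K) * N"
          using S2 S3 K1 N0 unfolding s_def[symmetric] by (smt (verit) mult_right_mono)
        moreover have "0 \<le> s" unfolding s_def by (rule sum_nonneg) simp
        then have "1 * s \<le> real r * s" using r0 by (rule mult_right_mono[rotated])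
        moreover have "(2 * real K) * N \<le> (\<eta> * real q) * N" using q N0 by (intro mult_right_mono) auto
        ultimately have "s \<le> (\<eta> * real q) * N" by linarith
        then show ?thesis using q1 by (simp add: divide_le_eq mult_ac)
      qed
      have s3: "real T * 2 ^ (T * r) \<le> \<eta> * N"
      proof -
        have "real T * 2 ^ (T * r) \<le> real T0 * 2 ^ (T0 * r)"
          using T by (intro mult_mono power_increasing) auto
        then show ?thesis using NT by linarith
      qed
      have s4: "2 * \<eta> * real K * N / real K = 2 * \<eta> * N" using K1 by simp
      have "real (card M) \<ge> N / real r - 4 * \<eta> * N"
        using cM s1 s2 s3 unfolding s4 s_def[symmetric] by linarith
      also have "N / real r - 4 * \<eta> * N = (1 - \<kappa>) * N / real r" using r0 by (simp add: \<eta>_def field_simps)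
      finally show "\<exists>M. M \<subseteq> F \<and> finite M \<and> disjoint_tuples r M \<and>
        (1 - \<kappa>) * real (card X) / real r \<le> real (card M)"
        using M unfolding N_def by blast
    qed
  qed
  show ?thesis by (rule that[of \<gamma>]) (use \<gamma> main in auto)
qed

section \<open>The threshold for perfect fractional matchings\<close>

lemma set_degree_le_choose:
  assumes "k_graph k V E" "S \<subseteq> V" "card S = d" "d \<le> k"
  shows "set_degree E S \<le> (card V - d) choose (k - d)"
proof -
  have fV: "finite V" and E: "\<And>e. e \<in> E \<Longrightarrow> e \<subseteq> V \<and> card e = k" using assms by (auto simp: k_graph_def)
  have fS: "finite S" using assms fV finite_subset by blast
  have "card {e \<in> E. S \<subseteq> e} \<le> card {T. T \<subseteq> V - S \<and> card T = k - d}"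
  proof (rule card_inj_on_le[where f = "\<lambda>e. e - S"])
    show "inj_on (\<lambda>e. e - S) {e \<in> E. S \<subseteq> e}" by (auto simp: inj_on_def)
    show "(\<lambda>e. e - S) ` {e \<in> E. S \<subseteq> e} \<subseteq> {T. T \<subseteq> V - S \<and> card T = k - d}"
      using E fS assms by (auto simp: card_Diff_subset)
    show "finite {T. T \<subseteq> V - S \<and> card T = k - d}" using fV by simp
  qed
  also have "\<dots> = card (V - S) choose (k - d)" using fV by (simp add: n_subsets)
  also have "card (V - S) = card V - d" using assms fS by (simp add: card_Diff_subset)
  finally show ?thesis by (simp add: set_degree_def)
qed

lemma min_degree_le_set_degree:
  assumes "finite V" "S \<subseteq> V" "card S = d"
  shows "min_degree d V E \<le> set_degree E S"
  unfolding min_degree_def by (rule Min_le) (use assms in auto)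

lemma le_min_degree_iff:
  assumes "finite V" "d \<le> card V"
  shows "x \<le> real (min_degree d V E) \<longleftrightarrow> (\<forall>S. S \<subseteq> V \<and> card S = d \<longrightarrow> x \<le> real (set_degree E S))"
proof
  show "\<forall>S. S \<subseteq> V \<and> card S = d \<longrightarrow> x \<le> real (set_degree E S)" if "x \<le> real (min_degree d V E)"
    using min_degree_le_set_degree[OF assms(1)] that by (meson of_nat_le_iff order_trans)
next
  assume x: "\<forall>S. S \<subseteq> V \<and> card S = d \<longrightarrow> x \<le> real (set_degree E S)"
  have "{S. S \<subseteq> V \<and> card S = d} \<noteq> {}" using obtain_subset_with_card_n[OF assms(2)] by blast
  then have "min_degree d V E \<in> set_degree E ` {S. S \<subseteq> V \<and> card S = d}"
    unfolding min_degree_def by (intro Min_in) (use assms in auto)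
  then show "x \<le> real (min_degree d V E)" using x by auto
qed

abbreviation degree_ge :: "nat \<Rightarrow> nat \<Rightarrow> 'a set \<Rightarrow> real \<Rightarrow> 'a set set \<Rightarrow> bool" where
  "degree_ge k d V \<rho> E \<equiv> \<forall>S. S \<subseteq> V \<and> card S = d \<longrightarrow>
     \<rho> * real ((card V - d) choose (k - d)) \<le> real (set_degree E S)"

lemma pfm_threshold_nat:
  assumes "1 \<le> d" "d < k" "\<epsilon> > 0"
  obtains n0 where "\<And>(V :: nat set) E. \<lbrakk>k_graph k V E; card V \<ge> n0;
      (pfm_threshold k d + \<epsilon>) * real ((card V - d) choose (k - d)) \<le> real (min_degree d V E)\<rbrakk>
      \<Longrightarrow> \<exists>f. perfect_fractional_matching V E f"
proof -
  define P where "P c \<epsilon> n0 \<longleftrightarrow> (\<forall>n\<ge>n0. \<forall>(V :: nat set) E.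
     k_graph k V E \<and> card V = n \<and>
     real (min_degree d V E) \<ge> (c + \<epsilon>) * real ((n - d) choose (k - d)) \<longrightarrow>
     (\<exists>f. perfect_fractional_matching V E f))" for c \<epsilon> :: real and n0
  define A where "A = {c. \<forall>\<epsilon>>0. \<exists>n0. P c \<epsilon> n0}"
  have pA: "pfm_threshold k d = Inf A" by (simp add: pfm_threshold_def A_def P_def)
  have "P 1 \<epsilon> k" if "\<epsilon> > 0" for \<epsilon>
    unfolding P_def
  proof (intro allI impI, elim conjE)
    fix n and V :: "nat set" and E
    assume n: "n \<ge> k" and V: "k_graph k V E" "card V = n"
      and deg: "real (min_degree d V E) \<ge> (1 + \<epsilon>) * real ((n - d) choose (k - d))"
    obtain S where S: "S \<subseteq> V" "card S = d" using obtain_subset_with_card_n[of d V] n V assms by auto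
    have "finite V" using V by (simp add: k_graph_def)
    from min_degree_le_set_degree[OF this S] set_degree_le_choose[OF V(1) S] assms V
    have "min_degree d V E \<le> (n - d) choose (k - d)" by (metis le_trans less_imp_le)
    then have "real (min_degree d V E) \<le> 1 * real ((n - d) choose (k - d))" by simp
    also have "\<dots> < (1 + \<epsilon>) * real ((n - d) choose (k - d))"
      using that n assms by (intro mult_strict_right_mono) auto
    finally show "\<exists>f. perfect_fractional_matching V E f" using deg by simp
  qed
  then have "1 \<in> A" by (auto simp: A_def)
  then have "A \<noteq> {}" by auto
  \<comment> \<open>The infimum need not be attained: an admissible \<open>c\<close> close to it is
    used, with the difference \<open>Inf A + \<epsilon> - c\<close> as its own margin.\<close>
  then obtain c where c: "c \<in> A" "c < Inf A + \<epsilon>" using cInf_lessD[of A "Inf A + \<epsilon>"] \<open>\<epsilon> > 0\<close> by auto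
  have "\<forall>\<epsilon>>0. \<exists>n0. P c \<epsilon> n0" using c(1) unfolding A_def by (rule CollectD)
  moreover have "Inf A + \<epsilon> - c > 0" using c(2) by simp
  ultimately obtain n0 where n0: "P c (Inf A + \<epsilon> - c) n0" by blast
  show ?thesis
  proof (rule that[of n0])
    fix V :: "nat set" and E
    assume "k_graph k V E" "card V \<ge> n0"
      "(pfm_threshold k d + \<epsilon>) * real ((card V - d) choose (k - d)) \<le> real (min_degree d V E)"
    then show "\<exists>f. perfect_fractional_matching V E f"
      using n0 unfolding P_def pA by simp
  qed
qed

lemma set_degree_image:
  assumes "inj_on g V" "k_graph k V E" "S \<subseteq> V"
  shows "set_degree ((`) g ` E) (g ` S) = set_degree E S"
proof -
  have E: "\<And>e. e \<in> E \<Longrightarrow> e \<subseteq> V" using assms by (auto simp: k_graph_def)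
  have "g ` S \<subseteq> g ` e \<longleftrightarrow> S \<subseteq> e" if "e \<in> E" for e
  proof
    assume *: "g ` S \<subseteq> g ` e"
    show "S \<subseteq> e"
    proof
      fix x assume "x \<in> S"
      then have "g x \<in> g ` e" "x \<in> V" using * assms(3) by auto
      then show "x \<in> e" using inj_on_image_mem_iff[OF assms(1) _ E[OF that]] by simp
    qed
  qed (rule image_mono)
  then have "{e' \<in> (`) g ` E. g ` S \<subseteq> e'} = (`) g ` {e \<in> E. S \<subseteq> e}" by blast
  moreover have "inj_on ((`) g) {e \<in> E. S \<subseteq> e}"
    by (rule inj_on_subset[OF inj_on_image_Pow[OF assms(1)]]) (use E in auto)
  ultimately show ?thesis by (simp add: set_degree_def card_image)
qed

lemma perfect_fractional_matching_image:
  assumes "inj_on g V" "k_graph k V E" "perfect_fractional_matching (g ` V) ((`) g ` E) f"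
  shows "perfect_fractional_matching V E (\<lambda>e. f (g ` e))"
proof -
  have E: "\<And>e. e \<in> E \<Longrightarrow> e \<subseteq> V" using assms by (auto simp: k_graph_def)
  have "(\<Sum>e\<in>{e \<in> E. v \<in> e}. f (g ` e)) = 1" if v: "v \<in> V" for v
  proof -
    have "g v \<in> g ` e \<longleftrightarrow> v \<in> e" if "e \<in> E" for e
      by (rule inj_on_image_mem_iff[OF assms(1) v E[OF that]])
    then have "{e' \<in> (`) g ` E. g v \<in> e'} = (`) g ` {e \<in> E. v \<in> e}" by blast
    moreover have "inj_on ((`) g) {e \<in> E. v \<in> e}"
      by (rule inj_on_subset[OF inj_on_image_Pow[OF assms(1)]]) (use E in auto)
    ultimately have "(\<Sum>e\<in>{e \<in> E. v \<in> e}. f (g ` e)) = (\<Sum>e'\<in>{e' \<in> (`) g ` E. g v \<in> e'}. f e')"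
      by (simp add: sum.reindex)
    then show ?thesis using assms(3) v by (simp add: perfect_fractional_matching_def)
  qed
  then show ?thesis using assms(3) by (auto simp: perfect_fractional_matching_def fractional_matching_def)
qed

text \<open>The threshold speaks of vertices in \<open>nat\<close>; a bijection onto an initial
  segment carries it over to any vertex type. Stating the degree condition set by set keeps
  \<open>min_degree\<close> out of all later arguments about modified hypergraphs.\<close>

lemma pfm_threshold_works:
  assumes "1 \<le> d" "d < k" "\<epsilon> > 0"
  obtains n0 where "\<And>(V :: 'a set) E. \<lbrakk>k_graph k V E; card V \<ge> n0;
      \<And>S. S \<subseteq> V \<Longrightarrow> card S = d \<Longrightarrow> (pfm_threshold k d + \<epsilon>) * real ((card V - d) choose (k - d)) \<le> real (set_degree E S)\<rbrakk>
      \<Longrightarrow> \<exists>f. perfect_fractional_matching V E f"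
proof -
  obtain n0 where n0: "\<And>(V :: nat set) E. \<lbrakk>k_graph k V E; card V \<ge> n0;
      (pfm_threshold k d + \<epsilon>) * real ((card V - d) choose (k - d)) \<le> real (min_degree d V E)\<rbrakk>
      \<Longrightarrow> \<exists>f. perfect_fractional_matching V E f"
    using pfm_threshold_nat[OF assms] by blast
  \<comment> \<open>The bound \<open>d\<close> guarantees that a \<open>d\<close>-set exists, so
    that \<open>min_degree\<close> is a genuine minimum.\<close>
  show ?thesis
  proof (rule that[of "max n0 d"])
    fix V :: "'a set" and E
    assume V: "k_graph k V E" "card V \<ge> max n0 d" and deg: "\<And>S. S \<subseteq> V \<Longrightarrow> card S = d \<Longrightarrow>
        (pfm_threshold k d + \<epsilon>) * real ((card V - d) choose (k - d)) \<le> real (set_degree E S)"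
    have fV: "finite V" using V by (simp add: k_graph_def)
    obtain g where "bij_betw g V {0..<card V}" using ex_bij_betw_finite_nat[OF fV] by blast
    then have inj: "inj_on g V" by (simp add: bij_betw_def)
    have cV: "card (g ` V) = card V" using inj by (rule card_image)
    have kg: "k_graph k (g ` V) ((`) g ` E)"
      using V(1) inj unfolding k_graph_def by (auto intro!: card_image[THEN trans] inj_on_subset[OF inj])
    have "(pfm_threshold k d + \<epsilon>) * real ((card (g ` V) - d) choose (k - d)) \<le> real (min_degree d (g ` V) ((`) g ` E))"
    proof (subst le_min_degree_iff)
      show "finite (g ` V)" "d \<le> card (g ` V)" using fV V cV by auto
      show "\<forall>S. S \<subseteq> g ` V \<and> card S = d \<longrightarrow>
        (pfm_threshold k d + \<epsilon>) * real ((card (g ` V) - d) choose (k - d)) \<le> real (set_degree ((`) g ` E) S)"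
      proof (intro allI impI, elim conjE)
        fix S assume S: "S \<subseteq> g ` V" "card S = d"
        then obtain S' where S': "S' \<subseteq> V" "S = g ` S'" by (meson subset_imageE)
        then have "card S' = d" using S card_image[OF inj_on_subset[OF inj S'(1)]] by simp
        then show "(pfm_threshold k d + \<epsilon>) * real ((card (g ` V) - d) choose (k - d)) \<le> real (set_degree ((`) g ` E) S)"
          using deg[OF S'(1)] cV set_degree_image[OF inj V(1) S'(1)] S' by simp
      qed
    qed
    then have "\<exists>f. perfect_fractional_matching (g ` V) ((`) g ` E) f"
      by (intro n0[OF kg]) (use V cV in auto)
    then show "\<exists>f. perfect_fractional_matching V E f"
      using perfect_fractional_matching_image[OF inj V(1)] by blast
  qed
qed

text \<open>The easy direction of linear programming duality. Weighted by \<open>f\<close>, the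
  edges count every vertex exactly once; so \<open>f\<close> has total \<open>card V / k\<close>,
  and the \<open>f\<close>-weighted sum of the edge weights is the total of
  \<open>z\<close>.\<close>

lemma fractional_cover_bound:
  assumes "k_graph k V G" "k \<ge> 1" "perfect_fractional_matching V G f" "\<And>e. e \<in> G \<Longrightarrow> a \<le> (\<Sum>v\<in>e. z v)"
  shows "a * real (card V) \<le> real k * (\<Sum>v\<in>V. z v :: real)"
proof -
  have fV: "finite V" and G: "\<And>e. e \<in> G \<Longrightarrow> e \<subseteq> V \<and> card e = k" using assms(1) by (auto simp: k_graph_def)
  have fG: "finite G" by (rule finite_subset[of _ "Pow V"]) (use G fV in auto)
  have f: "\<And>e. e \<in> G \<Longrightarrow> 0 \<le> f e" "\<And>v. v \<in> V \<Longrightarrow> (\<Sum>e\<in>{e \<in> G. v \<in> e}. f e) = 1"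
    using assms(3) by (auto simp: perfect_fractional_matching_def fractional_matching_def)
  have swap: "(\<Sum>e\<in>G. f e * (\<Sum>v\<in>e. h v)) = (\<Sum>v\<in>V. h v)" for h :: "_ \<Rightarrow> real"
  proof -
    have "(\<Sum>e\<in>G. f e * (\<Sum>v\<in>e. h v)) = (\<Sum>e\<in>G. \<Sum>v\<in>{v \<in> V. v \<in> e}. f e * h v)"
    proof (rule sum.cong)
      fix e assume "e \<in> G"
      then have "{v \<in> V. v \<in> e} = e" using G by auto
      then show "f e * (\<Sum>v\<in>e. h v) = (\<Sum>v\<in>{v \<in> V. v \<in> e}. f e * h v)" by (simp add: sum_distrib_left)
    qed simp
    also have "\<dots> = (\<Sum>v\<in>V. \<Sum>e\<in>{e \<in> G. v \<in> e}. f e * h v)"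
      by (rule sum.swap_restrict) (use fG fV in auto)
    also have "\<dots> = (\<Sum>v\<in>V. h v)"
      using f(2) by (simp add: sum_distrib_right[symmetric])
    finally show ?thesis .
  qed
  have "real k * (\<Sum>e\<in>G. f e) = (\<Sum>e\<in>G. f e * (\<Sum>v\<in>e. 1))"
    using G by (simp add: sum_distrib_left mult.commute)
  also have "\<dots> = real (card V)" unfolding swap by simp
  finally have "a * real (card V) = real k * (\<Sum>e\<in>G. f e * a)"
    by (simp add: sum_distrib_right[symmetric])
  also have "\<dots> \<le> real k * (\<Sum>e\<in>G. f e * (\<Sum>v\<in>e. z v))"
    by (intro mult_left_mono sum_mono) (use assms(4) f in auto)
  finally show ?thesis unfolding swap .
qed

section \<open>From perfect fractional matchings to many light edges\<close>

lemma sum_set_degree_le: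
  assumes "finite B" "\<And>e. e \<in> B \<Longrightarrow> finite e \<and> card e = k" "finite \<D>" "\<And>S. S \<in> \<D> \<Longrightarrow> card S = d"
  shows "(\<Sum>S\<in>\<D>. set_degree B S) \<le> card B * (k choose d)"
proof -
  have "(\<Sum>S\<in>\<D>. set_degree B S) = (\<Sum>S\<in>\<D>. \<Sum>e\<in>{e \<in> B. S \<subseteq> e}. 1)" by (simp add: set_degree_def)
  also have "\<dots> = (\<Sum>e\<in>B. \<Sum>S\<in>{S \<in> \<D>. S \<subseteq> e}. 1)" by (rule sum.swap_restrict) (use assms in auto)
  also have "\<dots> \<le> (\<Sum>e\<in>B. k choose d)"
  proof (rule sum_mono)
    fix e assume e: "e \<in> B"
    have "card {S \<in> \<D>. S \<subseteq> e} \<le> card {S. S \<subseteq> e \<and> card S = d}"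
      by (rule card_mono) (use assms(2)[OF e] assms(4) in auto)
    then show "(\<Sum>S\<in>{S \<in> \<D>. S \<subseteq> e}. 1) \<le> k choose d" using assms(2)[OF e] by (simp add: n_subsets)
  qed
  finally show ?thesis by simp
qed

lemma choose_ge_power:
  assumes "n \<ge> 2 * k" "d \<le> k" "k \<ge> 1"
  shows "real ((n - d) choose (k - d)) \<ge> (real n / (2 * real k)) ^ (k - d)"
proof (cases "k = d")
  case False
  have "(real n / (2 * real k)) ^ (k - d) \<le> (real (n - d) / real (k - d)) ^ (k - d)"
  proof (rule power_mono)
    have "real n / (2 * real k) = real n / 2 / real k" by simp
    also have "\<dots> \<le> real (n - d) / real (k - d)"
      using False assms by (intro frac_le) auto
    finally show "real n / (2 * real k) \<le> real (n - d) / real (k - d)" .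
  qed simp
  also have "\<dots> \<le> real ((n - d) choose (k - d))"
    using binomial_ge_n_over_k_pow_k[of "k - d" "n - d", where 'a = real] assms by simp
  finally show ?thesis .
qed simp

lemma choose_le_power: "n choose j \<le> n ^ j"
proof -
  have "(n choose j) * 1 \<le> (n choose j) * fact j" by (intro mult_le_mono2) (simp add: fact_ge_1)
  also have "\<dots> \<le> n ^ j" by (rule binomial_fact_pow)
  finally show ?thesis by simp
qed

lemma card_subsets_hitting_le:
  assumes "finite V" "finite S" "j \<ge> 1"
  shows "card {T. T \<subseteq> V \<and> card T = j \<and> T \<inter> S \<noteq> {}} \<le> card S * card V ^ (j - 1)"
proof -
  have "{T. T \<subseteq> V \<and> card T = j \<and> T \<inter> S \<noteq> {}} \<subseteq> (\<Union>s\<in>S. insert s ` {T. T \<subseteq> V \<and> card T = j - 1})"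
  proof
    fix T assume "T \<in> {T. T \<subseteq> V \<and> card T = j \<and> T \<inter> S \<noteq> {}}"
    then obtain s where s: "T \<subseteq> V" "card T = j" "s \<in> T" "s \<in> S" by auto
    then have "T = insert s (T - {s})" "T - {s} \<subseteq> V" "card (T - {s}) = j - 1"
      using assms finite_subset[OF s(1)] by auto
    then show "T \<in> (\<Union>s\<in>S. insert s ` {T. T \<subseteq> V \<and> card T = j - 1})" using s(4) by blast
  qed
  then have "card {T. T \<subseteq> V \<and> card T = j \<and> T \<inter> S \<noteq> {}} \<le> card (\<Union>s\<in>S. insert s ` {T. T \<subseteq> V \<and> card T = j - 1})"
    by (rule card_mono[rotated]) (use assms in auto)
  also have "\<dots> \<le> (\<Sum>s\<in>S. card (insert s ` {T. T \<subseteq> V \<and> card T = j - 1}))" by (rule card_UN_le[OF assms(2)])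
  also have "\<dots> \<le> (\<Sum>s\<in>S. card V ^ (j - 1))"
  proof (rule sum_mono)
    fix s
    have "card (insert s ` {T. T \<subseteq> V \<and> card T = j - 1}) \<le> card {T. T \<subseteq> V \<and> card T = j - 1}"
      by (rule card_image_le) (use assms in simp)
    also have "\<dots> = card V choose (j - 1)" using assms by (simp add: n_subsets)
    also have "\<dots> \<le> card V ^ (j - 1)" by (rule choose_le_power)
    finally show "card (insert s ` {T. T \<subseteq> V \<and> card T = j - 1}) \<le> card V ^ (j - 1)" .
  qed
  finally show ?thesis by simp
qed

text \<open>Raising \<open>w\<close> to at least \<open>l\<close>, its maximum on a small set \<open>L\<close> of lightest vertices, makes
  every \<open>d\<close>-set at least as heavy as every \<open>d\<close>-set inside \<open>L\<close>. So each \<open>d\<close>-set \<open>S\<close> inherits,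
  among the heavy \<open>k\<close>-sets, the degree of the best \<open>d\<close>-set \<open>S'\<close> of \<open>L\<close>.\<close>

lemma set_degree_heavy_ge:
  fixes w :: "'a \<Rightarrow> real"
  assumes kH: "k_graph k V H" and S: "S \<subseteq> V" "card S = d" and S': "S' \<subseteq> L" "card S' = d" and "L \<subseteq> V" "d < k"
    and l: "\<And>v. v \<in> L \<Longrightarrow> w v \<le> l"
    and G: "G = {e. e \<subseteq> V \<and> card e = k \<and> a \<le> (\<Sum>v\<in>e. max (w v) l)}"
    and B: "B = {e\<in>H. (\<Sum>v\<in>e. w v) < a}"
  shows "set_degree H S' \<le> set_degree B S' + set_degree G S + d * card V ^ (k - d - 1)"
proof -
  have fV: "finite V" and H: "\<And>e. e \<in> H \<Longrightarrow> e \<subseteq> V \<and> card e = k" using kH by (auto simp: k_graph_def)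
  have fS: "finite S" "finite S'" 
    using finite_subset[OF S(1) fV] finite_subset[OF subset_trans[OF S'(1) \<open>L \<subseteq> V\<close>] fV] by simp_all
  have fH: "finite H" by (rule finite_subset[of _ "Pow V"]) (use H fV in auto)
  have fG: "finite G" by (rule finite_subset[of _ "Pow V"]) (use G fV in auto)
  \<comment> \<open>For the edges in \<open>P1\<close>, exchanging \<open>S'\<close> for
    \<open>S\<close> gives distinct heavy \<open>k\<close>-sets through \<open>S\<close>. For those
    in \<open>P2\<close> the exchange would lose vertices, and such edges are of lower
    order.\<close>
  define P1 where "P1 = {e \<in> H. S' \<subseteq> e \<and> e \<notin> B \<and> (e - S') \<inter> S = {}}"
  define P2 where "P2 = {e \<in> H. S' \<subseteq> e \<and> (e - S') \<inter> S \<noteq> {}}"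
  have "{e \<in> H. S' \<subseteq> e} \<subseteq> {e \<in> B. S' \<subseteq> e} \<union> (P1 \<union> P2)" by (auto simp: P1_def P2_def)
  then have "card {e \<in> H. S' \<subseteq> e} \<le> card ({e \<in> B. S' \<subseteq> e} \<union> (P1 \<union> P2))"
    by (rule card_mono[rotated]) (use fH in \<open>auto simp: B P1_def P2_def\<close>)
  also have "\<dots> \<le> card {e \<in> B. S' \<subseteq> e} + card (P1 \<union> P2)" by (rule card_Un_le)
  also have "card (P1 \<union> P2) \<le> card P1 + card P2" by (rule card_Un_le)
  also have "card P1 \<le> card {e \<in> G. S \<subseteq> e}"
  proof (rule card_inj_on_le[where f = "\<lambda>e. (e - S') \<union> S"])
    show "inj_on (\<lambda>e. (e - S') \<union> S) P1"
    proof (rule inj_onI)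
      fix e f assume e: "e \<in> P1" and f: "f \<in> P1" and eq: "(e - S') \<union> S = (f - S') \<union> S"
      have "e = ((e - S') \<union> S) - S \<union> S'" using e by (auto simp: P1_def)
      also have "\<dots> = ((f - S') \<union> S) - S \<union> S'" using eq by simp
      also have "\<dots> = f" using f by (auto simp: P1_def)
      finally show "e = f" .
    qed
    show "(\<lambda>e. (e - S') \<union> S) ` P1 \<subseteq> {e \<in> G. S \<subseteq> e}"
    proof
      fix x assume "x \<in> (\<lambda>e. (e - S') \<union> S) ` P1"
      then obtain e where e: "e \<in> H" "S' \<subseteq> e" "e \<notin> B" "(e - S') \<inter> S = {}" and x: "x = (e - S') \<union> S"
        by (auto simp: P1_def)
      have fe: "finite e" using H[OF e(1)] fV finite_subset by blast
      have "card x = card (e - S') + card S" unfolding x by (rule card_Un_disjoint) (use fe fS e in auto)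
      then have cx: "card x = k" using H[OF e(1)] e(2) fS S S' \<open>d < k\<close> by (simp add: card_Diff_subset)
      have "a \<le> (\<Sum>v\<in>e. w v)" using e B by auto
      also have "\<dots> = (\<Sum>v\<in>e - S'. w v) + (\<Sum>v\<in>S'. w v)" by (rule sum.subset_diff[OF e(2) fe])
      also have "\<dots> \<le> (\<Sum>v\<in>e - S'. max (w v) l) + real d * l"
      proof (rule add_mono)
        show "(\<Sum>v\<in>e - S'. w v) \<le> (\<Sum>v\<in>e - S'. max (w v) l)" by (rule sum_mono) simp
        have "(\<Sum>v\<in>S'. w v) \<le> of_nat (card S') * l" by (rule sum_bounded_above) (use l S' in auto)
        then show "(\<Sum>v\<in>S'. w v) \<le> real d * l" using S' by simp
      qed
      also have "real d * l \<le> (\<Sum>v\<in>S. max (w v) l)"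
      proof -
        have "of_nat (card S) * l \<le> (\<Sum>v\<in>S. max (w v) l)" by (rule sum_bounded_below) simp
        then show ?thesis using S by simp
      qed
      also have "(\<Sum>v\<in>e - S'. max (w v) l) + (\<Sum>v\<in>S. max (w v) l) = (\<Sum>v\<in>x. max (w v) l)"
        unfolding x by (rule sum.union_disjoint[symmetric]) (use fe fS e in auto)
      finally show "x \<in> {e \<in> G. S \<subseteq> e}" using cx H[OF e(1)] S by (auto simp: G x)
    qed
    show "finite {e \<in> G. S \<subseteq> e}" using fG by simp
  qed
  also have "card P2 \<le> d * card V ^ (k - d - 1)"
  proof -
    have "card P2 \<le> card {T. T \<subseteq> V \<and> card T = k - d \<and> T \<inter> S \<noteq> {}}"
    proof (rule card_inj_on_le[where f = "\<lambda>e. e - S'"])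
      show "inj_on (\<lambda>e. e - S') P2" by (auto simp: inj_on_def P2_def)
      show "(\<lambda>e. e - S') ` P2 \<subseteq> {T. T \<subseteq> V \<and> card T = k - d \<and> T \<inter> S \<noteq> {}}"
        using H fS S' by (auto simp: P2_def card_Diff_subset)
      show "finite {T. T \<subseteq> V \<and> card T = k - d \<and> T \<inter> S \<noteq> {}}" using fV by simp
    qed
    also have "\<dots> \<le> card S * card V ^ (k - d - 1)" by (rule card_subsets_hitting_le) (use fV fS \<open>d < k\<close> in auto)
    finally show ?thesis using S by simp
  qed
  finally show ?thesis by (simp add: set_degree_def)
qed

text \<open>Suppose few edges are light. Averaging over the \<open>d\<close>-sets inside a set
  \<open>L\<close> of lightest vertices, some \<open>S'\<close> lies in few light edges, so every
  \<open>d\<close>-set has degree above the threshold in the hypergraph \<open>G\<close> of heavy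
  \<open>k\<close>-sets. A perfect fractional matching of \<open>G\<close> forces total weight at
  least \<open>a * n / k\<close>, but raising the weights on \<open>L\<close> adds too little to
  bridge the slack \<open>\<gamma>\<close>.\<close>

lemma many_light_edges:
  assumes dk: "1 \<le> d" "d < k" and "\<epsilon> > 0" "\<gamma> > 0"
  shows "\<exists>\<delta> n0. \<delta> > 0 \<and> (\<forall>(V :: 'a set) H z a. k_graph k V H \<and> n0 \<le> card V \<and>
      degree_ge k d V (pfm_threshold k d + \<epsilon>) H \<and>
      (\<forall>v\<in>V. 0 \<le> z v) \<and> a \<le> 1 \<and> real k * (\<Sum>v\<in>V. z v) \<le> (a - \<gamma>) * real (card V) \<longrightarrow>
      \<delta> * real (card V) ^ k \<le> real (card {e\<in>H. (\<Sum>v\<in>e. z v) < a}))"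
proof -
  have "\<epsilon>/2 > 0" using \<open>\<epsilon> > 0\<close> by simp
  obtain n1 where n1: "\<And>(V :: 'a set) E. \<lbrakk>k_graph k V E; card V \<ge> n1;
      \<And>S. S \<subseteq> V \<Longrightarrow> card S = d \<Longrightarrow> (pfm_threshold k d + \<epsilon>/2) * real ((card V - d) choose (k - d)) \<le> real (set_degree E S)\<rbrakk>
      \<Longrightarrow> \<exists>f. perfect_fractional_matching V E f"
    by (rule pfm_threshold_works[OF dk \<open>\<epsilon>/2 > 0\<close>, where 'a = 'a]) blast
  \<comment> \<open>\<open>L\<close> will have at most \<open>2 * \<beta> * n\<close> vertices, each
    gaining at most 1 in weight; multiplied by \<open>k\<close>, this must not exceed half of
    \<open>\<gamma> * n\<close>.\<close>
  define \<beta> where "\<beta> = min (1/2) (\<gamma> / (4 * real k))"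
  have k0: "real k > 0" using dk by simp
  have \<beta>: "\<beta> > 0" "\<beta> \<le> 1/2" "2 * real k * \<beta> \<le> \<gamma> / 2" using \<open>\<gamma> > 0\<close> k0 
    by (auto simp: \<beta>_def min_def field_simps)
  \<comment> \<open>Makes \<open>\<tau> * n ^ (k - d)\<close> at most a quarter of
    \<open>\<epsilon>\<close> times the maximal possible \<open>d\<close>-degree. It is spent twice,
    on the light edges through \<open>S'\<close> and on the edges colliding with \<open>S\<close>,
    and leaves the margin \<open>\<epsilon> / 2\<close>.\<close>
  define \<tau> where "\<tau> = \<epsilon> / 4 * (1 / (2 * real k)) ^ (k - d)"
  have \<tau>: "\<tau> > 0" using \<open>\<epsilon> > 0\<close> k0 by (simp add: \<tau>_def)
  \<comment> \<open>If each of the at least \<open>(\<beta> * n / d) ^ d\<close> many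
    \<open>d\<close>-sets in \<open>L\<close> were in \<open>\<tau> * n ^ (k - d)\<close> light
    edges, double counting would give \<open>\<delta> * n ^ k\<close> light edges.\<close>
  define \<delta> where "\<delta> = \<tau> * (\<beta> / real d) ^ d / real (k choose d)"
  have kd: "real (k choose d) > 0" using dk by simp
  have \<delta>: "\<delta> > 0" using \<tau> \<beta> dk kd by (simp add: \<delta>_def)
  define n0 where "n0 = n1 + 2 * k + nat \<lceil>1 / \<beta>\<rceil> + nat \<lceil>real d / \<beta>\<rceil> + nat \<lceil>real d / \<tau>\<rceil>"
  have main: "\<delta> * real (card V) ^ k \<le> real (card {e\<in>H. (\<Sum>v\<in>e. z v) < a})"
    if kH: "k_graph k V H" and n: "card V \<ge> n0"
      and deg: "\<And>S. S \<subseteq> V \<Longrightarrow> card S = d \<Longrightarrow> (pfm_threshold k d + \<epsilon>) * real ((card V - d) choose (k - d)) \<le> real (set_degree H S)"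
      and z: "\<And>v. v \<in> V \<Longrightarrow> 0 \<le> z v" and a: "a \<le> 1" and zs: "real k * (\<Sum>v\<in>V. z v) \<le> (a - \<gamma>) * real (card V)"
    for V :: "'a set" and H z a
  proof (rule ccontr)
    assume "\<not> \<delta> * real (card V) ^ k \<le> real (card {e\<in>H. (\<Sum>v\<in>e. z v) < a})"
    then have few: "real (card {e\<in>H. (\<Sum>v\<in>e. z v) < a}) < \<delta> * real (card V) ^ k" by simp
    define n where "n = real (card V)"
    define C where "C = real ((card V - d) choose (k - d))"
    have fV: "finite V" and H: "\<And>e. e \<in> H \<Longrightarrow> e \<subseteq> V \<and> card e = k" using kH by (auto simp: k_graph_def)
    have fH: "finite H" by (rule finite_subset[of _ "Pow V"]) (use H fV in auto)
    have nn: "n \<ge> real n0" using \<open>card V \<ge> n0\<close> by (simp add: n_def)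
    have n2k: "card V \<ge> 2 * k" "card V \<ge> n1" using \<open>card V \<ge> n0\<close> by (auto simp: n0_def)
    have npos: "n > 0" using n2k dk by (simp add: n_def)
    have nb: "1 \<le> \<beta> * n" "real d \<le> \<beta> * n" "real d \<le> \<tau> * n"
    proof -
      have "1 / \<beta> \<le> n" "real d / \<beta> \<le> n" "real d / \<tau> \<le> n" using nn unfolding n0_def by linarith+
      then show "1 \<le> \<beta> * n" "real d \<le> \<beta> * n" "real d \<le> \<tau> * n" using \<beta> \<tau> by (simp_all add: field_simps)
    qed
    have Cbig: "\<tau> * n ^ (k - d) \<le> \<epsilon> / 4 * C"
    proof -
      have "(n / (2 * real k)) ^ (k - d) \<le> C" unfolding C_def n_def by (rule choose_ge_power) (use n2k dk in auto)
      then have "\<epsilon> / 4 * (n / (2 * real k)) ^ (k - d) \<le> \<epsilon> / 4 * C" using \<open>\<epsilon> > 0\<close> by simp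
      then show ?thesis by (simp add: \<tau>_def power_divide mult_ac)
    qed
    \<comment> \<open>Truncation keeps the level \<open>l\<close> at most 1. It creates no new light
      edges: as \<open>a \<le> 1\<close>, an edge of truncated weight below \<open>a\<close>
      contains no vertex whose weight was cut.\<close>
    define w where "w v = min 1 (z v)" for v
    define B where "B = {e\<in>H. (\<Sum>v\<in>e. w v) < a}"
    have "B \<subseteq> {e\<in>H. (\<Sum>v\<in>e. z v) < a}"
    proof
      fix e assume e: "e \<in> B"
      then have eH: "e \<in> H" and lt: "(\<Sum>v\<in>e. w v) < a" by (auto simp: B_def)
      have fe: "finite e" and eV: "e \<subseteq> V" using H[OF eH] fV finite_subset by auto
      have w0: "w v \<ge> 0" if "v \<in> e" for v using z that eV by (auto simp: w_def)
      have "w v = z v" if v: "v \<in> e" for v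
      proof -
        have "w v \<le> (\<Sum>v\<in>e. w v)" by (rule member_le_sum[OF v _ fe]) (use w0 in auto)
        then show ?thesis using lt a by (auto simp: w_def min_def split: if_splits)
      qed
      then show "e \<in> {e\<in>H. (\<Sum>v\<in>e. z v) < a}" using lt eH by simp
    qed
    then have "card B \<le> card {e\<in>H. (\<Sum>v\<in>e. z v) < a}" by (rule card_mono[rotated]) (use fH in simp)
    then have fewB: "real (card B) < \<delta> * n ^ k" using few by (simp add: n_def)
    define b where "b = nat \<lceil>\<beta> * n\<rceil>"
    have b1: "\<beta> * n \<le> real b" "real b \<le> 2 * (\<beta> * n)" unfolding b_def using nb by linarith+
    have "2 * (\<beta> * n) \<le> n" using mult_right_mono[OF \<beta>(2), of n] npos by simp
    then have bV: "b \<le> card V" using b1 by (simp add: n_def)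
    have b0: "b \<ge> 1" using b1 nb by linarith
    have bd: "d \<le> b" using b1 nb by linarith
    obtain L where L: "L \<subseteq> V" "card L = b" "\<And>u v. \<lbrakk>u \<in> V - L; v \<in> L\<rbrakk> \<Longrightarrow> - w u \<le> - w v"
      using ex_top_subset[OF fV bV, of "\<lambda>v. - w v"] by blast
    have fL: "finite L" using L fV finite_subset by blast
    have Lne: "L \<noteq> {}" using L b0 by auto
    define l where "l = Max (w ` L)"
    have lw: "w v \<le> l" if "v \<in> L" for v unfolding l_def using fL that by simp
    have lin: "l \<in> w ` L" unfolding l_def by (rule Max_in) (use fL Lne in auto)
    have l1: "l \<le> 1" using lin by (auto simp: w_def)
    have lo: "l \<le> w u" if "u \<in> V - L" for u using lin L(3)[OF that] by auto
    define y where "y v = max (w v) l" for v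
    have ysum: "(\<Sum>v\<in>V. y v) \<le> (\<Sum>v\<in>V. z v) + real b"
    proof -
      have "(\<Sum>v\<in>V. y v) \<le> (\<Sum>v\<in>V. z v + (if v \<in> L then 1 else 0))"
      proof (rule sum_mono)
        fix v assume v: "v \<in> V"
        show "y v \<le> z v + (if v \<in> L then 1 else 0)"
        proof (cases "v \<in> L")
          case True then show ?thesis using z[OF v] l1 by (auto simp: y_def w_def)
        next
          case False then show ?thesis using lo[of v] v by (auto simp: y_def w_def)
        qed
      qed
      also have "\<dots> = (\<Sum>v\<in>V. z v) + real b"
        using fV L by (simp add: sum.distrib sum.If_cases Int_absorb1)
      finally show ?thesis .
    qed
    \<comment> \<open>All heavy \<open>k\<close>-sets are taken, since the sets produced by the
      exchange need not be edges of \<open>H\<close>.\<close>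
    define G where "G = {e. e \<subseteq> V \<and> card e = k \<and> a \<le> (\<Sum>v\<in>e. max (w v) l)}"
    have kG: "k_graph k V G" using fV by (auto simp: k_graph_def G_def)
    have degG: "(pfm_threshold k d + \<epsilon>/2) * C \<le> real (set_degree G S)" if S: "S \<subseteq> V" "card S = d" for S
    proof -
      define \<D> where "\<D> = {S'. S' \<subseteq> L \<and> card S' = d}"
      have f\<D>: "finite \<D>" unfolding \<D>_def using fL by simp
      have c\<D>: "card \<D> = b choose d" unfolding \<D>_def using fL L by (simp add: n_subsets)
      have "\<exists>S'\<in>\<D>. real (set_degree B S') \<le> \<tau> * n ^ (k - d)"
      proof (rule ccontr)
        assume "\<not> ?thesis"
        then have big: "\<tau> * n ^ (k - d) \<le> real (set_degree B S')" if "S' \<in> \<D>" for S' using that by fastforce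
        have "(\<beta> * n / real d) ^ d \<le> (real b / real d) ^ d"
          using b1 dk npos \<beta> by (intro power_mono divide_right_mono) auto
        also have "\<dots> \<le> real (b choose d)" by (rule binomial_ge_n_over_k_pow_k[OF bd])
        finally have "(\<beta> * n / real d) ^ d * (\<tau> * n ^ (k - d)) \<le> real (b choose d) * (\<tau> * n ^ (k - d))"
          using \<tau> npos by (intro mult_right_mono) auto
        also have "\<dots> \<le> (\<Sum>S'\<in>\<D>. real (set_degree B S'))"
          using sum_bounded_below[of \<D> "\<tau> * n ^ (k - d)" "\<lambda>S'. real (set_degree B S')"] big c\<D> by simp
        also have "\<dots> = real (\<Sum>S'\<in>\<D>. set_degree B S')" by simp
        also have "\<dots> \<le> real (card B * (k choose d))"
          unfolding of_nat_le_iff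
        proof (rule sum_set_degree_le)
          show "finite B" using fH by (simp add: B_def)
          show "finite e \<and> card e = k" if "e \<in> B" for e 
            using H[of e] that finite_subset[OF _ fV] by (simp add: B_def)
        qed (use f\<D> in \<open>auto simp: \<D>_def\<close>)
        also have "\<dots> < \<delta> * n ^ k * real (k choose d)" using fewB kd by simp
        also have "\<dots> = \<tau> * (\<beta> / real d) ^ d * n ^ k" using kd by (simp add: \<delta>_def)
        also have "n ^ k = n ^ d * n ^ (k - d)" using dk by (simp add: power_add[symmetric])
        finally show False by (simp add: power_divide power_mult_distrib mult_ac)
      qed
      then obtain S' where S': "S' \<subseteq> L" "card S' = d" "real (set_degree B S') \<le> \<tau> * n ^ (k - d)"
        by (auto simp: \<D>_def)
      have "set_degree H S' \<le> set_degree B S' + set_degree G S + d * card V ^ (k - d - 1)"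
        by (rule set_degree_heavy_ge[OF kH S S'(1,2) L(1) dk(2) lw G_def B_def])
      then have "real (set_degree H S') \<le> real (set_degree B S' + set_degree G S + d * card V ^ (k - d - 1))"
        by (simp only: of_nat_le_iff)
      then have "real (set_degree H S') \<le> real (set_degree B S') + real (set_degree G S) + real d * n ^ (k - d - 1)"
        by (simp add: n_def)
      moreover have "real d * n ^ (k - d - 1) \<le> \<tau> * n ^ (k - d)"
      proof -
        have "real d * n ^ (k - d - 1) \<le> (\<tau> * n) * n ^ (k - d - 1)" using nb npos by (intro mult_right_mono) auto
        also have "\<dots> = \<tau> * n ^ Suc (k - d - 1)" by simp
        also have "Suc (k - d - 1) = k - d" using dk by simp
        finally show ?thesis .
      qed
      moreover have "(pfm_threshold k d + \<epsilon>) * C \<le> real (set_degree H S')"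
        using deg[of S'] S' L unfolding C_def by blast
      moreover have "(pfm_threshold k d + \<epsilon>) * C = (pfm_threshold k d + \<epsilon>/2) * C + 2 * (\<epsilon> / 4 * C)"
        by (simp add: algebra_simps)
      ultimately show ?thesis using S'(3) Cbig by linarith
    qed
    obtain f where f: "perfect_fractional_matching V G f"
      using n1[OF kG n2k(2)] degG unfolding C_def by blast
    have "a * n \<le> real k * (\<Sum>v\<in>V. y v)"
      unfolding n_def by (rule fractional_cover_bound[OF kG _ f]) (use dk in \<open>auto simp: G_def y_def\<close>)
    also have "\<dots> \<le> real k * ((\<Sum>v\<in>V. z v) + real b)" using ysum k0 by simp
    also have "\<dots> \<le> (a - \<gamma>) * n + real k * (2 * (\<beta> * n))"
      unfolding distrib_left n_def[symmetric] using zs b1 k0 by (intro add_mono mult_left_mono) (auto simp: n_def)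
    also have "real k * (2 * (\<beta> * n)) \<le> (\<gamma> / 2) * n"
      using mult_right_mono[OF \<beta>(3), of n] npos by (simp add: mult_ac)
    finally have "\<gamma> * n \<le> \<gamma> / 2 * n" by (simp add: algebra_simps)
    then show False using npos \<open>\<gamma> > 0\<close> by simp
  qed
  show ?thesis
  proof (rule exI[of _ \<delta>], rule exI[of _ n0], intro conjI allI impI, rule \<delta>, elim conjE)
    fix V :: "'a set" and H z a
    assume "k_graph k V H" "n0 \<le> card V"
      "degree_ge k d V (pfm_threshold k d + \<epsilon>) H"
      "\<forall>v\<in>V. 0 \<le> z v" "a \<le> 1" "real k * (\<Sum>v\<in>V. z v) \<le> (a - \<gamma>) * real (card V)"
    then show "\<delta> * real (card V) ^ k \<le> real (card {e\<in>H. (\<Sum>v\<in>e. z v) < a})"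
      by (intro main) simp_all
  qed
qed

section \<open>Near-perfect rainbow matchings\<close>

text \<open>Boxes need coordinates, so an edge enters in every order of its vertices; the constant
  factor between edges and tuples is harmless.\<close>

definition system_tuples :: "nat \<Rightarrow> 'c set \<Rightarrow> 'a set \<Rightarrow> ('c \<Rightarrow> 'a set set) \<Rightarrow> (nat \<Rightarrow> 'c + 'a) set" where
  "system_tuples k C V H = {x \<in> {..<Suc k} \<rightarrow>\<^sub>E Inl ` C \<union> Inr ` V.
     \<exists>c\<in>C. \<exists>e\<in>H c. x 0 = Inl c \<and> bij_betw x {1..<Suc k} (Inr ` e)}"

lemma ex_system_tuple:
  fixes C :: "'c set" and V :: "'a set"
  assumes "c \<in> C" "e \<in> H c" "e \<subseteq> V" "card e = k" "finite e"
  shows "\<exists>x\<in>system_tuples k C V H. x 0 = Inl c \<and> bij_betw x {1..<Suc k} (Inr ` e)"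
proof -
  have "card (Inr ` e :: ('c + 'a) set) = k" using assms by (simp add: card_image)
  then obtain g where g: "bij_betw g {1..<Suc k} (Inr ` e :: ('c + 'a) set)"
    using finite_same_card_bij[of "{1..<Suc k}" "Inr ` e"] assms by auto
  define x where "x = (\<lambda>i\<in>{..<Suc k}. if i = 0 then Inl c else g i)"
  have b: "bij_betw x {1..<Suc k} (Inr ` e)"
    using g by (rule bij_betw_cong[THEN iffD1, rotated]) (simp add: x_def)
  have "x i \<in> Inl ` C \<union> Inr ` V" if i: "i < Suc k" for i
  proof (cases "i = 0")
    case False
    then have "x i \<in> Inr ` e" using b i by (auto simp: bij_betw_def)
    then show ?thesis using assms(3) by auto
  qed (use assms in \<open>simp add: x_def\<close>)
  then have "x \<in> {..<Suc k} \<rightarrow>\<^sub>E Inl ` C \<union> Inr ` V" by (auto simp: x_def)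
  moreover have "x 0 = Inl c" by (simp add: x_def)
  ultimately show ?thesis unfolding system_tuples_def using b assms(1,2) by blast
qed

lemma sum_system_tuple:
  assumes "x 0 = Inl c" "bij_betw x {1..<Suc k} (Inr ` e)"
  shows "(\<Sum>i<Suc k. L (x i)) = L (Inl c) + (\<Sum>v\<in>e. L (Inr v) :: real)"
proof -
  have "(\<Sum>i<Suc k. L (x i)) = L (x 0) + (\<Sum>i\<in>{1..<Suc k}. L (x i))"
    by (simp add: lessThan_atLeast0 sum.atLeast_Suc_lessThan)
  also have "(\<Sum>i\<in>{1..<Suc k}. L (x i)) = (\<Sum>u\<in>Inr ` e. L u)" by (rule sum.reindex_bij_betw[OF assms(2)])
  finally show ?thesis using assms(1) by (simp add: sum.reindex)
qed

text \<open>The arithmetic of averaging over \<open>m\<close> colours of which \<open>g\<close> are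
  good.\<close>

lemma half_deficit_bound:
  fixes m g \<gamma> :: real
  assumes "(m - g) * (1 - \<gamma> / 2) \<le> (1 - \<gamma>) * m" "0 \<le> \<gamma>" "0 \<le> g"
  shows "\<gamma> * m / 2 \<le> g"
proof -
  have e1: "(m - g) * (1 - \<gamma> / 2) = m - g - \<gamma> * m / 2 + \<gamma> * g / 2"
    by (simp add: algebra_simps diff_divide_distrib)
  have e2: "(1 - \<gamma>) * m = m - \<gamma> * m" by (simp add: left_diff_distrib)
  have "m - g - \<gamma> * m / 2 + \<gamma> * g / 2 \<le> m - \<gamma> * m" using assms(1) by (simp only: e1 e2)
  moreover have "0 \<le> \<gamma> * g" using assms by simp
  ultimately show ?thesis by linarith
qed

text \<open>Divided by \<open>\<mu>\<close>, the weighting of colours and vertices has total at most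
  \<open>(1 - \<gamma>) * m\<close>. By averaging, a proportion \<open>\<gamma> / 2\<close> of the
  colours have weight \<open>y c\<close> so small that the vertex weights fall short of covering the
  edges of \<open>H c\<close> to the level \<open>1 - y c\<close>; each of these colours contributes
  many light edges.\<close>

lemma system_robust_cover:
  assumes dk: "1 \<le> d" "d < k" and "\<epsilon> > 0" and \<gamma>: "0 < \<gamma>" "\<gamma> < 1"
  shows "\<exists>\<delta> m0. \<delta> > 0 \<and> (\<forall>(V :: 'a set) (C :: 'c set) H. finite C \<and> card V = k * card C \<and> m0 \<le> card C \<and>
      (\<forall>c\<in>C. k_graph k V (H c) \<and> degree_ge k d V (pfm_threshold k d + \<epsilon>) (H c)) \<longrightarrow>
      robust_cover \<gamma> \<delta> (Suc k) (Inl ` C \<union> Inr ` V) (system_tuples k C V H))"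
proof -
  have "\<gamma> / 2 > 0" using \<gamma> by simp
  from many_light_edges[OF dk \<open>\<epsilon> > 0\<close> this, where 'a = 'a]
  obtain \<delta>1 n0 where \<delta>1: "\<delta>1 > 0" and light: "\<forall>(V :: 'a set) H z a. k_graph k V H \<and> n0 \<le> card V \<and>
      degree_ge k d V (pfm_threshold k d + \<epsilon>) H \<and>
      (\<forall>v\<in>V. 0 \<le> z v) \<and> a \<le> 1 \<and> real k * (\<Sum>v\<in>V. z v) \<le> (a - \<gamma> / 2) * real (card V) \<longrightarrow>
      \<delta>1 * real (card V) ^ k \<le> real (card {e\<in>H. (\<Sum>v\<in>e. z v) < a})"
    by (elim exE conjE) (rule that)
  \<comment> \<open>At least \<open>\<gamma> / 2 * m\<close> good colours give
    \<open>\<delta>1 * (k * m) ^ k\<close> tuples each; the quotient expresses this product through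
    \<open>card X = Suc k * m\<close>.\<close>
  define \<delta> where "\<delta> = \<gamma> / 2 * \<delta>1 * real k ^ k / real (Suc k) ^ Suc k"
  have \<delta>: "\<delta> > 0" using \<delta>1 \<gamma> dk by (simp add: \<delta>_def)
  define m0 where "m0 = n0 + 1"
  have main: "robust_cover \<gamma> \<delta> (Suc k) (Inl ` C \<union> Inr ` V) (system_tuples k C V H)"
    if fC: "finite C" and cV: "card V = k * card C" and m0: "m0 \<le> card C" and kH: "\<And>c. c \<in> C \<Longrightarrow> k_graph k V (H c)"
      and deg: "\<And>c. c \<in> C \<Longrightarrow> degree_ge k d V (pfm_threshold k d + \<epsilon>) (H c)"
    for V :: "'a set" and C :: "'c set" and H
    unfolding robust_cover_def
  proof (intro allI impI, elim conjE)
    fix L :: "'c + 'a \<Rightarrow> real" and \<mu> :: real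
    define X where "X = (Inl ` C \<union> Inr ` V :: ('c + 'a) set)"
    define F where "F = {x \<in> system_tuples k C V H. (\<Sum>i<Suc k. L (x i)) < \<mu>}"
    define m where "m = real (card C)"
    assume L0: "\<forall>v\<in>Inl ` C \<union> Inr ` V. 0 \<le> L v" and \<mu>: "\<mu> > 0"
      and Ls: "sum L (Inl ` C \<union> Inr ` V) \<le> (1 - \<gamma>) * \<mu> * real (card (Inl ` C \<union> Inr ` V :: ('c + 'a) set)) / real (Suc k)"
    have mpos: "m > 0" using m0 by (simp add: m_def m0_def)
    then have "C \<noteq> {}" by (auto simp: m_def)
    then have fV: "finite V" using kH by (auto simp: k_graph_def)
    have dis: "Inl ` C \<inter> Inr ` V = ({} :: ('c + 'a) set)" by auto
    have "card X = card C + card V"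
      unfolding X_def using fC fV dis by (subst card_Un_disjoint) (auto simp: card_image)
    then have cX: "real (card X) = real (Suc k) * m" by (simp add: cV m_def algebra_simps)
    have sX: "sum L X = (\<Sum>c\<in>C. L (Inl c)) + (\<Sum>v\<in>V. L (Inr v))"
      unfolding X_def using fC fV dis by (subst sum.union_disjoint) (auto simp: sum.reindex)
    define y where "y c = L (Inl c) / \<mu>" for c
    define z where "z v = L (Inr v) / \<mu>" for v
    define Y where "Y = (\<Sum>v\<in>V. z v)"
    have y0: "y c \<ge> 0" if "c \<in> C" for c using L0 \<mu> that by (simp add: y_def)
    have z0: "z v \<ge> 0" if "v \<in> V" for v using L0 \<mu> that by (simp add: z_def)
    have Y0: "Y \<ge> 0" unfolding Y_def by (rule sum_nonneg) (rule z0)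
    have tot: "(\<Sum>c\<in>C. y c) + Y \<le> (1 - \<gamma>) * m"
    proof -
      have "sum L X \<le> (1 - \<gamma>) * \<mu> * m"
        using Ls unfolding X_def[symmetric] cX by simp
      moreover have "(\<Sum>c\<in>C. y c) + Y = sum L X / \<mu>"
        unfolding sX by (simp add: y_def z_def Y_def sum_divide_distrib add_divide_distrib)
      ultimately show ?thesis using \<mu> by (simp add: divide_le_eq mult_ac)
    qed
    \<comment> \<open>Because \<open>card V = k * m\<close>, this is the bound on the total vertex
      weight that \<open>many_light_edges\<close> asks for with \<open>a = 1 - y c\<close> and slack
      \<open>\<gamma> / 2\<close>.\<close>
    define Gd where "Gd = {c\<in>C. m * y c + Y \<le> (1 - \<gamma> / 2) * m}"
    have fG: "finite Gd" using fC by (simp add: Gd_def)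
    have cGd: "\<gamma> / 2 * m \<le> real (card Gd)"
    proof -
      have cD: "real (card (C - Gd)) = m - real (card Gd)"
        using fC fG by (subst card_Diff_subset) (auto simp: Gd_def m_def of_nat_diff card_mono)
      have "real (card (C - Gd)) * ((1 - \<gamma> / 2) * m) \<le> (\<Sum>c\<in>C - Gd. m * y c + Y)"
        by (rule sum_bounded_below) (auto simp: Gd_def)
      also have "\<dots> \<le> (\<Sum>c\<in>C. m * y c + Y)"
        by (rule sum_mono2) (use fC mpos y0 Y0 in auto)
      also have "\<dots> = m * ((\<Sum>c\<in>C. y c) + Y)" 
        by (simp add: sum.distrib distrib_left sum_distrib_left[symmetric] m_def)
      also have "\<dots> \<le> m * ((1 - \<gamma>) * m)" using tot mpos by (intro mult_left_mono) auto
      finally have "(m - real (card Gd)) * (1 - \<gamma> / 2) * m \<le> (1 - \<gamma>) * m * m" unfolding cD by (simp add: mult_ac)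
      then have "(m - real (card Gd)) * (1 - \<gamma> / 2) \<le> (1 - \<gamma>) * m" using mpos by simp
      then have "\<gamma> * m / 2 \<le> real (card Gd)" by (rule half_deficit_bound) (use \<gamma> in auto)
      then show ?thesis by simp
    qed
    define E where "E c = {e\<in>H c. (\<Sum>v\<in>e. z v) < 1 - y c}" for c
    have H: "e \<subseteq> V" "card e = k" "finite e" if "c \<in> C" "e \<in> H c" for c e
      using kH[OF that(1)] that(2) finite_subset[OF _ fV, of e] by (auto simp: k_graph_def)
    have fE: "finite (E c)" if "c \<in> C" for c
      by (rule finite_subset[of _ "Pow V"]) (use H(1)[OF that] fV in \<open>auto simp: E_def\<close>)
    have cE: "\<delta>1 * real (card V) ^ k \<le> real (card (E c))" if c: "c \<in> Gd" for c
    proof -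
      have cC: "c \<in> C" and ineq: "m * y c + Y \<le> (1 - \<gamma> / 2) * m" using c by (auto simp: Gd_def)
      have "n0 \<le> 1 * card C" using m0 by (simp add: m0_def)
      also have "\<dots> \<le> k * card C" using dk by (intro mult_right_mono) auto
      finally have n0: "n0 \<le> card V" by (simp add: cV)
      have "real k * Y \<le> real k * ((1 - y c - \<gamma> / 2) * m)"
        using ineq by (intro mult_left_mono) (auto simp: algebra_simps)
      also have "\<dots> = (1 - y c - \<gamma> / 2) * real (card V)" by (simp add: cV m_def)
      finally have "real k * (\<Sum>v\<in>V. z v) \<le> (1 - y c - \<gamma> / 2) * real (card V)" by (simp add: Y_def)
      then show ?thesis unfolding E_def
        by (intro light[rule_format] conjI kH[OF cC] n0 deg[OF cC] ballI z0) (use y0[OF cC] in auto)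
    qed
    have "\<exists>x\<in>system_tuples k C V H. x 0 = Inl (fst p) \<and> bij_betw x {1..<Suc k} (Inr ` snd p)"
      if p: "p \<in> Sigma Gd E" for p
    proof -
      have cH: "fst p \<in> C" "snd p \<in> H (fst p)" using p by (auto simp: E_def Gd_def)
      show ?thesis by (rule ex_system_tuple[where c = "fst p" and e = "snd p" and H = H, OF cH H[OF cH]])
    qed
    then obtain t where t: "\<And>p. p \<in> Sigma Gd E \<Longrightarrow> t p \<in> system_tuples k C V H"
      "\<And>p. p \<in> Sigma Gd E \<Longrightarrow> t p 0 = Inl (fst p)" 
      "\<And>p. p \<in> Sigma Gd E \<Longrightarrow> bij_betw (t p) {1..<Suc k} (Inr ` snd p)" by metis
    have "card (Sigma Gd E) \<le> card F"
    proof (rule card_inj_on_le[where f = t])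
      show "inj_on t (Sigma Gd E)"
      proof (rule inj_onI)
        fix p p' assume p: "p \<in> Sigma Gd E" "p' \<in> Sigma Gd E" and eq: "t p = t p'"
        have "fst p = fst p'" using t(2)[OF p(1)] t(2)[OF p(2)] eq by simp
        moreover have "Inr ` snd p = (Inr ` snd p' :: ('c + 'a) set)"
          using bij_betw_imp_surj_on[OF t(3)[OF p(1)]] bij_betw_imp_surj_on[OF t(3)[OF p(2)]] eq by simp
        then have "snd p = snd p'" by (simp add: inj_image_eq_iff)
        ultimately show "p = p'" by (rule prod_eqI)
      qed
      show "t ` Sigma Gd E \<subseteq> F"
      proof
        fix x assume "x \<in> t ` Sigma Gd E"
        then obtain p where p: "p \<in> Sigma Gd E" "x = t p" by blast
        have "(\<Sum>v\<in>snd p. z v) < 1 - y (fst p)" using p by (auto simp: E_def)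
        then have "(\<Sum>v\<in>snd p. L (Inr v)) / \<mu> + L (Inl (fst p)) / \<mu> < 1"
          by (simp add: z_def y_def sum_divide_distrib)
        then have "L (Inl (fst p)) + (\<Sum>v\<in>snd p. L (Inr v)) < \<mu>" using \<mu>
          by (simp add: add_divide_distrib[symmetric] divide_less_eq add.commute)
        then show "x \<in> F" unfolding F_def p(2) using t(1)[OF p(1)]
          by (simp only: sum_system_tuple[OF t(2,3)[OF p(1)]] mem_Collect_eq)
      qed
      show "finite F"
        by (rule finite_subset[of _ "{..<Suc k} \<rightarrow>\<^sub>E Inl ` C \<union> Inr ` V"])
          (use fC fV in \<open>auto simp: F_def system_tuples_def intro!: finite_PiE\<close>)
    qed
    then have "real (card (Sigma Gd E)) \<le> real (card F)" by simp
    have "\<delta> * real (card X) ^ Suc k = (\<gamma> / 2 * m) * (\<delta>1 * real (card V) ^ k)"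
    proof -
      have "real (card X) ^ Suc k = real (Suc k) ^ Suc k * (m * m ^ k)" unfolding cX by (simp only: power_mult_distrib power_Suc mult_ac)
      moreover have "real (Suc k) ^ Suc k \<noteq> 0" by simp
      ultimately have "\<delta> * real (card X) ^ Suc k = \<gamma> / 2 * \<delta>1 * real k ^ k * (m * m ^ k)"
        unfolding \<delta>_def by (simp only: times_divide_eq_left times_divide_eq_right nonzero_mult_div_cancel_left mult_ac) simp
      moreover have "real (card V) ^ k = real k ^ k * m ^ k" by (simp add: cV m_def power_mult_distrib)
      ultimately show ?thesis by (simp add: mult_ac)
    qed
    also have "\<dots> \<le> real (card Gd) * (\<delta>1 * real (card V) ^ k)"
      using cGd \<delta>1 by (intro mult_right_mono) auto
    also have "\<dots> \<le> (\<Sum>c\<in>Gd. real (card (E c)))" by (rule sum_bounded_below) (rule cE)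
    also have "\<dots> = real (card (Sigma Gd E))"
      using fG fE by (subst card_SigmaI) (auto simp: Gd_def)
    also have "\<dots> \<le> real (card F)" by fact
    finally show "\<delta> * real (card (Inl ` C \<union> Inr ` V :: ('c + 'a) set)) ^ Suc k
        \<le> real (card {x \<in> system_tuples k C V H. (\<Sum>i<Suc k. L (x i)) < \<mu>})"
      unfolding X_def F_def .
  qed
  show ?thesis
    by (rule exI[of _ \<delta>], rule exI[of _ m0], intro conjI allI impI, rule \<delta>, elim conjE, rule main) simp_all
qed

text \<open>Disjoint tuples differ in their colour coordinate and have disjoint edges. Since
  \<open>card X = Suc k * card C\<close>, a proportion \<open>1 - \<kappa>\<close> of a perfect
  matching by tuples uses the same proportion of the colours.\<close>

lemma near_perfect_rainbow_matching:
  assumes dk: "1 \<le> d" "d < k" and "\<epsilon> > 0" and "\<kappa> > 0"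
  shows "\<exists>m0. \<forall>(V :: 'a set) (C :: 'c set) H. finite C \<and> card V = k * card C \<and> m0 \<le> card C \<and>
      (\<forall>c\<in>C. k_graph k V (H c) \<and> degree_ge k d V (pfm_threshold k d + \<epsilon>) (H c)) \<longrightarrow>
      (\<exists>C0 e. C0 \<subseteq> C \<and> (\<forall>c\<in>C0. e c \<in> H c) \<and> disjoint_family_on e C0 \<and> (1 - \<kappa>) * real (card C) \<le> real (card C0))"
proof -
  obtain \<gamma> where \<gamma>: "0 < \<gamma>" "\<gamma> < 1" and tuples:
    "\<And>\<delta>. \<delta> > 0 \<Longrightarrow> \<exists>N0. \<forall>(X :: ('c + 'a) set) F. finite X \<and> card X \<ge> N0 \<and> F \<subseteq> {..<Suc k} \<rightarrow>\<^sub>E X \<and> robust_cover \<gamma> \<delta> (Suc k) X F \<longrightarrow>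
      (\<exists>M. M \<subseteq> F \<and> finite M \<and> disjoint_tuples (Suc k) M \<and>
        (1 - \<kappa>) * real (card X) / real (Suc k) \<le> real (card M))"
    by (rule near_perfect_tuple_matching[of "Suc k" \<kappa>, where 'x = "'c + 'a"]) (use \<open>\<kappa> > 0\<close> in auto)
  from system_robust_cover[OF dk \<open>\<epsilon> > 0\<close> \<gamma>, where 'a = 'a and 'c = 'c]
  obtain \<delta> m1 where \<delta>: "\<delta> > 0" and rob: "\<forall>(V :: 'a set) (C :: 'c set) H. finite C \<and> card V = k * card C \<and> m1 \<le> card C \<and>
      (\<forall>c\<in>C. k_graph k V (H c) \<and> degree_ge k d V (pfm_threshold k d + \<epsilon>) (H c)) \<longrightarrow>
      robust_cover \<gamma> \<delta> (Suc k) (Inl ` C \<union> Inr ` V) (system_tuples k C V H)"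
    by (elim exE conjE) (rule that)
  from tuples[OF \<delta>] obtain N0 where N0: "\<forall>(X :: ('c + 'a) set) F. finite X \<and> card X \<ge> N0 \<and> F \<subseteq> {..<Suc k} \<rightarrow>\<^sub>E X \<and> robust_cover \<gamma> \<delta> (Suc k) X F \<longrightarrow>
      (\<exists>M. M \<subseteq> F \<and> finite M \<and> disjoint_tuples (Suc k) M \<and>
        (1 - \<kappa>) * real (card X) / real (Suc k) \<le> real (card M))" by (elim exE) (rule that)
  show ?thesis
  proof (rule exI[of _ "m1 + N0 + 1"], intro allI impI)
    fix V :: "'a set" and C :: "'c set" and H
    assume asm: "finite C \<and> card V = k * card C \<and> m1 + N0 + 1 \<le> card C \<and>
      (\<forall>c\<in>C. k_graph k V (H c) \<and> degree_ge k d V (pfm_threshold k d + \<epsilon>) (H c))"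
    define X where "X = (Inl ` C \<union> Inr ` V :: ('c + 'a) set)"
    define F where "F = system_tuples k C V H"
    have fC: "finite C" and cV: "card V = k * card C" and "C \<noteq> {}" using asm by auto
    then have fV: "finite V" using asm by (auto simp: k_graph_def)
    have m1: "m1 \<le> card C" using asm by simp
    have "\<forall>c\<in>C. k_graph k V (H c) \<and> degree_ge k d V (pfm_threshold k d + \<epsilon>) (H c)"
      using asm by (elim conjE) assumption
    then have rc: "robust_cover \<gamma> \<delta> (Suc k) X F"
      unfolding X_def F_def using rob fC cV m1 by blast
    have cX: "card X = Suc k * card C"
      unfolding X_def using fC fV by (subst card_Un_disjoint) (auto simp: card_image cV)
    have "card C \<le> card X" unfolding cX by simp
    moreover have "N0 \<le> card C" using asm by linarith
    ultimately have "N0 \<le> card X" by linarith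
    moreover have "finite X" using fC fV by (simp add: X_def)
    moreover have "F \<subseteq> {..<Suc k} \<rightarrow>\<^sub>E X" by (auto simp: F_def X_def system_tuples_def)
    ultimately have "\<exists>M. M \<subseteq> F \<and> finite M \<and> disjoint_tuples (Suc k) M \<and>
        (1 - \<kappa>) * real (card X) / real (Suc k) \<le> real (card M)"
      using N0[THEN spec, THEN spec, THEN mp, of X F] rc by (simp only: simp_thms)
    then obtain M where M: "M \<subseteq> F" "finite M" "\<forall>x\<in>M. \<forall>y\<in>M. x \<noteq> y \<longrightarrow> x ` {..<Suc k} \<inter> y ` {..<Suc k} = {}"
      "(1 - \<kappa>) * real (card X) / real (Suc k) \<le> real (card M)" by (elim exE conjE) (rule that)
    have cM: "(1 - \<kappa>) * real (card C) \<le> real (card M)"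
    proof -
      have "(1 - \<kappa>) * real (card X) / real (Suc k) = (1 - \<kappa>) * real (card C)" unfolding cX of_nat_mult by simp
      then show ?thesis using M(4) by simp
    qed
    have "\<exists>c e. c \<in> C \<and> e \<in> H c \<and> x 0 = Inl c \<and> bij_betw x {1..<Suc k} (Inr ` e)" if "x \<in> M" for x
      using M(1) that unfolding F_def system_tuples_def by blast
    then obtain c e where ce: "\<And>x. x \<in> M \<Longrightarrow> c x \<in> C" "\<And>x. x \<in> M \<Longrightarrow> e x \<in> H (c x)" "\<And>x. x \<in> M \<Longrightarrow> x 0 = Inl (c x)"
      "\<And>x. x \<in> M \<Longrightarrow> bij_betw x {1..<Suc k} (Inr ` e x)" by metis
    have inj: "inj_on c M"
    proof (rule inj_onI, rule ccontr)
      fix x y assume xy: "x \<in> M" "y \<in> M" "c x = c y" "x \<noteq> y"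
      then have "x ` {..<Suc k} \<inter> y ` {..<Suc k} = {}" using M(3) by blast
      moreover have "x 0 \<in> x ` {..<Suc k}" "y 0 \<in> y ` {..<Suc k}" by auto
      ultimately show False using ce(3) xy by (metis IntI empty_iff)
    qed
    define e' where "e' a = e (inv_into M c a)" for a
    have e': "e' (c x) = e x" if "x \<in> M" for x using inj that by (simp add: e'_def)
    have "disjoint_family_on e' (c ` M)"
      unfolding disjoint_family_on_def
    proof (intro ballI impI equals0I)
      fix a b v assume "a \<in> c ` M" "b \<in> c ` M" "a \<noteq> b" and v: "v \<in> e' a \<inter> e' b"
      then obtain x y where xy: "x \<in> M" "y \<in> M" "a = c x" "b = c y" "x \<noteq> y" by blast
      have sub: "{1..<Suc k} \<subseteq> {..<Suc k}" by auto
      have "Inr v \<in> Inr ` e x" "Inr v \<in> Inr ` e y" using v e' xy by auto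
      then have iv: "Inr v \<in> x ` {1..<Suc k}" "Inr v \<in> y ` {1..<Suc k}"
        using bij_betw_imp_surj_on[OF ce(4)[OF xy(1)]] bij_betw_imp_surj_on[OF ce(4)[OF xy(2)]] by simp_all
      have "Inr v \<in> x ` {..<Suc k} \<inter> y ` {..<Suc k}"
        by (rule IntI[OF subsetD[OF image_mono[OF sub] iv(1)] subsetD[OF image_mono[OF sub] iv(2)]])
      moreover have "x ` {..<Suc k} \<inter> y ` {..<Suc k} = {}"
        by (rule M(3)[rule_format, OF xy(1,2,5)])
      ultimately show False by simp
    qed
    moreover have "\<forall>a\<in>c ` M. e' a \<in> H a" using e' ce(2) by auto
    moreover have "c ` M \<subseteq> C" using ce(1) by auto
    moreover have "(1 - \<kappa>) * real (card C) \<le> real (card (c ` M))" using cM inj by (simp add: card_image)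
    ultimately show "\<exists>C0 e. C0 \<subseteq> C \<and> (\<forall>c\<in>C0. e c \<in> H c) \<and> disjoint_family_on e C0 \<and> (1 - \<kappa>) * real (card C) \<le> real (card C0)"
      by (intro exI[of _ "c ` M"] exI[of _ e'] conjI)
  qed
qed

section \<open>Absorption\<close>

text \<open>Allowing any sets of colours and vertices makes gadgets, gadgets that have absorbed
  something, and the near-perfect matching objects of one kind, which glue along disjoint
  unions.\<close>

definition rainbow_pm :: "'c set \<Rightarrow> 'a set \<Rightarrow> ('c \<Rightarrow> 'a set set) \<Rightarrow> bool" where
  "rainbow_pm C V H \<longleftrightarrow> (\<exists>e. (\<forall>c\<in>C. e c \<in> H c) \<and> disjoint_family_on e C \<and> \<Union>(e ` C) = V)"

section \<open>Gluing rainbow matchings, and greedy choices\<close>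

lemma rainbow_pm_UN:
  assumes pm: "\<And>j. j \<in> J \<Longrightarrow> rainbow_pm (C j) (V j) H"
    and C: "disjoint_family_on C J" and V: "disjoint_family_on V J"
  shows "rainbow_pm (\<Union>(C ` J)) (\<Union>(V ` J)) H"
proof -
  obtain e where e: "\<And>j c. j \<in> J \<Longrightarrow> c \<in> C j \<Longrightarrow> e j c \<in> H c" "\<And>j. j \<in> J \<Longrightarrow> disjoint_family_on (e j) (C j)"
    "\<And>j. j \<in> J \<Longrightarrow> \<Union>(e j ` C j) = V j"
    using pm unfolding rainbow_pm_def by metis
  define f where "f c = e (SOME j. j \<in> J \<and> c \<in> C j) c" for c
  have f: "f c = e j c" if "j \<in> J" "c \<in> C j" for j c
  proof -
    have "(SOME j. j \<in> J \<and> c \<in> C j) = j"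
    proof (rule some_equality)
      fix i assume "i \<in> J \<and> c \<in> C i"
      then show "i = j" using C that unfolding disjoint_family_on_def by blast
    qed (use that in simp)
    then show ?thesis by (simp add: f_def)
  qed
  have "disjoint_family_on f (\<Union>(C ` J))"
    unfolding disjoint_family_on_def
  proof (intro ballI impI)
    fix c c' assume "c \<in> \<Union>(C ` J)" "c' \<in> \<Union>(C ` J)" and ne: "c \<noteq> c'"
    then obtain j j' where j: "j \<in> J" "c \<in> C j" "j' \<in> J" "c' \<in> C j'" by blast
    show "f c \<inter> f c' = {}"
    proof (cases "j = j'")
      case True
      then show ?thesis using e(2)[OF j(1)] j ne f by (simp add: disjoint_family_on_def)
    next
      case False
      have "e j c \<subseteq> V j" "e j' c' \<subseteq> V j'" using e(3) j by blast+
      moreover have "V j \<inter> V j' = {}" using V j False by (simp add: disjoint_family_on_def)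
      ultimately show ?thesis using f j by auto
    qed
  qed
  moreover have "\<forall>c\<in>\<Union>(C ` J). f c \<in> H c" using e(1) f by auto
  moreover have "\<Union>(f ` \<Union>(C ` J)) = \<Union>(V ` J)"
  proof -
    have "\<Union>(f ` C j) = V j" if "j \<in> J" for j using e(3)[OF that] f[OF that] by auto
    then show ?thesis by auto
  qed
  ultimately show ?thesis unfolding rainbow_pm_def by blast
qed

lemma rainbow_pm_Un:
  assumes "rainbow_pm C V H" "rainbow_pm D W H" "C \<inter> D = {}" "V \<inter> W = {}"
  shows "rainbow_pm (C \<union> D) (V \<union> W) H"
proof -
  have "rainbow_pm (\<Union>((\<lambda>b. if b then C else D) ` UNIV)) (\<Union>((\<lambda>b. if b then V else W) ` UNIV)) H"
    by (rule rainbow_pm_UN) (use assms in \<open>auto simp: disjoint_family_on_def\<close>)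
  then show ?thesis by (simp add: UNIV_bool Un_commute)
qed

lemma rainbow_pm_empty: "rainbow_pm {} {} H"
  by (simp add: rainbow_pm_def disjoint_family_on_def)

lemma rainbow_pm_edge: "e \<in> H c \<Longrightarrow> rainbow_pm {c} e H"
  unfolding rainbow_pm_def by (rule exI[of _ "\<lambda>_. e"]) (simp add: disjoint_family_on_def)

text \<open>Keeps what is left balanced: every matched part uses \<open>k\<close> vertices per
  colour.\<close>

lemma rainbow_pm_card:
  assumes "rainbow_pm C V H" "finite C" "\<And>c e. c \<in> C \<Longrightarrow> e \<in> H c \<Longrightarrow> finite e \<and> card e = k"
  shows "card V = k * card C"
proof -
  obtain e where e: "\<forall>c\<in>C. e c \<in> H c" "disjoint_family_on e C" "\<Union>(e ` C) = V"
    using assms(1) by (auto simp: rainbow_pm_def)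
  have "card (\<Union>(e ` C)) = (\<Sum>c\<in>C. card (e c))"
    by (rule card_UN_disjoint) (use e assms in \<open>auto simp: disjoint_family_on_def\<close>)
  also have "\<dots> = (\<Sum>c\<in>C. k)" by (rule sum.cong) (use e assms in auto)
  finally show ?thesis using e by simp
qed

text \<open>With every set at least as large as the whole index set, Hall's condition is trivial and
  elements can be picked one by one.\<close>

lemma greedy_transversal:
  assumes "finite I" "\<And>i. i \<in> I \<Longrightarrow> finite (A i) \<and> card I \<le> card (A i)"
  shows "\<exists>f. inj_on f I \<and> (\<forall>i\<in>I. f i \<in> A i)"
  using assms
proof (induction I)
  case (insert i I)
  have "\<And>j. j \<in> I \<Longrightarrow> finite (A j) \<and> card I \<le> card (A j)"
    using insert.prems insert.hyps by (metis card_insert_disjoint insertCI Suc_leD)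
  then obtain f where f: "inj_on f I" "\<forall>i\<in>I. f i \<in> A i" using insert.IH by blast
  have "card (f ` I) < card (A i)"
    using insert.prems[of i] insert.hyps card_image_le[of I f] by simp
  then have "\<not> A i \<subseteq> f ` I" using insert.hyps card_mono[of "f ` I" "A i"] by auto
  then obtain a where a: "a \<in> A i" "a \<notin> f ` I" by blast
  have "inj_on (f(i := a)) (insert i I)"
    using f(1) a(2) insert.hyps(2) by (auto simp: inj_on_def)
  moreover have "\<forall>j\<in>insert i I. (f(i := a)) j \<in> A j" using f(2) a(1) by auto
  ultimately show ?case by blast
qed simp

text \<open>Each new gadget is chosen to lower \<open>\<Sum>t. (1/2) ^ (number of chosen gadgets good for t)\<close> by a
  factor \<open>1 - \<mu>/2\<close>; this replaces a random choice followed by a union bound over the targets.\<close>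

lemma greedy_family:
  fixes \<mu> :: real
  assumes "finite \<Omega>" "\<Omega> \<noteq> {}" "finite \<T>" "\<T> \<noteq> {}" "\<mu> > 0" "good {}"
    and step: "\<And>\<G> t. \<G> \<subseteq> \<Omega> \<Longrightarrow> card \<G> < s \<Longrightarrow> good \<G> \<Longrightarrow> t \<in> \<T> \<Longrightarrow>
      \<mu> * real (card \<Omega>) \<le> real (card {g\<in>\<Omega>. g \<notin> \<G> \<and> good (insert g \<G>) \<and> R g t})"
  shows "\<exists>\<G>\<subseteq>\<Omega>. card \<G> = s \<and> good \<G> \<and>
    (\<Sum>t\<in>\<T>. (1/2) ^ card {g\<in>\<G>. R g t}) \<le> real (card \<T>) * (1 - \<mu>/2) ^ s"
proof -
  have "j \<le> s \<Longrightarrow> \<exists>\<G>\<subseteq>\<Omega>. card \<G> = j \<and> good \<G> \<and>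
    (\<Sum>t\<in>\<T>. (1/2) ^ card {g\<in>\<G>. R g t}) \<le> real (card \<T>) * (1 - \<mu>/2) ^ j" for j
  proof (induction j)
    case 0
    then show ?case using \<open>good {}\<close> by (intro exI[of _ "{}"]) simp
  next
    case (Suc j)
    then obtain \<G> where \<G>: "\<G> \<subseteq> \<Omega>" "card \<G> = j" "good \<G>"
      "(\<Sum>t\<in>\<T>. (1/2) ^ card {g\<in>\<G>. R g t}) \<le> real (card \<T>) * (1 - \<mu>/2) ^ j" by auto
    have f\<G>: "finite \<G>" using \<G> assms finite_subset by blast
    define w :: "_ \<Rightarrow> real" where "w t = (1/2) ^ card {g\<in>\<G>. R g t}" for t
    define W where "W = sum w \<T>"
    define \<Omega>' where "\<Omega>' = {g\<in>\<Omega>. g \<notin> \<G> \<and> good (insert g \<G>)}"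
    have f\<Omega>: "finite \<Omega>'" using assms by (simp add: \<Omega>'_def)
    have w0: "w t > 0" for t by (simp add: w_def)
    have W0: "W > 0" unfolding W_def by (rule sum_pos) (use assms w0 in auto)
    have cnt: "\<mu> * real (card \<Omega>) \<le> real (card {g\<in>\<Omega>'. R g t})" if "t \<in> \<T>" for t
    proof -
      have "{g\<in>\<Omega>'. R g t} = {g\<in>\<Omega>. g \<notin> \<G> \<and> good (insert g \<G>) \<and> R g t}" by (auto simp: \<Omega>'_def)
      then show ?thesis using step[OF \<G>(1) _ \<G>(3) that] \<G>(2) Suc.prems by simp
    qed
    \<comment> \<open>Double counting of pairs \<open>(g, t)\<close> weighted by \<open>w\<close>:
      the gadgets in \<open>\<Omega>'\<close> account for a total of at least
      \<open>\<mu> * card \<Omega> * W\<close>, and there are at most \<open>card \<Omega>\<close>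
      of them.\<close>
    have "\<exists>g\<in>\<Omega>'. \<mu> * W \<le> (\<Sum>t\<in>{t\<in>\<T>. R g t}. w t)"
    proof (rule ccontr)
      assume "\<not> ?thesis"
      then have small: "(\<Sum>t\<in>{t\<in>\<T>. R g t}. w t) < \<mu> * W" if "g \<in> \<Omega>'" for g using that by fastforce
      have ne: "\<Omega>' \<noteq> {}"
      proof
        assume "\<Omega>' = {}"
        moreover obtain t where "t \<in> \<T>" using assms by auto
        ultimately have "\<mu> * real (card \<Omega>) \<le> 0" using cnt[of t] by simp
        moreover have "real (card \<Omega>) > 0" using assms by (simp add: card_gt_0_iff)
        ultimately show False using \<open>\<mu> > 0\<close> by (simp add: mult_le_0_iff)
      qed
      have "\<mu> * real (card \<Omega>) * W \<le> (\<Sum>t\<in>\<T>. real (card {g\<in>\<Omega>'. R g t}) * w t)"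
        unfolding W_def sum_distrib_left by (intro sum_mono mult_right_mono cnt) (use w0 less_imp_le in auto)
      also have "\<dots> = (\<Sum>t\<in>\<T>. \<Sum>g\<in>{g\<in>\<Omega>'. R g t}. w t)" by simp
      also have "\<dots> = (\<Sum>g\<in>\<Omega>'. \<Sum>t\<in>{t\<in>\<T>. R g t}. w t)" by (rule sum.swap_restrict) (use assms f\<Omega> in auto)
      also have "\<dots> < (\<Sum>g\<in>\<Omega>'. \<mu> * W)" by (rule sum_strict_mono) (use f\<Omega> ne small in auto)
      also have "\<dots> = real (card \<Omega>') * (\<mu> * W)" by simp
      also have "\<dots> \<le> real (card \<Omega>) * (\<mu> * W)"
        by (rule mult_right_mono) (use assms W0 in \<open>auto simp: \<Omega>'_def intro!: card_mono\<close>)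
      finally show False by (simp add: mult_ac)
    qed
    then obtain g where g: "g \<in> \<Omega>'" "\<mu> * W \<le> (\<Sum>t\<in>{t\<in>\<T>. R g t}. w t)" by blast
    have g': "g \<in> \<Omega>" "g \<notin> \<G>" "good (insert g \<G>)" using g(1) by (auto simp: \<Omega>'_def)
    have "(1/2) ^ card {h\<in>insert g \<G>. R h t} = w t - (if R g t then w t / 2 else 0)" for t
    proof (cases "R g t")
      case True
      then have "{h\<in>insert g \<G>. R h t} = insert g {h\<in>\<G>. R h t}" by auto
      then show ?thesis using True g'(2) f\<G> by (simp add: w_def)
    next
      case False
      then have "{h\<in>insert g \<G>. R h t} = {h\<in>\<G>. R h t}" by auto
      then show ?thesis using False by (simp add: w_def)
    qed
    then have "(\<Sum>t\<in>\<T>. (1/2) ^ card {h\<in>insert g \<G>. R h t}) = W - (\<Sum>t\<in>\<T>. if R g t then w t / 2 else 0)"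
      by (simp add: sum_subtractf W_def)
    also have "(\<Sum>t\<in>\<T>. if R g t then w t / 2 else 0) = (\<Sum>t\<in>{t\<in>\<T>. R g t}. w t) / 2"
      using assms(3) by (simp add: sum.inter_filter[symmetric] sum_divide_distrib)
    also have "W - (\<Sum>t\<in>{t\<in>\<T>. R g t}. w t) / 2 \<le> (1 - \<mu>/2) * W" using g(2) by (simp add: algebra_simps)
    also have "\<dots> \<le> (1 - \<mu>/2) * (real (card \<T>) * (1 - \<mu>/2) ^ j)"
    proof (rule mult_left_mono)
      show "W \<le> real (card \<T>) * (1 - \<mu>/2) ^ j" using \<G>(4) by (simp add: W_def w_def)
      \<comment> \<open>The existence of \<open>g\<close> forces \<open>\<mu> \<le> 1\<close>, as
        its targets weigh at most \<open>W\<close>.\<close>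
      have "(\<Sum>t\<in>{t\<in>\<T>. R g t}. w t) \<le> W" unfolding W_def
        by (rule sum_mono2) (use assms(3) less_imp_le[OF w0] in auto)
      then have "\<mu> * W \<le> 1 * W" using g(2) by simp
      then have "\<mu> \<le> 1" using W0 by simp
      then show "0 \<le> 1 - \<mu>/2" by simp
    qed
    finally have "(\<Sum>t\<in>\<T>. (1/2) ^ card {h\<in>insert g \<G>. R h t}) \<le> real (card \<T>) * (1 - \<mu>/2) ^ Suc j"
      by (simp add: mult_ac)
    moreover have "card (insert g \<G>) = Suc j" "insert g \<G> \<subseteq> \<Omega>" using \<G> g' f\<G> by auto
    ultimately show ?case using g'(3) by blast
  qed
  from this[OF order_refl] show ?thesis .
qed

text \<open>The lists of pairs \<open>(S, c)\<close> whose edges \<open>insert x S\<close> can be exchanged for \<open>insert v S\<close>; the sets \<open>W\<close>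
  and \<open>D\<close> collect the vertices and colours already in use.\<close>

fun link_lists :: "nat \<Rightarrow> 'a set \<Rightarrow> 'c set \<Rightarrow> ('c \<Rightarrow> 'a set set) \<Rightarrow> ('a \<times> 'a) list \<Rightarrow> 'a set \<Rightarrow> 'c set \<Rightarrow> ('a set \<times> 'c) list set" where
  "link_lists j V C H [] W D = {[]}"
| "link_lists j V C H ((x, v) # zs) W D =
     (\<Union>p\<in>{(S, c). S \<subseteq> V \<and> card S = j \<and> S \<inter> W = {} \<and> c \<in> C - D \<and> insert x S \<in> H c \<and> insert v S \<in> H c}.
        (#) p ` link_lists j V C H zs (W \<union> fst p) (insert (snd p) D))"

lemma finite_link_lists:
  assumes "finite V" "finite C"
  shows "finite (link_lists j V C H zs W D)"
proof (induction zs arbitrary: W D)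
  case (Cons z zs)
  obtain x v where "z = (x, v)" by (cases z)
  moreover have "finite {(S, c). S \<subseteq> V \<and> card S = j \<and> S \<inter> W = {} \<and> c \<in> C - D \<and> insert x S \<in> H c \<and> insert v S \<in> H c}"
    by (rule finite_subset[of _ "Pow V \<times> C"]) (use assms in auto)
  ultimately show ?case using Cons by simp
qed simp

text \<open>The pairs are chosen one after another. Each has at least \<open>q\<close> possibilities
  while the used vertices and colours stay within the budgets \<open>w0\<close> and
  \<open>d0\<close>, and each choice uses up \<open>j\<close> vertices and one colour.\<close>

lemma card_link_lists_ge:
  fixes q :: real
  assumes "finite V" "finite C" "q \<ge> 0"
    and step: "\<And>x v W D. (x, v) \<in> set zs0 \<Longrightarrow> W \<subseteq> V \<Longrightarrow> D \<subseteq> C \<Longrightarrow> card W \<le> w0 \<Longrightarrow> card D \<le> d0 \<Longrightarrow>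
      q \<le> real (card {(S, c). S \<subseteq> V \<and> card S = j \<and> S \<inter> W = {} \<and> c \<in> C - D \<and> insert x S \<in> H c \<and> insert v S \<in> H c})"
  shows "set zs \<subseteq> set zs0 \<Longrightarrow> W \<subseteq> V \<Longrightarrow> D \<subseteq> C \<Longrightarrow> card W + j * length zs \<le> w0 \<Longrightarrow> card D + length zs \<le> d0 \<Longrightarrow>
    q ^ length zs \<le> real (card (link_lists j V C H zs W D))"
proof (induction zs arbitrary: W D)
  case (Cons z zs)
  obtain x v where z: "z = (x, v)" by (cases z)
  define P where "P = {(S, c). S \<subseteq> V \<and> card S = j \<and> S \<inter> W = {} \<and> c \<in> C - D \<and> insert x S \<in> H c \<and> insert v S \<in> H c}"
  define Z where "Z p = (#) p ` link_lists j V C H zs (W \<union> fst p) (insert (snd p) D)" for p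
  have fP: "finite P" by (rule finite_subset[of _ "Pow V \<times> C"]) (use assms in \<open>auto simp: P_def\<close>)
  have cP: "q \<le> real (card P)" unfolding P_def
    by (rule step) (use Cons.prems z in auto)
  have cZ: "q ^ length zs \<le> real (card (Z p))" if p: "p \<in> P" for p
  proof -
    have "card (W \<union> fst p) \<le> card W + j" using card_Un_le[of W "fst p"] p by (auto simp: P_def)
    moreover have "card (insert (snd p) D) \<le> card D + 1" by (simp add: card_insert_le_m1 card_insert_if)
    ultimately have "q ^ length zs \<le> real (card (link_lists j V C H zs (W \<union> fst p) (insert (snd p) D)))"
      by (intro Cons.IH) (use Cons.prems p in \<open>auto simp: P_def\<close>)
    also have "\<dots> = real (card (Z p))" unfolding Z_def by (subst card_image) auto
    finally show ?thesis .
  qed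
  have "link_lists j V C H (z # zs) W D = (\<Union>p\<in>P. Z p)" by (simp add: z P_def Z_def)
  then have "card (link_lists j V C H (z # zs) W D) = (\<Sum>p\<in>P. card (Z p))"
    by (simp only:, intro card_UN_disjoint) (use fP finite_link_lists[OF assms(1,2)] in \<open>auto simp: Z_def\<close>)
  then have "real (card (link_lists j V C H (z # zs) W D)) = (\<Sum>p\<in>P. real (card (Z p)))" by simp
  also have "\<dots> \<ge> real (card P) * q ^ length zs" by (rule sum_bounded_below) (rule cZ)
  finally have "real (card P) * q ^ length zs \<le> real (card (link_lists j V C H (z # zs) W D))" .
  moreover have "q * q ^ length zs \<le> real (card P) * q ^ length zs" using cP assms(3) by (intro mult_right_mono) auto
  ultimately show ?case by simp
qed simp

text \<open>The two matchings share their colours and the sets \<open>S\<close>, and differ only in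
  covering the first or the second components of \<open>zs\<close>. Switching from one to the other
  is the exchange behind absorption.\<close>

lemma link_lists_structure:
  assumes "ps \<in> link_lists j V C H zs W D" "fst ` set zs \<union> snd ` set zs \<subseteq> W"
    "distinct (map fst zs)" "distinct (map snd zs)"
  shows "length ps = length zs \<and> set ps \<subseteq> {S. S \<subseteq> V \<and> card S = j} \<times> C \<and>
    \<Union>(fst ` set ps) \<inter> W = {} \<and> snd ` set ps \<inter> D = {} \<and>
    rainbow_pm (snd ` set ps) (fst ` set zs \<union> \<Union>(fst ` set ps)) H \<and>
    rainbow_pm (snd ` set ps) (snd ` set zs \<union> \<Union>(fst ` set ps)) H"
  using assms
proof (induction zs arbitrary: ps W D)
  case Nil
  then show ?case by (simp add: rainbow_pm_empty)
next
  case (Cons z zs)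
  obtain x v where z: "z = (x, v)" by (cases z)
  obtain S c ps' where p: "ps = (S, c) # ps'" "S \<subseteq> V" "card S = j" "S \<inter> W = {}" "c \<in> C" "c \<notin> D"
    "insert x S \<in> H c" "insert v S \<in> H c" and ps': "ps' \<in> link_lists j V C H zs (W \<union> S) (insert c D)"
    using Cons.prems(1) by (auto simp: z)
  have sub: "fst ` set zs \<union> snd ` set zs \<subseteq> W \<union> S" using Cons.prems(2) by auto
  have IH: "length ps' = length zs" "set ps' \<subseteq> {S. S \<subseteq> V \<and> card S = j} \<times> C"
    "\<Union>(fst ` set ps') \<inter> (W \<union> S) = {}" "snd ` set ps' \<inter> insert c D = {}"
    "rainbow_pm (snd ` set ps') (fst ` set zs \<union> \<Union>(fst ` set ps')) H"
    "rainbow_pm (snd ` set ps') (snd ` set zs \<union> \<Union>(fst ` set ps')) H"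
    using Cons.IH[OF ps' sub] Cons.prems(3,4) by auto
  have xW: "x \<in> W" "v \<in> W" "x \<notin> fst ` set zs" "v \<notin> snd ` set zs" using Cons.prems(2,3,4) by (auto simp: z)
  have SW: "S \<inter> fst ` set zs = {}" "S \<inter> snd ` set zs = {}" using Cons.prems(2) p(4) by auto
  have "rainbow_pm ({c} \<union> snd ` set ps') (insert x S \<union> (fst ` set zs \<union> \<Union>(fst ` set ps'))) H"
    by (rule rainbow_pm_Un[OF rainbow_pm_edge[of "insert x S" H c, OF p(7)] IH(5)]) (use IH(3,4) xW SW in auto)
  moreover have "rainbow_pm ({c} \<union> snd ` set ps') (insert v S \<union> (snd ` set zs \<union> \<Union>(fst ` set ps'))) H"
    by (rule rainbow_pm_Un[OF rainbow_pm_edge[of "insert v S" H c, OF p(8)] IH(6)]) (use IH(3,4) xW SW in auto)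
  moreover have "insert x S \<union> (fst ` set zs \<union> \<Union>(fst ` set ps')) = fst ` set (z # zs) \<union> \<Union>(fst ` set ps)"
    "insert v S \<union> (snd ` set zs \<union> \<Union>(fst ` set ps')) = snd ` set (z # zs) \<union> \<Union>(fst ` set ps)"
    "{c} \<union> snd ` set ps' = snd ` set ps" by (auto simp: z p(1))
  ultimately show ?case using IH(1-4) p by auto
qed

text \<open>Relative degrees above 1/2 enter here: two families that each contain more than half of
  all \<open>(k - 1)\<close>-sets overlap in a positive proportion, and the sets meeting the small
  \<open>W\<close> are too few to spoil this. The case \<open>x = v\<close> is used too, to count
  the edges at one vertex.\<close>

lemma common_link_count:
  fixes \<epsilon> \<omega> :: real
  assumes "k \<ge> 2" and kH: "k_graph k V H" and n: "card V \<ge> 2 * k" and "W \<subseteq> V"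
    and deg: "(1/2 + \<epsilon>) * real ((card V - 1) choose (k - 1)) \<le> real (set_degree H {x})"
      "(1/2 + \<epsilon>) * real ((card V - 1) choose (k - 1)) \<le> real (set_degree H {v})"
    and \<omega>: "\<omega> \<le> \<epsilon> * (1 / (2 * real k)) ^ (k - 1)" "1 + real (card W) \<le> \<omega> * real (card V)" and "\<epsilon> > 0"
  shows "\<omega> * real (card V) ^ (k - 1) \<le>
    real (card {S. S \<subseteq> V \<and> card S = k - 1 \<and> S \<inter> W = {} \<and> insert x S \<in> H \<and> insert v S \<in> H})"
proof -
  define n where "n = card V"
  have fV: "finite V" and H: "\<And>e. e \<in> H \<Longrightarrow> e \<subseteq> V \<and> card e = k" using kH by (auto simp: k_graph_def)
  have fW: "finite W" using assms(4) fV finite_subset by blast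
  define L where "L u = {S. S \<subseteq> V \<and> card S = k - 1 \<and> insert u S \<in> H}" for u
  have fL: "finite (L u)" for u unfolding L_def using fV by simp
  have cL: "set_degree H {u} \<le> card (L u)" for u
    unfolding set_degree_def
  proof (rule card_inj_on_le[where f = "\<lambda>e. e - {u}"])
    show "inj_on (\<lambda>e. e - {u}) {e \<in> H. {u} \<subseteq> e}" by (auto simp: inj_on_def)
    show "(\<lambda>e. e - {u}) ` {e \<in> H. {u} \<subseteq> e} \<subseteq> L u"
    proof
      fix S assume "S \<in> (\<lambda>e. e - {u}) ` {e \<in> H. {u} \<subseteq> e}"
      then obtain e where e: "e \<in> H" "u \<in> e" "S = e - {u}" by auto
      then have "insert u S = e" by auto
      then show "S \<in> L u" using H[OF e(1)] e by (auto simp: L_def)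
    qed
  qed (rule fL)
  define Hit where "Hit = {S. S \<subseteq> V \<and> card S = k - 1 \<and> S \<inter> W \<noteq> {}}"
  define Tg where "Tg = {S. S \<subseteq> V \<and> card S = k - 1 \<and> S \<inter> W = {} \<and> insert x S \<in> H \<and> insert v S \<in> H}"
  have fin: "finite Hit" "finite Tg" using fV by (auto simp: Hit_def Tg_def)
  have "card (L x \<inter> L v) \<le> card (Tg \<union> Hit)"
    by (rule card_mono) (use fin in \<open>auto simp: L_def Tg_def Hit_def\<close>)
  also have "\<dots> \<le> card Tg + card Hit" by (rule card_Un_le)
  also have "card Hit \<le> card W * n ^ (k - 1 - 1)"
    unfolding Hit_def n_def by (rule card_subsets_hitting_le) (use fV fW \<open>k \<ge> 2\<close> in auto)
  finally have 1: "card (L x \<inter> L v) \<le> card Tg + card W * n ^ (k - 2)" by (simp add: numeral_2_eq_2)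
  have "card (L x \<union> L v) \<le> card {S. S \<subseteq> V \<and> card S = k - 1}"
    by (rule card_mono) (use fV in \<open>auto simp: L_def\<close>)
  also have "\<dots> = n choose (k - 1)" using fV by (simp add: n_subsets n_def)
  \<comment> \<open>Degrees are measured against \<open>(n - 1) choose (k - 1)\<close>, but a link
    of \<open>x\<close> may contain \<open>v\<close>, so the union lives among all
    \<open>(k - 1)\<close>-subsets of \<open>V\<close>. The difference accounts for the summand 1
    next to \<open>card W\<close>.\<close>
  also have "\<dots> = ((n - 1) choose (k - 2)) + ((n - 1) choose (k - 1))"
  proof -
    have "n = Suc (n - 1)" "k - 1 = Suc (k - 2)" using n \<open>k \<ge> 2\<close> by (auto simp: n_def)
    then show ?thesis by (metis binomial_Suc_Suc)
  qed
  also have "(n - 1) choose (k - 2) \<le> n ^ (k - 2)"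
    by (rule order_trans[OF choose_le_power]) (simp add: power_mono)
  finally have 2: "card (L x \<union> L v) \<le> n ^ (k - 2) + ((n - 1) choose (k - 1))" by simp
  have "card (L x) + card (L v) = card (L x \<union> L v) + card (L x \<inter> L v)"
    by (rule card_Un_Int[OF fL fL])
  then have "card (L x) + card (L v) \<le> ((n - 1) choose (k - 1)) + (1 + card W) * n ^ (k - 2) + card Tg"
    using 1 2 by simp
  then have "real (card (L x) + card (L v)) \<le> real (((n - 1) choose (k - 1)) + (1 + card W) * n ^ (k - 2) + card Tg)"
    by (simp only: of_nat_le_iff)
  then have 3: "real (card (L x)) + real (card (L v)) \<le> real ((n - 1) choose (k - 1)) + (1 + real (card W)) * real n ^ (k - 2) + real (card Tg)"
    by (simp only: of_nat_add of_nat_mult of_nat_power of_nat_1)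
  have 4: "(1 + real (card W)) * real n ^ (k - 2) \<le> \<omega> * real n ^ (k - 1)"
  proof -
    have "(1 + real (card W)) * real n ^ (k - 2) \<le> (\<omega> * real n) * real n ^ (k - 2)"
      using \<omega>(2) by (intro mult_right_mono) (auto simp: n_def)
    also have "\<dots> = \<omega> * real n ^ Suc (k - 2)" by simp
    also have "Suc (k - 2) = k - 1" using \<open>k \<ge> 2\<close> by simp
    finally show ?thesis .
  qed
  have 5: "\<omega> * real n ^ (k - 1) \<le> \<epsilon> * real ((n - 1) choose (k - 1))"
  proof -
    have "\<omega> * real n ^ (k - 1) \<le> (\<epsilon> * (1 / (2 * real k)) ^ (k - 1)) * real n ^ (k - 1)"
      using \<omega>(1) by (intro mult_right_mono) auto
    also have "\<dots> = \<epsilon> * (real n / (2 * real k)) ^ (k - 1)" by (simp add: power_divide)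
    also have "\<dots> \<le> \<epsilon> * real ((n - 1) choose (k - 1))"
      using \<open>\<epsilon> > 0\<close> n \<open>k \<ge> 2\<close> by (intro mult_left_mono choose_ge_power) (auto simp: n_def)
    finally show ?thesis .
  qed
  have "real (set_degree H {x}) \<le> real (card (L x))" "real (set_degree H {v}) \<le> real (card (L v))"
    using cL by simp_all
  moreover have "(1/2 + \<epsilon>) * real ((n - 1) choose (k - 1)) = real ((n - 1) choose (k - 1)) / 2 + \<epsilon> * real ((n - 1) choose (k - 1))"
    by (simp add: algebra_simps)
  ultimately have "\<omega> * real n ^ (k - 1) \<le> real (card Tg)"
    using deg 3 4 5 unfolding n_def[symmetric] by linarith
  then show ?thesis by (simp add: Tg_def n_def)
qed

text \<open>A gadget is a pair \<open>(xs, ps)\<close>: \<open>xs\<close> lists the vertices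
  \<open>x\<^sub>i\<close>, and \<open>ps\<close> the pairs \<open>(S\<^sub>i, c\<^sub>i)\<close> of
  the exchange.\<close>

definition gadget_vertices :: "'a list \<times> ('a set \<times> 'c) list \<Rightarrow> 'a set" where
  "gadget_vertices g = set (fst g) \<union> \<Union>(fst ` set (snd g))"

definition gadget_colours :: "'a list \<times> ('a set \<times> 'c) list \<Rightarrow> 'c set" where
  "gadget_colours g = snd ` set (snd g)"

text \<open>Merely the space from which gadgets are drawn: sizes are prescribed, but neither edges
  nor disjointness. Its size is thus explicit, and absorbers of a given target form a fixed
  proportion of it.\<close>

definition gadgets :: "nat \<Rightarrow> 'a set \<Rightarrow> 'c set \<Rightarrow> ('a list \<times> ('a set \<times> 'c) list) set" where
  "gadgets k V C = {xs. set xs \<subseteq> V \<and> length xs = k} \<times>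
     {ps. set ps \<subseteq> {S. S \<subseteq> V \<and> card S = k - 1} \<times> C \<and> length ps = k}"

definition absorbs :: "('c \<Rightarrow> 'a set set) \<Rightarrow> 'a list \<times> ('a set \<times> 'c) list \<Rightarrow> 'a set \<times> 'c \<Rightarrow> bool" where
  "absorbs H g t \<longleftrightarrow> fst t \<inter> gadget_vertices g = {} \<and> snd t \<notin> gadget_colours g \<and>
     rainbow_pm (insert (snd t) (gadget_colours g)) (fst t \<union> gadget_vertices g) H"

section \<open>Counting absorbers\<close>

lemma finite_gadgets: "finite V \<Longrightarrow> finite C \<Longrightarrow> finite (gadgets k V C)"
  unfolding gadgets_def by (intro finite_cartesian_product finite_lists_length_eq) auto

lemma card_gadgets_le:
  assumes "finite V" "finite C"
  shows "real (card (gadgets k V C)) \<le> real (card V) ^ k * (real (card V) ^ (k - 1) * real (card C)) ^ k"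
proof -
  have "card (gadgets k V C) = card V ^ k * ((card V choose (k - 1)) * card C) ^ k"
    unfolding gadgets_def using assms
    by (simp add: card_cartesian_product card_lists_length_eq n_subsets finite_lists_length_eq)
  also have "\<dots> \<le> card V ^ k * (card V ^ (k - 1) * card C) ^ k"
    by (intro mult_left_mono power_mono mult_right_mono choose_le_power) auto
  finally have "real (card (gadgets k V C)) \<le> real (card V ^ k * (card V ^ (k - 1) * card C) ^ k)"
    by (simp only: of_nat_le_iff)
  then show ?thesis by simp
qed

lemma card_gadget_vertices_le:
  assumes "g \<in> gadgets k V C" "k \<ge> 1"
  shows "card (gadget_vertices g) \<le> k * k" "card (gadget_colours g) \<le> k"
proof -
  obtain xs ps where g: "g = (xs, ps)" "length xs = k" "length ps = k" "set ps \<subseteq> {S. S \<subseteq> V \<and> card S = k - 1} \<times> C"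
    using assms by (auto simp: gadgets_def)
  have "card (\<Union>(fst ` set ps)) \<le> (\<Sum>p\<in>set ps. card (fst p))" by (rule card_UN_le) simp
  also have "\<dots> = (\<Sum>p\<in>set ps. k - 1)" by (rule sum.cong) (use g(4) in auto)
  also have "\<dots> \<le> k * (k - 1)" using card_length[of ps] g(3) by simp
  finally have "card (\<Union>(fst ` set ps)) \<le> k * (k - 1)" .
  moreover have "card (set xs) \<le> k" using card_length[of xs] g(2) by simp
  moreover have "k + k * (k - 1) = k * k" using assms(2) by (simp add: algebra_simps)
  ultimately show "card (gadget_vertices g) \<le> k * k"
    using card_Un_le[of "set xs" "\<Union>(fst ` set ps)"] by (simp add: gadget_vertices_def g(1))
  have "card (snd ` set ps) \<le> card (set ps)" by (rule card_image_le) simp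
  also have "\<dots> \<le> k" using card_length[of ps] g(3) by simp
  finally show "card (gadget_colours g) \<le> k" by (simp add: gadget_colours_def g(1))
qed

text \<open>An edge of colour \<open>c\<close> can be chosen, as an ordered list, in at least
  \<open>N / 2 * (\<omega> * N ^ (k - 1))\<close> ways, and each of the \<open>k\<close> links with
  its colour in at least \<open>\<omega> / 2 * (N ^ (k - 1) * m)\<close> ways. Relative to the whole
  space this makes \<open>k + 1\<close> factors \<open>\<omega> / 2\<close>. The term
  \<open>2 * k + k * k\<close> covers the vertices of \<open>T\<close>, of the edge and of the links
  already chosen, all to be avoided besides \<open>W\<close>.\<close>

lemma absorber_count:
  fixes \<epsilon> \<omega> :: real and V :: "'a set" and C :: "'c set"
  assumes "k \<ge> 2" and fC: "finite C" and fV: "finite V" and n: "card V \<ge> 2 * k"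
    and kH: "\<And>c. c \<in> C \<Longrightarrow> k_graph k V (H c)"
    and deg: "\<And>c v. c \<in> C \<Longrightarrow> v \<in> V \<Longrightarrow> (1/2 + \<epsilon>) * real ((card V - 1) choose (k - 1)) \<le> real (set_degree (H c) {v})"
    and "\<epsilon> > 0" and \<omega>: "0 < \<omega>" "\<omega> \<le> 1/2" "\<omega> \<le> \<epsilon> * (1 / (2 * real k)) ^ (k - 1)"
    and T: "T \<subseteq> V" "card T = k" "c \<in> C" and W: "W \<subseteq> V" "real (card W + 2 * k + k * k + 1) \<le> \<omega> * real (card V)"
    and D: "D \<subseteq> C" "2 * (card D + k + 1) \<le> card C"
  shows "(\<omega> / 2) ^ Suc k * real (card (gadgets k V C)) \<le>
    real (card {g \<in> gadgets k V C. gadget_vertices g \<inter> W = {} \<and> gadget_colours g \<inter> D = {} \<and>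
      rainbow_pm (gadget_colours g) (gadget_vertices g) H \<and> absorbs H g (T, c)})"
proof -
  define N where "N = real (card V)"
  define m where "m = real (card C)"
  define B where "B = {g \<in> gadgets k V C. gadget_vertices g \<inter> W = {} \<and> gadget_colours g \<inter> D = {} \<and>
      rainbow_pm (gadget_colours g) (gadget_vertices g) H \<and> absorbs H g (T, c)}"
  have fT: "finite T" using T fV finite_subset by blast
  have fW: "finite W" using W fV finite_subset by blast
  obtain vs where vs: "set vs = T" "distinct vs" using finite_distinct_list[OF fT] by blast
  then have lvs: "length vs = k" using T distinct_card by metis
  \<comment> \<open>A fixed order on every set turns links into lists injectively.\<close>
  define l :: "'a set \<Rightarrow> 'a list" where "l S = (SOME xs. set xs = S \<and> distinct xs)" for S
  have l: "set (l S) = S" "distinct (l S)" if "finite S" for S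
    using someI_ex[OF finite_distinct_list[OF that]] by (auto simp: l_def)
  \<comment> \<open>The membership is repeated so that these are the common links of
    \<open>v\<close> with itself, as counted by \<open>common_link_count\<close>.\<close>
  define Lk where "Lk v = {S. S \<subseteq> V \<and> card S = k - 1 \<and> S \<inter> (W \<union> T) = {} \<and> insert v S \<in> H c \<and> insert v S \<in> H c}" for v
  define Xs where "Xs = {xs. distinct xs \<and> length xs = k \<and> set xs \<subseteq> V \<and> set xs \<in> H c \<and> set xs \<inter> (W \<union> T) = {}}"
  have cWT: "card (W \<union> T) \<le> card W + k" using card_Un_le[of W T] T by simp
  have fXs: "finite Xs"
    by (rule finite_subset[of _ "{xs. set xs \<subseteq> V \<and> length xs = k}"])
      (use fV in \<open>auto simp: Xs_def intro: finite_lists_length_eq\<close>)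
  have fLk: "finite (Lk v)" for v using fV by (simp add: Lk_def)
  have bound: "1 + real (card W') \<le> \<omega> * real (card V)" if "card W' \<le> card W + 2 * k + k * k" for W' :: "'a set"
  proof -
    have "1 + card W' \<le> card W + 2 * k + k * k + 1" using that by linarith
    then have "real (1 + card W') \<le> real (card W + 2 * k + k * k + 1)" by (simp only: of_nat_le_iff)
    then show ?thesis using W(2) by (simp only: of_nat_add of_nat_1)
  qed
  have cLk: "\<omega> * N ^ (k - 1) \<le> real (card (Lk v))" if "v \<in> V" for v
    unfolding Lk_def N_def
    by (rule common_link_count[OF \<open>k \<ge> 2\<close> kH[OF T(3)] n _ deg[OF T(3) that] deg[OF T(3) that] \<omega>(3) bound \<open>\<epsilon> > 0\<close>])
      (use W T cWT in auto)
  have Hc: "e \<subseteq> V" "card e = k" if "c' \<in> C" "e \<in> H c'" for c' e using kH[OF that(1)] that(2) by (auto simp: k_graph_def)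
  have fin_sub: "finite S" if "S \<subseteq> V" for S using that fV finite_subset by blast
  have cXs: "N / 2 * (\<omega> * N ^ (k - 1)) \<le> real (card Xs)"
  proof -
    have half: "N / 2 \<le> real (card (V - (W \<union> T)))"
    proof -
      have "real (card W + 2 * k + k * k + 1) \<le> (1/2) * N"
        using W(2) mult_right_mono[OF \<omega>(2), of N] by (simp add: N_def)
      moreover have "real (card (W \<union> T)) \<le> real (card W + 2 * k + k * k + 1)" by (rule of_nat_mono) (use cWT in linarith)
      moreover have "card (V - (W \<union> T)) = card V - card (W \<union> T)"
        by (rule card_Diff_subset) (use W T fW fT in auto)
      then have "real (card (V - (W \<union> T))) \<ge> N - real (card (W \<union> T))" by (simp add: N_def)
      ultimately show ?thesis by linarith
    qed
    have "N / 2 * (\<omega> * N ^ (k - 1)) \<le> real (card (V - (W \<union> T))) * (\<omega> * N ^ (k - 1))"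
      using half \<omega> by (intro mult_right_mono) (auto simp: N_def)
    also have "\<dots> \<le> (\<Sum>v\<in>V - (W \<union> T). real (card (Lk v)))" by (rule sum_bounded_below) (rule cLk, simp)
    also have "\<dots> = real (card (Sigma (V - (W \<union> T)) Lk))"
      using fV fLk by (subst card_SigmaI) auto
    also have "\<dots> \<le> real (card Xs)"
      unfolding of_nat_le_iff
    proof (rule card_inj_on_le[where f = "\<lambda>(v, S). v # l S"])
      show "inj_on (\<lambda>(v, S). v # l S) (Sigma (V - (W \<union> T)) Lk)"
      proof (rule inj_onI)
        fix p q assume p: "p \<in> Sigma (V - (W \<union> T)) Lk" "q \<in> Sigma (V - (W \<union> T)) Lk" and eq: "(\<lambda>(v, S). v # l S) p = (\<lambda>(v, S). v # l S) q"
        obtain v S v' S' where pq: "p = (v, S)" "q = (v', S')" by (cases p, cases q)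
        have vl: "v = v'" "l S = l S'" using eq by (auto simp: pq)
        have "S \<subseteq> V" "S' \<subseteq> V" using p by (simp_all add: pq Lk_def)
        then have "set (l S) = S" "set (l S') = S'" by (simp_all only: l(1)[OF fin_sub])
        then have "S = S'" using vl(2) by metis
        then show "p = q" using vl(1) by (simp add: pq)
      qed
      show "(\<lambda>(v, S). v # l S) ` Sigma (V - (W \<union> T)) Lk \<subseteq> Xs"
      proof
        fix xs assume "xs \<in> (\<lambda>(v, S). v # l S) ` Sigma (V - (W \<union> T)) Lk"
        then obtain v S where vS: "(v, S) \<in> Sigma (V - (W \<union> T)) Lk" "xs = v # l S" by force
        then have v: "v \<in> V - (W \<union> T)" "S \<subseteq> V" "card S = k - 1" "S \<inter> (W \<union> T) = {}" "insert v S \<in> H c" "xs = v # l S"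
          by (simp_all add: Lk_def)
        have fS: "finite S" by (rule fin_sub[OF v(2)])
        have cvS: "card (insert v S) = k" using Hc[OF T(3) v(5)] by simp
        then have "v \<notin> S" using v(3) \<open>k \<ge> 2\<close> by (auto simp: insert_absorb)
        moreover have "length (l S) = k - 1" using l[OF fS] v(3) distinct_card by metis
        ultimately show "xs \<in> Xs" using v l[OF fS] \<open>k \<ge> 2\<close> by (auto simp: Xs_def)
      qed
    qed (rule fXs)
    finally show ?thesis .
  qed
  define q where "q = \<omega> / 2 * (N ^ (k - 1) * m)"
  have q0: "q \<ge> 0" using \<omega> by (simp add: q_def N_def m_def)
  \<comment> \<open>\<open>T\<close> and \<open>c\<close> count as used from the start:
    \<open>T\<close> is to be disjoint from the gadget, and \<open>c\<close> has to remain free for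
    the edge \<open>set xs\<close> after the exchange.\<close>
  define Z where "Z xs = link_lists (k - 1) V C H (zip xs vs) (W \<union> T \<union> set xs) (insert c D)" for xs
  have fZ: "finite (Z xs)" for xs unfolding Z_def by (rule finite_link_lists[OF fV fC])
  have cZ: "q ^ k \<le> real (card (Z xs))" if xs: "xs \<in> Xs" for xs
  proof -
    have lz: "length (zip xs vs) = k" using xs lvs by (simp add: Xs_def)
    have step: "q \<le> real (card {(S, c). S \<subseteq> V \<and> card S = k - 1 \<and> S \<inter> W' = {} \<and> c \<in> C - D' \<and> insert x S \<in> H c \<and> insert v S \<in> H c})"
      if xv: "(x, v) \<in> set (zip xs vs)" and W': "W' \<subseteq> V" "card W' \<le> card W + 2 * k + (k - 1) * k" and D': "D' \<subseteq> C" "card D' \<le> card D + k + 1"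
      for x v W' D'
    proof -
      have xvV: "x \<in> V" "v \<in> V" using set_zip_leftD[OF xv] set_zip_rightD[OF xv] xs vs T by (auto simp: Xs_def)
      define Q where "Q c = {S. S \<subseteq> V \<and> card S = k - 1 \<and> S \<inter> W' = {} \<and> insert x S \<in> H c \<and> insert v S \<in> H c}" for c
      have "(k - 1) * k \<le> k * k" by (intro mult_right_mono) auto
      then have W2: "card W' \<le> card W + 2 * k + k * k" using W'(2) by linarith
      have cQ: "\<omega> * N ^ (k - 1) \<le> real (card (Q c))" if "c \<in> C - D'" for c
        unfolding Q_def N_def using that xvV
        by (intro common_link_count[OF \<open>k \<ge> 2\<close> kH n W'(1) deg deg \<omega>(3) bound[OF W2] \<open>\<epsilon> > 0\<close>]) auto
      have "m / 2 \<le> real (card (C - D'))"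
      proof -
        have "card (C - D') = card C - card D'" by (rule card_Diff_subset) (use D' fC finite_subset in auto)
        moreover have "2 * card D' \<le> card C" by (rule order_trans[OF mult_le_mono2[OF D'(2)] D(2)])
        ultimately have "card C \<le> 2 * card (C - D')" by linarith
        then show ?thesis by (simp add: m_def)
      qed
      then have "m / 2 * (\<omega> * N ^ (k - 1)) \<le> real (card (C - D')) * (\<omega> * N ^ (k - 1))"
        using \<omega> by (intro mult_right_mono) (auto simp: N_def)
      also have "\<dots> \<le> (\<Sum>c\<in>C - D'. real (card (Q c)))" by (rule sum_bounded_below) (rule cQ)
      also have "\<dots> = real (card (Sigma (C - D') Q))"
        using fC fV by (subst card_SigmaI) (auto simp: Q_def)
      also have "card (Sigma (C - D') Q) = card {(S, c). S \<subseteq> V \<and> card S = k - 1 \<and> S \<inter> W' = {} \<and> c \<in> C - D' \<and> insert x S \<in> H c \<and> insert v S \<in> H c}"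
        by (rule bij_betw_same_card[where f = prod.swap]) (auto simp: bij_betw_def inj_on_def Q_def image_iff)
      finally show ?thesis by (simp add: q_def mult_ac)
    qed
    have "q ^ length (zip xs vs) \<le> real (card (link_lists (k - 1) V C H (zip xs vs) (W \<union> T \<union> set xs) (insert c D)))"
    proof (rule card_link_lists_ge[OF fV fC q0, where ?w0.0 = "card W + 2 * k + (k - 1) * k" and ?d0.0 = "card D + k + 1" and ?zs0.0 = "zip xs vs"])
      show "q \<le> real (card {(S, c). S \<subseteq> V \<and> card S = k - 1 \<and> S \<inter> W' = {} \<and> c \<in> C - D' \<and> insert x S \<in> H c \<and> insert v S \<in> H c})"
        if "(x, v) \<in> set (zip xs vs)" "W' \<subseteq> V" "D' \<subseteq> C" "card W' \<le> card W + 2 * k + (k - 1) * k" "card D' \<le> card D + k + 1" for x v W' D'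
        by (rule step[OF that(1,2,4,3,5)])
      have "card (set xs) = k" using xs by (auto simp: Xs_def distinct_card)
      then have "card (W \<union> T \<union> set xs) \<le> card W + 2 * k" using card_Un_le[of "W \<union> T" "set xs"] cWT by linarith
      then show "card (W \<union> T \<union> set xs) + (k - 1) * length (zip xs vs) \<le> card W + 2 * k + (k - 1) * k" unfolding lz by simp
      have "card (insert c D) \<le> card D + 1" using finite_subset[OF D(1) fC] by (simp add: card_insert_if)
      then show "card (insert c D) + length (zip xs vs) \<le> card D + k + 1" unfolding lz by simp
      show "W \<union> T \<union> set xs \<subseteq> V" using W T xs by (auto simp: Xs_def)
      show "insert c D \<subseteq> C" using D T by auto
    qed simp
    then show ?thesis unfolding Z_def lz .
  qed
  have "Sigma Xs Z \<subseteq> B"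
  proof
    fix g assume "g \<in> Sigma Xs Z"
    then obtain xs ps where g: "g = (xs, ps)" and xs: "xs \<in> Xs" and ps: "ps \<in> Z xs" by auto
    have lx: "length xs = length vs" using xs lvs by (simp add: Xs_def)
    have z1: "map fst (zip xs vs) = xs" "map snd (zip xs vs) = vs" using lx by simp_all
    then have z2: "fst ` set (zip xs vs) = set xs" "snd ` set (zip xs vs) = T"
      using vs(1) by (metis list.set_map)+
    have st: "length ps = length (zip xs vs) \<and> set ps \<subseteq> {S. S \<subseteq> V \<and> card S = k - 1} \<times> C \<and>
      \<Union>(fst ` set ps) \<inter> (W \<union> T \<union> set xs) = {} \<and> snd ` set ps \<inter> insert c D = {} \<and>
      rainbow_pm (snd ` set ps) (fst ` set (zip xs vs) \<union> \<Union>(fst ` set ps)) H \<and>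
      rainbow_pm (snd ` set ps) (snd ` set (zip xs vs) \<union> \<Union>(fst ` set ps)) H"
      by (rule link_lists_structure[OF ps[unfolded Z_def]]) (use xs vs in \<open>auto simp: z1 z2 Xs_def\<close>)
    have sx: "set xs \<inter> (W \<union> T) = {}" "set xs \<in> H c" "set xs \<subseteq> V" "length xs = k" using xs by (auto simp: Xs_def)
    have "rainbow_pm ({c} \<union> snd ` set ps) (set xs \<union> (T \<union> \<Union>(fst ` set ps))) H"
      by (rule rainbow_pm_Un[OF rainbow_pm_edge[of "set xs" H c, OF sx(2)]]) (use st sx(1) in \<open>auto simp: z2\<close>)
    moreover have "set xs \<union> (T \<union> \<Union>(fst ` set ps)) = T \<union> gadget_vertices g" by (auto simp: g gadget_vertices_def)
    moreover have "{c} \<union> snd ` set ps = insert c (gadget_colours g)" by (auto simp: g gadget_colours_def)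
    ultimately have "rainbow_pm (insert c (gadget_colours g)) (T \<union> gadget_vertices g) H" by simp
    moreover have "T \<inter> gadget_vertices g = {}" "c \<notin> gadget_colours g"
      using st sx(1) by (auto simp: g gadget_vertices_def gadget_colours_def)
    ultimately have "absorbs H g (T, c)" by (simp add: absorbs_def)
    moreover have "g \<in> gadgets k V C" using st sx lvs by (auto simp: g gadgets_def)
    moreover have "gadget_vertices g \<inter> W = {}" "gadget_colours g \<inter> D = {}"
      using st sx(1) by (auto simp: g gadget_vertices_def gadget_colours_def)
    moreover have "rainbow_pm (gadget_colours g) (gadget_vertices g) H"
      using st by (simp add: g gadget_vertices_def gadget_colours_def z2)
    ultimately show "g \<in> B" by (simp add: B_def)
  qed
  then have "card (Sigma Xs Z) \<le> card B"
    by (rule card_mono[rotated]) (use finite_gadgets[OF fV fC] in \<open>simp add: B_def\<close>)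
  then have "real (card (Sigma Xs Z)) \<le> real (card B)" by simp
  have "(\<omega> / 2) ^ Suc k * real (card (gadgets k V C)) \<le> (\<omega> / 2) ^ Suc k * (N ^ k * (N ^ (k - 1) * m) ^ k)"
    using card_gadgets_le[OF fV fC, of k] \<omega> by (intro mult_left_mono) (auto simp: N_def m_def)
  also have "\<dots> = (N / 2 * (\<omega> * N ^ (k - 1))) * q ^ k"
  proof -
    have "N ^ k = N * N ^ (k - 1)" using \<open>k \<ge> 2\<close> by (simp add: power_eq_if)
    moreover have "q ^ k = (\<omega> / 2) ^ k * (N ^ (k - 1) * m) ^ k" unfolding q_def by (rule power_mult_distrib)
    moreover have "\<omega> / 2 * a * (N * b * y) = (N / 2 * (\<omega> * b)) * (a * y)" for a b y :: real by simp
    ultimately show ?thesis by (simp only: power_Suc)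
  qed
  also have "\<dots> \<le> real (card Xs) * q ^ k" using cXs q0 by (intro mult_right_mono) auto
  also have "\<dots> \<le> (\<Sum>xs\<in>Xs. real (card (Z xs)))" by (rule sum_bounded_below) (rule cZ)
  also have "\<dots> = real (card (Sigma Xs Z))" using fXs fZ by (subst card_SigmaI) auto
  also have "\<dots> \<le> real (card B)" by fact
  finally show ?thesis unfolding B_def .
qed

text \<open>The number of targets, pairs of a \<open>k\<close>-set and a colour, is at most
  \<open>(k * m) ^ (k + 1)\<close>; the bound on the potential needs its logarithm to be a small
  multiple of \<open>m\<close>.\<close>

lemma ln_linear_bound:
  fixes \<rho> :: real
  assumes "\<rho> > 0"
  shows "\<exists>m0. \<forall>m\<ge>m0. real (Suc k) * ln (real (k * m)) \<le> \<rho> * real m"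
proof -
  define a where "a = 2 * real (Suc k)"
  define m0 where "m0 = nat \<lceil>a\<^sup>2 * real k / \<rho>\<^sup>2\<rceil>"
  show ?thesis
  proof (intro exI[of _ m0] allI impI)
    fix m assume "m0 \<le> m"
    then have "a\<^sup>2 * real k / \<rho>\<^sup>2 \<le> real m" unfolding m0_def by linarith
    then have "a\<^sup>2 * real k \<le> \<rho>\<^sup>2 * real m" using assms by (simp add: divide_le_eq mult.commute)
    then have "a\<^sup>2 * real k * real m \<le> \<rho>\<^sup>2 * real m * real m" by (rule mult_right_mono) simp
    then have "(a * sqrt (real (k * m)))\<^sup>2 \<le> (\<rho> * real m)\<^sup>2" by (simp add: power_mult_distrib power2_eq_square mult_ac)
    then have sq: "a * sqrt (real (k * m)) \<le> \<rho> * real m"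
      by (rule power2_le_imp_le) (use assms in simp)
    have "ln (real (k * m)) \<le> 2 * sqrt (real (k * m))"
    proof (cases "k * m = 0")
      case False
      then have pos: "real (k * m) > 0" by simp
      have "ln (real (k * m)) = ln ((sqrt (real (k * m)))\<^sup>2)" using pos by simp
      also have "\<dots> = 2 * ln (sqrt (real (k * m)))" using pos by (subst ln_realpow) auto
      also have "\<dots> \<le> 2 * sqrt (real (k * m))" using ln_bound[of "sqrt (real (k * m))"] pos by simp
      finally show ?thesis .
    qed auto
    then have "real (Suc k) * ln (real (k * m)) \<le> real (Suc k) * (2 * sqrt (real (k * m)))"
      by (rule mult_left_mono) simp
    also have "\<dots> = a * sqrt (real (k * m))" by (simp add: a_def)
    finally show "real (Suc k) * ln (real (k * m)) \<le> \<rho> * real m" using sq by linarith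
  qed
qed

text \<open>Cut the leftover vertices into \<open>k\<close>-sets, one for each leftover colour. Each
  such pair has at least as many absorbers as there are leftover colours, so the pairs can be given
  distinct gadgets; a gadget without a pair keeps its own matching.\<close>

lemma absorb_leftover:
  assumes "finite V'" "finite C'" "card V' = k * card C'" "finite \<G>"
    and pm: "\<And>g. g \<in> \<G> \<Longrightarrow> rainbow_pm (gadget_colours g) (gadget_vertices g) H"
    and dis: "disjoint_family_on gadget_vertices \<G>" "disjoint_family_on gadget_colours \<G>"
    and out: "V' \<inter> \<Union>(gadget_vertices ` \<G>) = {}" "C' \<inter> \<Union>(gadget_colours ` \<G>) = {}"
    and many: "\<And>T c. T \<subseteq> V' \<Longrightarrow> card T = k \<Longrightarrow> c \<in> C' \<Longrightarrow> card C' \<le> card {g\<in>\<G>. absorbs H g (T, c)}"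
  shows "rainbow_pm (\<Union>(gadget_colours ` \<G>) \<union> C') (\<Union>(gadget_vertices ` \<G>) \<union> V') H"
proof -
  obtain E where E: "\<And>c. c \<in> C' \<Longrightarrow> E c \<subseteq> V' \<and> card (E c) = k" "disjoint_family_on E C'"
    by (rule obtain_disjoint_subsets[OF assms(2,1), of k]) (use assms(3) in auto)
  have EV: "\<Union>(E ` C') = V'"
  proof (rule card_subset_eq[OF assms(1)])
    show "\<Union>(E ` C') \<subseteq> V'" using E(1) by blast
    have "card (\<Union>(E ` C')) = (\<Sum>c\<in>C'. card (E c))"
      by (rule card_UN_disjoint)
        (use assms(2) E finite_subset[OF _ assms(1)] in \<open>auto simp: disjoint_family_on_def\<close>)
    then show "card (\<Union>(E ` C')) = card V'" using E(1) assms(3) by simp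
  qed
  have "\<exists>f. inj_on f C' \<and> (\<forall>c\<in>C'. f c \<in> {g\<in>\<G>. absorbs H g (E c, c)})"
    by (rule greedy_transversal[OF assms(2)]) (use many E(1) assms(4) in auto)
  then obtain f where f: "inj_on f C'" "\<And>c. c \<in> C' \<Longrightarrow> f c \<in> \<G>" "\<And>c. c \<in> C' \<Longrightarrow> absorbs H (f c) (E c, c)" by auto
  define P where "P g = gadget_colours g \<union> {c\<in>C'. f c = g}" for g
  define Q where "Q g = gadget_vertices g \<union> \<Union>(E ` {c\<in>C'. f c = g})" for g
  have "rainbow_pm (P g) (Q g) H" if g: "g \<in> \<G>" for g
  proof (cases "g \<in> f ` C'")
    case True
    then obtain c where c: "c \<in> C'" "g = f c" by blast
    then have "{c'\<in>C'. f c' = g} = {c}" using f(1) by (auto dest: inj_onD)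
    then have "P g = insert c (gadget_colours g)" "Q g = E c \<union> gadget_vertices g" by (auto simp: P_def Q_def)
    then show ?thesis using f(3)[OF c(1)] c(2) by (simp add: absorbs_def)
  next
    case False
    then have "{c'\<in>C'. f c' = g} = {}" by auto
    then have "P g = gadget_colours g" "Q g = gadget_vertices g" by (simp_all only: P_def Q_def) auto
    then show ?thesis using pm[OF g] by simp
  qed
  moreover have "disjoint_family_on P \<G>"
    unfolding disjoint_family_on_def
  proof (intro ballI impI equals0I)
    fix g h c assume gh: "g \<in> \<G>" "h \<in> \<G>" "g \<noteq> h" and c: "c \<in> P g \<inter> P h"
    have "gadget_colours g \<inter> gadget_colours h = {}" using dis(2) gh by (simp add: disjoint_family_on_def)
    moreover have "gadget_colours g \<inter> C' = {}" "gadget_colours h \<inter> C' = {}" using out(2) gh by auto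
    ultimately show False using c gh(3) unfolding P_def by auto
  qed
  moreover have "disjoint_family_on Q \<G>"
    unfolding disjoint_family_on_def
  proof (intro ballI impI equals0I)
    fix g h v assume gh: "g \<in> \<G>" "h \<in> \<G>" "g \<noteq> h" and v: "v \<in> Q g \<inter> Q h"
    have 1: "gadget_vertices g \<inter> gadget_vertices h = {}" using dis(1) gh by (simp add: disjoint_family_on_def)
    have 2: "gadget_vertices g \<inter> V' = {}" "gadget_vertices h \<inter> V' = {}" using out(1) gh by auto
    have EV': "E c \<subseteq> V'" if "c \<in> C'" for c using E(1)[OF that] by simp
    have a: "v \<in> gadget_vertices g \<or> (\<exists>c\<in>C'. f c = g \<and> v \<in> E c)"
      and b: "v \<in> gadget_vertices h \<or> (\<exists>c\<in>C'. f c = h \<and> v \<in> E c)" using v unfolding Q_def by auto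
    have inV: "v \<in> V'" if "\<exists>c\<in>C'. f c = j \<and> v \<in> E c" for j using EV' that by blast
    have "v \<notin> gadget_vertices g" using 1 2 b inV[of h] by auto
    moreover have "v \<notin> gadget_vertices h" using 1 2 a inV[of g] by auto
    ultimately obtain c c' where c: "c \<in> C'" "f c = g" "v \<in> E c" "c' \<in> C'" "f c' = h" "v \<in> E c'" using a b by blast
    then have "c \<noteq> c'" using gh(3) by auto
    then have "E c \<inter> E c' = {}" using E(2) c by (simp add: disjoint_family_on_def)
    then show False using c by auto
  qed
  ultimately have "rainbow_pm (\<Union>(P ` \<G>)) (\<Union>(Q ` \<G>)) H" by (rule rainbow_pm_UN)
  moreover have "\<Union>(P ` \<G>) = \<Union>(gadget_colours ` \<G>) \<union> C'" using f(2) by (auto simp: P_def)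
  moreover have "\<Union>(Q ` \<G>) = \<Union>(gadget_vertices ` \<G>) \<union> \<Union>(E ` C')" using f(2) by (auto simp: Q_def)
  ultimately show ?thesis unfolding EV by simp
qed

section \<open>The absorbing family\<close>

lemma gadget_subset:
  assumes "g \<in> gadgets k V C" "k \<ge> 1"
  shows "gadget_vertices g \<subseteq> V" "gadget_colours g \<subseteq> C" "gadget_vertices g \<noteq> {}"
proof -
  obtain xs ps where g: "g = (xs, ps)" "set xs \<subseteq> V" "length xs = k" "set ps \<subseteq> {S. S \<subseteq> V \<and> card S = k - 1} \<times> C"
    using assms(1) by (auto simp: gadgets_def)
  have "fst p \<subseteq> V" "snd p \<in> C" if "p \<in> set ps" for p using subsetD[OF g(4) that] by auto
  then show "gadget_vertices g \<subseteq> V" "gadget_colours g \<subseteq> C"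
    using g(2) by (auto simp: g(1) gadget_vertices_def gadget_colours_def)
  have "xs \<noteq> []" using g(3) assms(2) by auto
  then show "gadget_vertices g \<noteq> {}" by (simp add: g(1) gadget_vertices_def)
qed

abbreviation absorbing :: "nat \<Rightarrow> real \<Rightarrow> 'a set \<Rightarrow> 'c set \<Rightarrow> ('c \<Rightarrow> 'a set set) \<Rightarrow> 'a set \<Rightarrow> 'c set \<Rightarrow> bool" where
  "absorbing k \<sigma> V C H W D \<equiv> \<forall>V' C'. V' \<subseteq> V - W \<and> C' \<subseteq> C - D \<and> card V' = k * card C' \<and>
     real (card C') \<le> \<sigma> * real (card C) \<longrightarrow> rainbow_pm (D \<union> C') (W \<union> V') H"

text \<open>About \<open>\<tau>' * m\<close> disjoint gadgets are chosen greedily. A target with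
  \<open>x\<close> absorbers contributes \<open>(1/2) ^ x\<close> to the final potential. There are
  only polynomially many targets and the potential shrinks exponentially in \<open>m\<close>, so
  every \<open>x\<close> is linear in \<open>m\<close>.\<close>

lemma absorbing_family:
  fixes \<epsilon> \<tau> :: real
  assumes k: "k \<ge> 2" and "\<epsilon> > 0" "\<tau> > 0"
  shows "\<exists>\<sigma> m0. \<sigma> > 0 \<and> (\<forall>(V :: 'a set) (C :: 'c set) H. finite C \<and> card V = k * card C \<and> m0 \<le> card C \<and>
      (\<forall>c\<in>C. k_graph k V (H c) \<and> (\<forall>v\<in>V. (1/2 + \<epsilon>) * real ((card V - 1) choose (k - 1)) \<le> real (set_degree (H c) {v}))) \<longrightarrow>
      (\<exists>W D. W \<subseteq> V \<and> D \<subseteq> C \<and> card W = k * card D \<and> real (card D) \<le> \<tau> * real (card C) \<and>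
        absorbing k \<sigma> V C H W D))"
proof -
  define \<omega> where "\<omega> = min (1/2) (\<epsilon> * (1 / (2 * real k)) ^ (k - 1))"
  have \<omega>: "0 < \<omega>" "\<omega> \<le> 1/2" "\<omega> \<le> \<epsilon> * (1 / (2 * real k)) ^ (k - 1)"
    using k \<open>\<epsilon> > 0\<close> by (auto simp: \<omega>_def)
  define \<mu> where "\<mu> = (\<omega> / 2) ^ Suc k"
  have \<mu>: "\<mu> > 0" using \<omega> by (simp add: \<mu>_def)
  \<comment> \<open>A gadget uses at most \<open>k\<close> colours and \<open>k * k\<close>
    vertices. The first bound keeps \<open>D\<close> within \<open>\<tau> * m\<close>; the second
    keeps \<open>W\<close> below half of \<open>\<omega> * card V\<close> and \<open>D\<close> below
    a quarter of the colours.\<close>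
  define \<tau>' where "\<tau>' = min (\<tau> / real k) (\<omega> / (2 * real k))"
  have k0: "real k > 0" using k by simp
  have \<tau>': "\<tau>' > 0" using \<omega> \<open>\<tau> > 0\<close> k0 by (simp add: \<tau>'_def)
  have k\<tau>: "real k * \<tau>' \<le> \<tau>" "real k * \<tau>' \<le> \<omega> / 2"
    using k0 by (auto simp: \<tau>'_def min_def field_simps)
  \<comment> \<open>The exponent \<open>\<mu> / 2 * s\<close> is at least
    \<open>\<mu> * \<tau>' / 4 * m\<close>, which is \<open>2 * \<sigma> * m\<close>; half of that
    is given up to the number of targets.\<close>
  define \<sigma> where "\<sigma> = \<mu> * \<tau>' / 8"
  have \<sigma>: "\<sigma> > 0" using \<mu> \<tau>' by (simp add: \<sigma>_def)
  obtain m1 where m1: "\<forall>m\<ge>m1. real (Suc k) * ln (real (k * m)) \<le> \<sigma> * real m"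
    using ln_linear_bound[OF \<sigma>, of k] by blast
  \<comment> \<open>The summands serve, in this order, the logarithm of the number of targets, the
    colours to be avoided besides \<open>D\<close>, the vertices to be avoided besides
    \<open>W\<close>, and the rounding of \<open>s\<close>.\<close>
  define m0 where "m0 = m1 + 4 * (k + 1) + nat \<lceil>real (2 * k + k * k + 1) * 2 / (\<omega> * real k)\<rceil> + nat \<lceil>2 / \<tau>'\<rceil>"
  have main: "\<exists>W D. W \<subseteq> V \<and> D \<subseteq> C \<and> card W = k * card D \<and> real (card D) \<le> \<tau> * real (card C) \<and>
        absorbing k \<sigma> V C H W D"
    if fC: "finite C" and cV: "card V = k * card C" and m0: "m0 \<le> card C"
      and kH: "\<And>c. c \<in> C \<Longrightarrow> k_graph k V (H c)"
      and deg: "\<And>c v. c \<in> C \<Longrightarrow> v \<in> V \<Longrightarrow> (1/2 + \<epsilon>) * real ((card V - 1) choose (k - 1)) \<le> real (set_degree (H c) {v})"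
    for V :: "'a set" and C :: "'c set" and H
  proof -
    define m where "m = real (card C)"
    have mm: "m1 \<le> card C" "4 * (k + 1) \<le> card C" using m0 by (simp_all add: m0_def)
    have mb: "real (2 * k + k * k + 1) * 2 / (\<omega> * real k) \<le> m" "2 / \<tau>' \<le> m"
    proof -
      have "real m0 \<le> m" using m0 by (simp add: m_def)
      then show "real (2 * k + k * k + 1) * 2 / (\<omega> * real k) \<le> m" "2 / \<tau>' \<le> m" unfolding m0_def by linarith+
    qed
    have mpos: "m > 0" using mm by (simp add: m_def)
    have Cne: "C \<noteq> {}" using mm by auto
    have fV: "finite V" using kH Cne by (auto simp: k_graph_def)
    have n2k: "card V \<ge> 2 * k"
    proof -
      have "k * 2 \<le> k * card C" using mm(2) by (intro mult_left_mono) auto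
      then show ?thesis by (simp add: cV mult.commute)
    qed
    define s where "s = nat \<lfloor>\<tau>' * m\<rfloor>"
    have \<tau>m: "\<tau>' * m \<ge> 2" using mb(2) \<tau>' by (simp add: divide_le_eq mult.commute)
    have s1: "real s \<le> \<tau>' * m" "\<tau>' * m / 2 \<le> real s" using \<tau>m unfolding s_def by linarith+
    define \<T> where "\<T> = {T. T \<subseteq> V \<and> card T = k} \<times> C"
    define good where "good \<G> \<longleftrightarrow> (\<forall>g\<in>\<G>. rainbow_pm (gadget_colours g) (gadget_vertices g) H) \<and>
      disjoint_family_on gadget_vertices \<G> \<and> disjoint_family_on gadget_colours \<G>"
      for \<G> :: "('a list \<times> ('a set \<times> 'c) list) set"
    define \<Omega> where "\<Omega> = gadgets k V C"
    have f\<Omega>: "finite \<Omega>" unfolding \<Omega>_def by (rule finite_gadgets[OF fV fC])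
    have k1: "k \<ge> 1" using k by simp
    have sub: "gadget_vertices g \<subseteq> V" "gadget_colours g \<subseteq> C" "gadget_vertices g \<noteq> {}" 
      "card (gadget_vertices g) \<le> k * k" "card (gadget_colours g) \<le> k" if "g \<in> \<Omega>" for g
      using gadget_subset[OF that[unfolded \<Omega>_def] k1] card_gadget_vertices_le[OF that[unfolded \<Omega>_def] k1] by simp_all
    have cardU: "card (\<Union>(gadget_vertices ` \<G>)) \<le> card \<G> * (k * k)" "card (\<Union>(gadget_colours ` \<G>)) \<le> card \<G> * k"
      if "\<G> \<subseteq> \<Omega>" for \<G>
    proof -
      have f: "finite \<G>" using that f\<Omega> finite_subset by blast
      have "card (\<Union>(gadget_vertices ` \<G>)) \<le> (\<Sum>g\<in>\<G>. card (gadget_vertices g))" by (rule card_UN_le[OF f])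
      also have "\<dots> \<le> of_nat (card \<G>) * (k * k)" by (rule sum_bounded_above) (use sub(4) that in auto)
      finally show "card (\<Union>(gadget_vertices ` \<G>)) \<le> card \<G> * (k * k)" by simp
      have "card (\<Union>(gadget_colours ` \<G>)) \<le> (\<Sum>g\<in>\<G>. card (gadget_colours g))" by (rule card_UN_le[OF f])
      also have "\<dots> \<le> of_nat (card \<G>) * k" by (rule sum_bounded_above) (use sub(5) that in auto)
      finally show "card (\<Union>(gadget_colours ` \<G>)) \<le> card \<G> * k" by simp
    qed
    have step: "\<mu> * real (card \<Omega>) \<le> real (card {g\<in>\<Omega>. g \<notin> \<G> \<and> good (insert g \<G>) \<and> absorbs H g t})"
      if \<G>: "\<G> \<subseteq> \<Omega>" "card \<G> < s" "good \<G>" and t: "t \<in> \<T>" for \<G> t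
    proof -
      define W where "W = \<Union>(gadget_vertices ` \<G>)"
      define D where "D = \<Union>(gadget_colours ` \<G>)"
      obtain T c where T: "t = (T, c)" "T \<subseteq> V" "card T = k" "c \<in> C" using t by (auto simp: \<T>_def)
      have WV: "W \<subseteq> V" "D \<subseteq> C" using sub(1,2) \<G>(1) unfolding W_def D_def by blast+
      have "card W \<le> card \<G> * (k * k)" unfolding W_def by (rule cardU(1)[OF \<G>(1)])
      also have "\<dots> \<le> s * (k * k)" using \<G>(2) by (intro mult_right_mono) auto
      finally have "real (card W) \<le> real (s * (k * k))" by (rule of_nat_mono)
      also have "\<dots> \<le> (\<tau>' * m) * (real k * real k)" unfolding of_nat_mult by (rule mult_right_mono[OF s1(1)]) simp
      also have "\<dots> = (real k * \<tau>') * (real k * m)" by simp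
      also have "\<dots> \<le> \<omega> / 2 * (real k * m)" using k\<tau>(2) mpos by (intro mult_right_mono) auto
      finally have "real (card W) \<le> \<omega> / 2 * (real k * m)" .
      moreover have "real (2 * k + k * k + 1) \<le> \<omega> / 2 * (real k * m)"
      proof -
        have "\<omega> * real k > 0" using \<omega> k0 by simp
        then have "real (2 * k + k * k + 1) * 2 \<le> m * (\<omega> * real k)" using mb(1) by (simp only: pos_divide_le_eq)
        then show ?thesis by (simp add: mult_ac)
      qed
      moreover have "real (card W + 2 * k + k * k + 1) = real (card W) + real (2 * k + k * k + 1)" by simp
      moreover have "\<omega> * real (card V) = \<omega> / 2 * (real k * m) + \<omega> / 2 * (real k * m)" by (simp add: cV m_def)
      ultimately have Wb: "real (card W + 2 * k + k * k + 1) \<le> \<omega> * real (card V)" by linarith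
      have "card D \<le> card \<G> * k" unfolding D_def by (rule cardU(2)[OF \<G>(1)])
      also have "\<dots> \<le> s * k" using \<G>(2) by (intro mult_right_mono) auto
      finally have "real (card D) \<le> real (s * k)" by (rule of_nat_mono)
      also have "\<dots> \<le> (\<tau>' * m) * real k" unfolding of_nat_mult by (rule mult_right_mono[OF s1(1)]) simp
      also have "\<dots> = (real k * \<tau>') * m" by simp
      also have "\<dots> \<le> (1/4) * m" using k\<tau>(2) \<omega>(2) mpos by (intro mult_right_mono) auto
      finally have "4 * real (card D) \<le> real (card C)" by (simp add: m_def)
      then have "real (4 * card D) \<le> real (card C)" by simp
      then have "4 * card D \<le> card C" by (simp only: of_nat_le_iff)
      moreover have "2 * (a + b + 1) \<le> x" if "4 * a \<le> x" "4 * (b + 1) \<le> x" for a b x :: nat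
        using that by presburger
      ultimately have Db: "2 * (card D + k + 1) \<le> card C" using mm(2) by blast
      have "\<mu> * real (card \<Omega>) \<le> real (card {g \<in> gadgets k V C. gadget_vertices g \<inter> W = {} \<and> gadget_colours g \<inter> D = {} \<and>
          rainbow_pm (gadget_colours g) (gadget_vertices g) H \<and> absorbs H g (T, c)})"
        unfolding \<mu>_def \<Omega>_def
        by (rule absorber_count[OF k fC fV n2k kH deg \<open>\<epsilon> > 0\<close> \<omega> T(2,3,4) WV(1) Wb WV(2) Db])
      also have "\<dots> \<le> real (card {g\<in>\<Omega>. g \<notin> \<G> \<and> good (insert g \<G>) \<and> absorbs H g t})"
      proof (rule of_nat_mono, rule card_mono)
        show "finite {g\<in>\<Omega>. g \<notin> \<G> \<and> good (insert g \<G>) \<and> absorbs H g t}" using f\<Omega> by simp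
        show "{g \<in> gadgets k V C. gadget_vertices g \<inter> W = {} \<and> gadget_colours g \<inter> D = {} \<and>
          rainbow_pm (gadget_colours g) (gadget_vertices g) H \<and> absorbs H g (T, c)}
          \<subseteq> {g\<in>\<Omega>. g \<notin> \<G> \<and> good (insert g \<G>) \<and> absorbs H g t}"
        proof
          fix g assume "g \<in> {g \<in> gadgets k V C. gadget_vertices g \<inter> W = {} \<and> gadget_colours g \<inter> D = {} \<and>
            rainbow_pm (gadget_colours g) (gadget_vertices g) H \<and> absorbs H g (T, c)}"
          then have g: "g \<in> \<Omega>" "gadget_vertices g \<inter> W = {}" "gadget_colours g \<inter> D = {}"
            "rainbow_pm (gadget_colours g) (gadget_vertices g) H" "absorbs H g t" by (simp_all add: \<Omega>_def T(1))
          have "g \<notin> \<G>" using g(2) sub(3)[OF g(1)] unfolding W_def by auto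
          moreover have "good (insert g \<G>)"
            using \<G>(3) g(2,3,4) unfolding good_def W_def D_def disjoint_family_on_def by auto
          ultimately show "g \<in> {g\<in>\<Omega>. g \<notin> \<G> \<and> good (insert g \<G>) \<and> absorbs H g t}" using g(1,5) by simp
        qed
      qed
      finally show ?thesis .
    qed
    have kV: "k \<le> card V" using n2k by linarith
    obtain T0 where T0: "T0 \<subseteq> V" "card T0 = k" using obtain_subset_with_card_n[OF kV] by metis
    obtain c0 where c0: "c0 \<in> C" using Cne by blast
    have \<T>ne: "\<T> \<noteq> {}" using T0 c0 by (auto simp: \<T>_def)
    have f\<T>: "finite \<T>" using fV fC by (simp add: \<T>_def)
    \<comment> \<open>A degenerate gadget full of repetitions will do, as \<open>gadgets\<close>
      demands neither distinctness nor edges.\<close>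
    have \<Omega>ne: "\<Omega> \<noteq> {}"
    proof -
      obtain v where v: "v \<in> V" using T0 k by fastforce
      have "k - 1 \<le> card V" using kV by linarith
      then obtain S where S: "S \<subseteq> V" "card S = k - 1" using obtain_subset_with_card_n by metis
      have "(replicate k v, replicate k (S, c0)) \<in> \<Omega>" using v S c0 k by (auto simp: \<Omega>_def gadgets_def)
      then show ?thesis by blast
    qed
    have good0: "good {}" by (simp add: good_def disjoint_family_on_def)
    from greedy_family[where R = "absorbs H" and good = good and s = s, OF f\<Omega> \<Omega>ne f\<T> \<T>ne \<mu> good0 step]
    obtain \<G> where \<G>: "\<G> \<subseteq> \<Omega>" "card \<G> = s" "good \<G>"
      and pot: "(\<Sum>t\<in>\<T>. (1/2) ^ card {g\<in>\<G>. absorbs H g t}) \<le> real (card \<T>) * (1 - \<mu>/2) ^ s" by blast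
    have f\<G>: "finite \<G>" using \<G>(1) f\<Omega> finite_subset by blast
    have many: "\<sigma> * m \<le> real (card {g\<in>\<G>. absorbs H g t})" if t: "t \<in> \<T>" for t
    proof -
      define x where "x = card {g\<in>\<G>. absorbs H g t}"
      define N where "N = real (k * card C)"
      have Npos: "N > 0" using mpos k0 by (simp add: N_def m_def)
      \<comment> \<open>Since \<open>e\<close> is at least 2, passing from base 1/2 to base
        \<open>1 / e\<close> is a valid estimate and leaves only exponents to compare.\<close>
      have "exp (- real x) = exp (-1) ^ x" by (simp add: exp_of_nat_mult[symmetric])
      also have "\<dots> \<le> (1/2) ^ x"
      proof (rule power_mono)
        have "2 \<le> exp (1::real)" using exp_ge_add_one_self[of 1] by simp
        then show "exp (-1) \<le> (1/2 :: real)" by (simp add: exp_minus field_simps)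
      qed simp
      also have "\<dots> \<le> (\<Sum>t\<in>\<T>. (1/2) ^ card {g\<in>\<G>. absorbs H g t})"
        unfolding x_def by (rule member_le_sum[OF t _ f\<T>]) simp
      also have "\<dots> \<le> real (card \<T>) * (1 - \<mu>/2) ^ s" by (rule pot)
      also have "\<dots> \<le> N ^ Suc k * exp (- (\<mu> / 2 * real s))"
      proof (rule mult_mono)
        have "card \<T> = (card V choose k) * card C" using fV by (simp add: \<T>_def card_cartesian_product n_subsets)
        also have "\<dots> \<le> card V ^ k * card V" using k cV by (intro mult_mono choose_le_power) auto
        finally have "real (card \<T>) \<le> real (card V ^ k * card V)" by (rule of_nat_mono)
        then show "real (card \<T>) \<le> N ^ Suc k" by (simp add: N_def cV mult_ac)
        have "\<mu> \<le> 1" unfolding \<mu>_def by (rule power_le_one) (use \<omega> in auto)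
        have "(1 - \<mu>/2) ^ s \<le> exp (- (\<mu>/2)) ^ s"
          by (rule power_mono) (use exp_ge_add_one_self[of "- (\<mu>/2)"] \<open>\<mu> \<le> 1\<close> in auto)
        then show "(1 - \<mu>/2) ^ s \<le> exp (- (\<mu> / 2 * real s))" by (simp add: exp_of_nat_mult[symmetric] mult.commute)
        show "0 \<le> (1 - \<mu>/2) ^ s" using \<open>\<mu> \<le> 1\<close> by simp
      qed (use Npos in simp)
      also have "N ^ Suc k = exp (real (Suc k) * ln N)" using Npos by (simp only: exp_of_nat_mult exp_ln)
      finally have "exp (- real x) \<le> exp (real (Suc k) * ln N + - (\<mu> / 2 * real s))" unfolding exp_add .
      then have "- real x \<le> real (Suc k) * ln N + - (\<mu> / 2 * real s)" by (rule exp_le_cancel_iff[THEN iffD1])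
      moreover have "real (Suc k) * ln N \<le> \<sigma> * m" using m1[rule_format, OF mm(1)] by (simp only: N_def m_def)
      moreover have "2 * (\<sigma> * m) \<le> \<mu> / 2 * real s"
      proof -
        have "\<mu> / 2 * (\<tau>' * m / 2) \<le> \<mu> / 2 * real s" using s1(2) \<mu> by (intro mult_left_mono) auto
        then show ?thesis by (simp add: \<sigma>_def)
      qed
      ultimately show ?thesis unfolding x_def by linarith
    qed
    define W where "W = \<Union>(gadget_vertices ` \<G>)"
    define D where "D = \<Union>(gadget_colours ` \<G>)"
    have WD: "W \<subseteq> V" "D \<subseteq> C" using sub(1,2) \<G>(1) unfolding W_def D_def by blast+
    have pm: "rainbow_pm (gadget_colours g) (gadget_vertices g) H" if "g \<in> \<G>" for g using \<G>(3) that by (simp add: good_def)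
    have disv: "disjoint_family_on gadget_vertices \<G>" and disc: "disjoint_family_on gadget_colours \<G>"
      using \<G>(3) by (simp_all add: good_def)
    have "rainbow_pm D W H" unfolding D_def W_def by (rule rainbow_pm_UN[OF pm disc disv])
    then have "card W = k * card D"
    proof (rule rainbow_pm_card)
      show "finite D" using WD(2) fC finite_subset by blast
      show "finite e \<and> card e = k" if "c \<in> D" "e \<in> H c" for c e
        using kH[of c] that WD(2) finite_subset[OF _ fV, of e] by (auto simp: k_graph_def)
    qed
    moreover have "real (card D) \<le> \<tau> * m"
    proof -
      have "card D \<le> s * k" unfolding D_def using cardU(2)[OF \<G>(1)] \<G>(2) by simp
      then have "real (card D) \<le> real (s * k)" by (rule of_nat_mono)
      also have "\<dots> \<le> (\<tau>' * m) * real k" unfolding of_nat_mult by (rule mult_right_mono[OF s1(1)]) simp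
      also have "\<dots> = (real k * \<tau>') * m" by simp
      also have "\<dots> \<le> \<tau> * m" using k\<tau>(1) mpos by (intro mult_right_mono) auto
      finally show ?thesis .
    qed
    moreover have "rainbow_pm (D \<union> C') (W \<union> V') H"
      if V': "V' \<subseteq> V - W" "C' \<subseteq> C - D" "card V' = k * card C'" "real (card C') \<le> \<sigma> * m" for V' C'
      unfolding D_def W_def
    proof (rule absorb_leftover[OF _ _ V'(3) f\<G> pm disv disc])
      show "finite V'" by (rule finite_subset[OF _ fV]) (use V'(1) in blast)
      show "finite C'" by (rule finite_subset[OF _ fC]) (use V'(2) in blast)
      show "V' \<inter> \<Union>(gadget_vertices ` \<G>) = {}" using V'(1) unfolding W_def by blast
      show "C' \<inter> \<Union>(gadget_colours ` \<G>) = {}" using V'(2) unfolding D_def by blast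
      fix T c assume "T \<subseteq> V'" "card T = k" "c \<in> C'"
      then have "(T, c) \<in> \<T>" using V'(1,2) by (auto simp: \<T>_def)
      from many[OF this] have "real (card C') \<le> real (card {g\<in>\<G>. absorbs H g (T, c)})" using V'(4) by linarith
      then show "card C' \<le> card {g\<in>\<G>. absorbs H g (T, c)}" by (simp only: of_nat_le_iff)
    qed
    ultimately show ?thesis using WD unfolding m_def
      by (intro exI[of _ W] exI[of _ D] conjI allI impI) simp_all
  qed
  show ?thesis
    by (rule exI[of _ \<sigma>], rule exI[of _ m0], intro conjI allI impI, rule \<sigma>, elim conjE, rule main) simp_all
qed

section \<open>Rainbow perfect matchings\<close>

text \<open>Sum the degrees of the \<open>d\<close>-sets through \<open>v\<close>: an edge at
  \<open>v\<close> is counted \<open>(k - 1) choose (d - 1)\<close> times. The identity for nested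
  subsets converts the maximal \<open>d\<close>-degree into the maximal vertex degree, so the ratio
  \<open>\<rho>\<close> is kept.\<close>

lemma vertex_degree_ge:
  fixes \<rho> :: real
  assumes "k_graph k V H" "1 \<le> d" "d < k" "k \<le> card V" "v \<in> V"
    and deg: "\<And>S. S \<subseteq> V \<Longrightarrow> card S = d \<Longrightarrow> \<rho> * real ((card V - d) choose (k - d)) \<le> real (set_degree H S)"
  shows "\<rho> * real ((card V - 1) choose (k - 1)) \<le> real (set_degree H {v})"
proof -
  define n where "n = card V"
  have fV: "finite V" and H: "\<And>e. e \<in> H \<Longrightarrow> e \<subseteq> V \<and> card e = k" using assms(1) by (auto simp: k_graph_def)
  have fH: "finite H" by (rule finite_subset[of _ "Pow V"]) (use H fV in auto)
  define \<D> where "\<D> = insert v ` {S. S \<subseteq> V - {v} \<and> card S = d - 1}"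
  have f\<D>: "finite \<D>" using fV by (simp add: \<D>_def)
  have inj: "inj_on (insert v) {S. S \<subseteq> V - {v} \<and> card S = d - 1}" by (auto simp: inj_on_def)
  have c\<D>: "card \<D> = (n - 1) choose (d - 1)"
    unfolding \<D>_def using fV assms(5) by (subst card_image[OF inj]) (simp add: n_subsets n_def)
  have \<D>: "S \<subseteq> V" "card S = d" "v \<in> S" if S: "S \<in> \<D>" for S
  proof -
    obtain S' where S': "S = insert v S'" "S' \<subseteq> V - {v}" "card S' = d - 1" using S by (auto simp: \<D>_def)
    have "finite S'" "v \<notin> S'" using S'(2) finite_subset[OF _ fV, of S'] by auto
    then show "S \<subseteq> V" "card S = d" "v \<in> S" using S' assms(2,5) by auto
  qed
  have "(\<Sum>S\<in>\<D>. set_degree H S) = (\<Sum>S\<in>\<D>. \<Sum>e\<in>{e \<in> H. S \<subseteq> e}. 1)" by (simp add: set_degree_def)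
  also have "\<dots> = (\<Sum>e\<in>H. \<Sum>S\<in>{S \<in> \<D>. S \<subseteq> e}. 1)" by (rule sum.swap_restrict[OF f\<D> fH])
  also have "\<dots> \<le> (\<Sum>e\<in>H. if v \<in> e then (k - 1) choose (d - 1) else 0)"
  proof (rule sum_mono)
    fix e assume e: "e \<in> H"
    show "(\<Sum>S\<in>{S \<in> \<D>. S \<subseteq> e}. 1) \<le> (if v \<in> e then (k - 1) choose (d - 1) else 0)"
    proof (cases "v \<in> e")
      case True
      have fe: "finite e" using H[OF e] finite_subset[OF _ fV] by blast
      have "{S \<in> \<D>. S \<subseteq> e} \<subseteq> insert v ` {S. S \<subseteq> e - {v} \<and> card S = d - 1}" by (auto simp: \<D>_def)
      then have "card {S \<in> \<D>. S \<subseteq> e} \<le> card (insert v ` {S. S \<subseteq> e - {v} \<and> card S = d - 1})"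
        by (rule card_mono[rotated]) (use fe in simp)
      also have "\<dots> \<le> card {S. S \<subseteq> e - {v} \<and> card S = d - 1}" by (rule card_image_le) (use fe in simp)
      also have "\<dots> = (k - 1) choose (d - 1)" using fe True H[OF e] by (simp add: n_subsets)
      finally show ?thesis using True by simp
    next
      case False
      then have "{S \<in> \<D>. S \<subseteq> e} = {}" using \<D>(3) by auto
      then show ?thesis by (simp only: sum.empty zero_le)
    qed
  qed
  also have "\<dots> = (\<Sum>e\<in>{e\<in>H. v \<in> e}. (k - 1) choose (d - 1))" by (rule sum.inter_filter[symmetric, OF fH])
  also have "\<dots> = set_degree H {v} * ((k - 1) choose (d - 1))" by (simp add: set_degree_def)
  finally have "real (\<Sum>S\<in>\<D>. set_degree H S) \<le> real (set_degree H {v} * ((k - 1) choose (d - 1)))"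
    by (rule of_nat_mono)
  moreover have "real (card \<D>) * (\<rho> * real ((n - d) choose (k - d))) \<le> (\<Sum>S\<in>\<D>. real (set_degree H S))"
    by (rule sum_bounded_below) (use deg \<D> in \<open>simp add: n_def\<close>)
  moreover have "real (card \<D>) * (\<rho> * real ((n - d) choose (k - d))) = \<rho> * real ((n - 1) choose (k - 1)) * real ((k - 1) choose (d - 1))"
  proof -
    have "((n - 1) choose (k - 1)) * ((k - 1) choose (d - 1)) = ((n - 1) choose (d - 1)) * ((n - 1 - (d - 1)) choose (k - 1 - (d - 1)))"
      by (rule choose_mult) (use assms in \<open>auto simp: n_def\<close>)
    moreover have "n - 1 - (d - 1) = n - d" "k - 1 - (d - 1) = k - d" using assms(2,3) by auto
    ultimately have "real ((n - 1) choose (k - 1)) * real ((k - 1) choose (d - 1)) = real ((n - 1) choose (d - 1)) * real ((n - d) choose (k - d))"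
      by (metis of_nat_mult)
    then show ?thesis unfolding c\<D> by (simp add: mult_ac)
  qed
  ultimately have "\<rho> * real ((n - 1) choose (k - 1)) * real ((k - 1) choose (d - 1)) \<le> real (set_degree H {v}) * real ((k - 1) choose (d - 1))"
    by simp
  moreover have "real ((k - 1) choose (d - 1)) > 0" using assms(2,3) by simp
  ultimately show ?thesis unfolding n_def by (rule mult_right_le_imp_le)
qed

text \<open>A deleted vertex destroys at most \<open>card V ^ (k - d - 1)\<close> edges through
  \<open>S\<close>, so a small \<open>W\<close> costs at most half of the margin
  \<open>\<epsilon>\<close>. The binomial of the smaller vertex set is no larger, which helps
  because \<open>\<rho>\<close> is nonnegative.\<close>

lemma degree_after_deletion:
  fixes \<rho> \<epsilon> \<theta> :: real
  assumes kH: "k_graph k V H" and dk: "1 \<le> d" "d < k" and n: "2 * k \<le> card V" and W: "W \<subseteq> V" "real (card W) \<le> \<theta> * real (card V)"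
    and \<theta>: "\<theta> \<le> \<epsilon> / 2 * (1 / (2 * real k)) ^ (k - d)" and "\<rho> \<ge> 0" "\<epsilon> > 0"
    and S: "S \<subseteq> V - W" "card S = d" and deg: "(\<rho> + \<epsilon>) * real ((card V - d) choose (k - d)) \<le> real (set_degree H S)"
  shows "(\<rho> + \<epsilon> / 2) * real ((card (V - W) - d) choose (k - d)) \<le> real (set_degree {e\<in>H. e \<subseteq> V - W} S)"
proof -
  define N where "N = real (card V)"
  define C where "C = real ((card V - d) choose (k - d))"
  have fV: "finite V" and H: "\<And>e. e \<in> H \<Longrightarrow> e \<subseteq> V \<and> card e = k" using kH by (auto simp: k_graph_def)
  have fW: "finite W" and fS: "finite S" using finite_subset[OF W(1) fV] finite_subset[OF S(1)] fV by auto
  have fH: "finite H" by (rule finite_subset[of _ "Pow V"]) (use H fV in auto)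
  define P where "P = {e\<in>H. S \<subseteq> e \<and> e \<inter> W \<noteq> {}}"
  have "{e\<in>H. S \<subseteq> e} \<subseteq> {e \<in> {e\<in>H. e \<subseteq> V - W}. S \<subseteq> e} \<union> P" using H by (auto simp: P_def)
  then have "card {e\<in>H. S \<subseteq> e} \<le> card ({e \<in> {e\<in>H. e \<subseteq> V - W}. S \<subseteq> e} \<union> P)"
    by (rule card_mono[rotated]) (use fH in \<open>simp add: P_def\<close>)
  also have "\<dots> \<le> card {e \<in> {e\<in>H. e \<subseteq> V - W}. S \<subseteq> e} + card P" by (rule card_Un_le)
  also have "card P \<le> card {T. T \<subseteq> V \<and> card T = k - d \<and> T \<inter> W \<noteq> {}}"
  proof (rule card_inj_on_le[where f = "\<lambda>e. e - S"])
    show "inj_on (\<lambda>e. e - S) P" by (auto simp: inj_on_def P_def)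
    show "(\<lambda>e. e - S) ` P \<subseteq> {T. T \<subseteq> V \<and> card T = k - d \<and> T \<inter> W \<noteq> {}}"
    proof
      fix T assume "T \<in> (\<lambda>e. e - S) ` P"
      then obtain e where e: "e \<in> H" "S \<subseteq> e" "e \<inter> W \<noteq> {}" "T = e - S" by (auto simp: P_def)
      have "card T = k - d" using H[OF e(1)] e(2,4) fS S(2) by (simp add: card_Diff_subset)
      moreover have "T \<subseteq> V" "T \<inter> W \<noteq> {}" using H[OF e(1)] e(3,4) S(1) by auto
      ultimately show "T \<in> {T. T \<subseteq> V \<and> card T = k - d \<and> T \<inter> W \<noteq> {}}" by simp
    qed
    show "finite {T. T \<subseteq> V \<and> card T = k - d \<and> T \<inter> W \<noteq> {}}" using fV by simp
  qed
  also have "\<dots> \<le> card W * card V ^ (k - d - 1)" by (rule card_subsets_hitting_le) (use fV fW dk in auto)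
  finally have "set_degree H S \<le> set_degree {e\<in>H. e \<subseteq> V - W} S + card W * card V ^ (k - d - 1)"
    by (simp add: set_degree_def)
  then have "real (set_degree H S) \<le> real (set_degree {e\<in>H. e \<subseteq> V - W} S + card W * card V ^ (k - d - 1))"
    by (rule of_nat_mono)
  then have 1: "real (set_degree H S) \<le> real (set_degree {e\<in>H. e \<subseteq> V - W} S) + real (card W) * N ^ (k - d - 1)"
    by (simp add: N_def)
  have "real (card W) * N ^ (k - d - 1) \<le> (\<theta> * N) * N ^ (k - d - 1)"
    using W(2) by (intro mult_right_mono) (auto simp: N_def)
  also have "\<dots> = \<theta> * N ^ Suc (k - d - 1)" by simp
  also have "Suc (k - d - 1) = k - d" using dk by simp
  also have "\<theta> * N ^ (k - d) \<le> (\<epsilon> / 2 * (1 / (2 * real k)) ^ (k - d)) * N ^ (k - d)"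
    using \<theta> by (intro mult_right_mono) (auto simp: N_def)
  also have "\<dots> = \<epsilon> / 2 * (N / (2 * real k)) ^ (k - d)" by (simp add: power_divide)
  also have "\<dots> \<le> \<epsilon> / 2 * C"
    unfolding N_def C_def using \<open>\<epsilon> > 0\<close> dk n by (intro mult_left_mono choose_ge_power) auto
  finally have 2: "real (card W) * N ^ (k - d - 1) \<le> \<epsilon> / 2 * C" .
  have "(\<rho> + \<epsilon>) * C = (\<rho> + \<epsilon> / 2) * C + \<epsilon> / 2 * C" by (simp add: algebra_simps)
  then have "(\<rho> + \<epsilon> / 2) * C \<le> real (set_degree {e\<in>H. e \<subseteq> V - W} S)" using 1 2 deg unfolding C_def[symmetric] by linarith
  moreover have "(\<rho> + \<epsilon> / 2) * real ((card (V - W) - d) choose (k - d)) \<le> (\<rho> + \<epsilon> / 2) * C"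
    unfolding C_def using \<open>\<rho> \<ge> 0\<close> \<open>\<epsilon> > 0\<close> fV
    by (intro mult_left_mono of_nat_mono binomial_right_mono diff_le_mono card_mono) auto
  ultimately show ?thesis by linarith
qed

text \<open>A disjoint family may repeat the empty set, but no other; nonempty edges therefore give
  injectivity.\<close>

lemma rainbow_pm_imp_perfect_matching:
  assumes pm: "rainbow_pm {1..m} V H" and ne: "\<And>i e. i \<in> {1..m} \<Longrightarrow> e \<in> H i \<Longrightarrow> e \<noteq> {}"
  shows "\<exists>e. rainbow_perfect_matching V m H e"
proof -
  obtain e where e: "\<forall>i\<in>{1..m}. e i \<in> H i" "disjoint_family_on e {1..m}" "\<Union>(e ` {1..m}) = V"
    using pm by (auto simp: rainbow_pm_def)
  have "inj_on e {1..m}"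
  proof (rule inj_onI, rule ccontr)
    fix i j assume ij: "i \<in> {1..m}" "j \<in> {1..m}" "e i = e j" "i \<noteq> j"
    have "e i \<inter> e j = {}" by (rule disjoint_family_onD[OF e(2) ij(1,2,4)])
    then have "e i = {}" using ij(3) by simp
    then show False using ne[OF ij(1)] e(1) ij(1) by blast
  qed
  moreover have "disjoint (e ` {1..m})" by (rule disjoint_family_on_disjoint_image[OF e(2)])
  ultimately show ?thesis using e unfolding rainbow_perfect_matching_def perfect_matching_def by blast
qed

theorem theorem1p6:
  fixes \<epsilon> :: real and k d :: nat
  assumes "\<epsilon> > 0" and "1 \<le> d" and "d \<le> k - 1"
  shows "\<exists>n0 :: nat. \<forall>n>n0. k dvd n \<longrightarrow>
    (\<forall>(V :: 'a set) (H :: nat \<Rightarrow> 'a set set).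
       finite V \<and> card V = n \<and> k_graph_system k V (n div k) H \<and>
       (\<forall>i\<in>{1..n div k}. real (min_degree d V (H i))
          \<ge> (max (pfm_threshold k d) (1/2) + \<epsilon>) * real ((n - d) choose (k - d))) \<longrightarrow>
       (\<exists>e. rainbow_perfect_matching V (n div k) H e))"
proof -
  have dk: "d < k" and k2: "k \<ge> 2" using assms(2,3) by auto
  have k0: "real k > 0" using k2 by simp
  \<comment> \<open>The bound 1/2 leaves at least half of the colours outside the absorbing family;
    the other bound is the one in \<open>degree_after_deletion\<close>.\<close>
  define \<theta> where "\<theta> = min (1/2) (\<epsilon> / 2 * (1 / (2 * real k)) ^ (k - d))"
  have \<theta>: "\<theta> > 0" "\<theta> \<le> 1/2" "\<theta> \<le> \<epsilon> / 2 * (1 / (2 * real k)) ^ (k - d)" using assms(1) k0 by (auto simp: \<theta>_def)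
  from absorbing_family[OF k2 \<open>\<epsilon> > 0\<close> \<theta>(1), where 'a = 'a and 'c = nat]
  obtain \<sigma> m1 where \<sigma>: "\<sigma> > 0" and absorb: "\<forall>(V :: 'a set) (C :: nat set) H. finite C \<and> card V = k * card C \<and> m1 \<le> card C \<and>
      (\<forall>c\<in>C. k_graph k V (H c) \<and> (\<forall>v\<in>V. (1/2 + \<epsilon>) * real ((card V - 1) choose (k - 1)) \<le> real (set_degree (H c) {v}))) \<longrightarrow>
      (\<exists>W D. W \<subseteq> V \<and> D \<subseteq> C \<and> card W = k * card D \<and> real (card D) \<le> \<theta> * real (card C) \<and>
        absorbing k \<sigma> V C H W D)" by (elim exE conjE) (rule that)
  have "\<epsilon> / 2 > 0" using assms(1) by simp
  \<comment> \<open>The error is exactly the proportion \<open>\<sigma>\<close> that can be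
    absorbed, and half of \<open>\<epsilon>\<close> has been kept for the degrees lost with the
    vertices of the absorbing family.\<close>
  from near_perfect_rainbow_matching[OF assms(2) dk this \<sigma>, where 'a = 'a and 'c = nat]
  obtain m2 where near: "\<forall>(V :: 'a set) (C :: nat set) H. finite C \<and> card V = k * card C \<and> m2 \<le> card C \<and>
      (\<forall>c\<in>C. k_graph k V (H c) \<and> degree_ge k d V (pfm_threshold k d + \<epsilon> / 2) (H c)) \<longrightarrow>
      (\<exists>C0 e. C0 \<subseteq> C \<and> (\<forall>c\<in>C0. e c \<in> H c) \<and> disjoint_family_on e C0 \<and> (1 - \<sigma>) * real (card C) \<le> real (card C0))"
    by (elim exE) (rule that)
  \<comment> \<open>Twice \<open>m2\<close>, as possibly only half of the colours remain; the final
    2 ensures \<open>2 * k \<le> card V\<close>.\<close>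
  define m0 where "m0 = m1 + 2 * m2 + 2"
  show ?thesis
  proof (rule exI[of _ "k * m0"], intro allI impI, elim conjE)
    fix n and V :: "'a set" and H :: "nat \<Rightarrow> 'a set set"
    assume n: "k * m0 < n" "k dvd n" and V: "finite V" "card V = n" and sys: "k_graph_system k V (n div k) H"
      and mdeg: "\<forall>i\<in>{1..n div k}. (max (pfm_threshold k d) (1/2) + \<epsilon>) * real ((n - d) choose (k - d)) \<le> real (min_degree d V (H i))"
    define \<rho> where "\<rho> = max (pfm_threshold k d) (1/2)"
    have \<rho>: "\<rho> \<ge> 1/2" "\<rho> \<ge> pfm_threshold k d" by (auto simp: \<rho>_def)
    define m where "m = n div k"
    have nm: "n = k * m" using n(2) by (simp add: m_def)
    have mm: "m0 < m" using n(1) unfolding nm by simp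
    define C where "C = {1..m}"
    have C: "finite C" "card C = m" by (simp_all add: C_def)
    have cV: "card V = k * card C" using V(2) nm C by simp
    have n2k: "2 * k \<le> card V"
    proof -
      have "k * 2 \<le> k * m" using mm by (intro mult_left_mono) (auto simp: m0_def)
      then show ?thesis using cV C by (simp add: mult.commute)
    qed
    have kH: "k_graph k V (H c)" if "c \<in> C" for c using sys that by (simp add: k_graph_system_def C_def m_def)
    have deg: "(\<rho> + \<epsilon>) * real ((card V - d) choose (k - d)) \<le> real (set_degree (H c) S)"
      if "c \<in> C" "S \<subseteq> V" "card S = d" for c S
    proof -
      have "(\<rho> + \<epsilon>) * real ((card V - d) choose (k - d)) \<le> real (min_degree d V (H c))"
        using mdeg that(1) V(2) by (simp add: \<rho>_def C_def m_def)
      also have "\<dots> \<le> real (set_degree (H c) S)"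
        by (rule of_nat_mono, rule min_degree_le_set_degree[OF V(1) that(2,3)])
      finally show ?thesis .
    qed
    have vdeg: "(1/2 + \<epsilon>) * real ((card V - 1) choose (k - 1)) \<le> real (set_degree (H c) {v})" if "c \<in> C" "v \<in> V" for c v
    proof -
      have "(1/2 + \<epsilon>) * real ((card V - 1) choose (k - 1)) \<le> (\<rho> + \<epsilon>) * real ((card V - 1) choose (k - 1))"
        using \<rho>(1) by (intro mult_right_mono) auto
      also have "\<dots> \<le> real (set_degree (H c) {v})"
        by (rule vertex_degree_ge[OF kH[OF that(1)] assms(2) dk _ that(2) deg[OF that(1)]]) (use n2k in simp)
      finally show ?thesis .
    qed
    have "m1 \<le> card C" using mm C by (simp add: m0_def)
    then have "\<exists>W D. W \<subseteq> V \<and> D \<subseteq> C \<and> card W = k * card D \<and> real (card D) \<le> \<theta> * real (card C) \<and>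
        absorbing k \<sigma> V C H W D"
      by (intro absorb[rule_format] conjI ballI C(1) cV kH vdeg)
    then obtain W D where W: "W \<subseteq> V" "D \<subseteq> C" "card W = k * card D" "real (card D) \<le> \<theta> * real (card C)"
      and abs: "absorbing k \<sigma> V C H W D" by (elim exE conjE) (rule that)
    have fWD: "finite W" "finite D" using W(1,2) V(1) C(1) finite_subset by auto
    define H' where "H' c = {e\<in>H c. e \<subseteq> V - W}" for c
    have cCD: "card (C - D) = card C - card D" by (rule card_Diff_subset[OF fWD(2) W(2)])
    have cDC: "card D \<le> card C" by (rule card_mono[OF C(1) W(2)])
    have cVW: "card (V - W) = k * card (C - D)"
      unfolding cCD using card_Diff_subset[OF fWD(1) W(1)] cV W(3) by (simp add: diff_mult_distrib2)
    have m2: "m2 \<le> card (C - D)"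
    proof -
      have "\<theta> * real (card C) \<le> (1/2) * real (card C)" using \<theta>(2) by (intro mult_right_mono) auto
      then have "2 * real (card D) \<le> real (card C)" using W(4) by linarith
      then have "real (2 * card D) \<le> real (card C)" by simp
      then have "2 * card D \<le> card C" by (simp only: of_nat_le_iff)
      moreover have "2 * m2 \<le> card C" using mm C by (simp add: m0_def)
      ultimately show ?thesis unfolding cCD by presburger
    qed
    have Wsmall: "real (card W) \<le> \<theta> * real (card V)"
    proof -
      have "real k * real (card D) \<le> real k * (\<theta> * real (card C))" using W(4) by (intro mult_left_mono) auto
      then show ?thesis by (simp add: W(3) cV mult_ac)
    qed
    have "k_graph k (V - W) (H' c) \<and> degree_ge k d (V - W) (pfm_threshold k d + \<epsilon> / 2) (H' c)"
      if c: "c \<in> C - D" for c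
    proof (intro conjI allI impI)
      show "k_graph k (V - W) (H' c)" using kH[of c] c by (auto simp: k_graph_def H'_def)
    next
      fix S assume S: "S \<subseteq> V - W \<and> card S = d"
      have cC: "c \<in> C" and SV: "S \<subseteq> V" using c S by auto
      have "(pfm_threshold k d + \<epsilon> / 2) * real ((card (V - W) - d) choose (k - d)) \<le> (\<rho> + \<epsilon> / 2) * real ((card (V - W) - d) choose (k - d))"
        using \<rho>(2) by (intro mult_right_mono) auto
      also have "\<dots> \<le> real (set_degree (H' c) S)"
        unfolding H'_def
        by (rule degree_after_deletion[OF kH[OF cC] assms(2) dk n2k W(1) Wsmall \<theta>(3) _ assms(1)])
          (use \<rho>(1) S deg[OF cC SV] in auto)
      finally show "(pfm_threshold k d + \<epsilon> / 2) * real ((card (V - W) - d) choose (k - d)) \<le> real (set_degree (H' c) S)" .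
    qed
    then have "\<forall>c\<in>C - D. k_graph k (V - W) (H' c) \<and> degree_ge k d (V - W) (pfm_threshold k d + \<epsilon> / 2) (H' c)"
      by (rule ballI)
    then have "\<exists>C0 e. C0 \<subseteq> C - D \<and> (\<forall>c\<in>C0. e c \<in> H' c) \<and> disjoint_family_on e C0 \<and> (1 - \<sigma>) * real (card (C - D)) \<le> real (card C0)"
      using near[THEN spec, of "V - W", THEN spec, of "C - D", THEN spec, of H', THEN mp,
          OF conjI[OF finite_Diff[OF C(1)] conjI[OF cVW conjI[OF m2]]]] by blast
    then obtain C0 e where C0: "C0 \<subseteq> C - D" "\<forall>c\<in>C0. e c \<in> H' c" "disjoint_family_on e C0"
      "(1 - \<sigma>) * real (card (C - D)) \<le> real (card C0)" by (elim exE conjE) (rule that)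
    define U where "U = \<Union>(e ` C0)"
    have pm0: "rainbow_pm C0 U H" unfolding rainbow_pm_def U_def using C0(2,3) by (auto simp: H'_def)
    have UV: "U \<subseteq> V - W" using C0(2) by (auto simp: U_def H'_def)
    have fin0: "finite C0" "finite U"
      using finite_subset[OF C0(1)] finite_subset[OF UV] C(1) V(1) by auto
    have cU: "card U = k * card C0"
    proof (rule rainbow_pm_card[OF pm0 fin0(1)])
      show "finite e \<and> card e = k" if "c \<in> C0" "e \<in> H c" for c e
        using kH[of c] that C0(1) finite_subset[OF _ V(1), of e] by (auto simp: k_graph_def)
    qed
    define C' where "C' = C - D - C0"
    define V' where "V' = V - W - U"
    have cC': "card C' = card (C - D) - card C0" unfolding C'_def by (rule card_Diff_subset[OF fin0(1) C0(1)])
    have cV': "card V' = k * card C'"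
      unfolding V'_def cC' using card_Diff_subset[OF fin0(2) UV] cVW cU by (simp add: diff_mult_distrib2)
    have "card C0 \<le> card (C - D)" using C0(1) C(1) by (intro card_mono) auto
    then have "real (card C') = real (card (C - D)) - real (card C0)" unfolding cC' by (rule of_nat_diff)
    also have "\<dots> \<le> \<sigma> * real (card (C - D))" using C0(4) by (simp add: left_diff_distrib)
    also have "\<dots> \<le> \<sigma> * real (card C)" using \<sigma> C(1) by (intro mult_left_mono of_nat_mono card_mono) auto
    finally have small: "real (card C') \<le> \<sigma> * real (card C)" .
    have "rainbow_pm (D \<union> C') (W \<union> V') H"
      by (rule abs[rule_format]) (use cV' small in \<open>auto simp: C'_def V'_def\<close>)
    then have "rainbow_pm ((D \<union> C') \<union> C0) ((W \<union> V') \<union> U) H"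
      by (rule rainbow_pm_Un[OF _ pm0]) (use C0(1) UV in \<open>auto simp: C'_def V'_def\<close>)
    moreover have "(D \<union> C') \<union> C0 = C" "(W \<union> V') \<union> U = V" using W(1,2) C0(1) UV by (auto simp: C'_def V'_def)
    ultimately have "rainbow_pm {1..m} V H" by (simp add: C_def)
    then have "\<exists>e. rainbow_perfect_matching V m H e"
    proof (rule rainbow_pm_imp_perfect_matching)
      show "e \<noteq> {}" if "i \<in> {1..m}" "e \<in> H i" for i e
        using kH[of i] that k2 by (auto simp: k_graph_def C_def)
    qed
    then show "\<exists>e. rainbow_perfect_matching V (n div k) H e" by (simp add: m_def)
  qed
qed

end
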